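(* Let $1\le p<\infty$, $0<r<\infty$, $0<q\le\infty$, $\frac1s:=\left(\frac1r-\frac1p\right)_+$. Let $u,v,w\in\mathfrak M^+$ with $\int_0^t u<\infty$ for all $t>0$, and let $k$ be an Oinarov kernel with constant $D$. Let $C_{\mathbf S}\in[0,\infty]$ be the least constant such that $\|\mathbf Sf\|_{L^r_u}\le C_{\mathbf S}\|f\|_{L^p_v}$ for all $f\in\mathfrak M^+$, where $$(\mathbf Sf)(x)=\left(\int_x^\infty k(y,x)w(y)\left(\int_y^\infty f(z)\,dz\right)^q dy\right)^{1/q}\ (q<\infty),\qquad (\mathbf Sf)(x)=\operatorname*{ess\,sup}_{y\ge x} k(y,x)w(y)\int_y^\infty f(z)\,dz\ (q=\infty).$$ If $q<\infty$, let $\mathbb B_0,\mathbb B_1\in[0,\infty]$ be the least constants such that for all $f\in\mathfrak M^+$ $$\left(\int_0^\infty u(x)\left(\int_x^{\sigma^3(x)} k(y,x)w(y)\,dy\right)^{\frac rq}\left(\int_{\sigma^3(x)}^\infty f\right)^r dx\right)^{\frac1r}\le \mathbb B_0\|f\|_{L^p_v},$$ $$\left(\int_0^\infty u(x)[k(\sigma^2(x),x)]^{\frac rq}\left(\int_{\sigma^2(x)}^\infty w(y)\left(\int_y^\infty f\right)^q dy\right)^{\frac rq} dx\right)^{\frac1r}\le \mathbb B_1\|f\|_{L^p_v};$$ if $q=\infty$, let $\mathbb B_0,\mathbb B_1\in[0,\infty]$ be the least constants such that for all $f\in\mathfrak M^+$ $$\left(\int_0^\infty u(x)\left[\operatorname*{ess\,sup}_{x\le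 y\le\sigma^3(x)}k(y,x)w(y)\right]^r\left(\int_{\sigma^3(x)}^\infty f\right)^r dx\right)^{\frac1r}\le \mathbb B_0\|f\|_{L^p_v},$$ $$\left(\int_0^\infty u(x)[k(\sigma^2(x),x)]^r\left(\operatorname*{ess\,sup}_{y\ge\sigma^2(x)}w(y)\int_y^\infty f\right)^r dx\right)^{\frac1r}\le \mathbb B_1\|f\|_{L^p_v}.$$ Let $$\mathbb B_2:=\begin{cases}\displaystyle\sup_{t>0}\left(\int_0^t u\right)^{\frac1r}\|\mathbf H^*_t\|_{L^p_v\to L^q_{w(\cdot)k(\cdot,t)}},& p\le r,\\[2mm] \displaystyle\left(\int_0^\infty u(x)\left(\int_0^x u\right)^{\frac sp}\|\mathbf H^*_{\sigma^{-1}(x),\sigma^2(x)}\|^s_{L^p_v\to L^q_{w(\cdot)k(\cdot,\sigma^{-1}(x))}}\,dx\right)^{\frac1s},& r<p.\end{cases}$$ Then $C_{\mathbf S}<\infty$ if and only if $\mathbb B:=\mathbb B_0+\mathbb B_1+\mathbb B_2<\infty$. Moreover, $C_{\mathbf S}\approx \mathbb B$, i.e. each side is bounded by the other times a positive constant depending only on $p,q,r,D$.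
   Context: $\mathfrak M$ is the set of measurable functions on $[0,\infty)$, $\mathfrak M^+\subset\mathfrak M$ the non-negative ones. For $0<p<\infty$, $v\in\mathfrak M^+$: $\|f\|_{L^p_v}:=\left(\int_0^\infty|f|^pv\right)^{1/p}$; for $p=\infty$: $\|f\|_{L^\infty_v}:=\operatorname{ess\,sup}_{x\ge0}v(x)|f(x)|$. $L^q_{w(\cdot)k(\cdot,t)}$ is the weighted space with weight $y\mapsto w(y)k(y,t)$. For a positive operator $H$ on $\mathfrak M^+$ and a weight $\omega$, $\|H\|_{L^p_v\to L^q_\omega}\in[0,\infty]$ is the least $C$ with $\|Hf\|_{L^q_\omega}\le C\|f\|_{L^p_v}$ for all $f\in\mathfrak M^+$. Expressions $0\cdot\infty$, $\frac\infty\infty$, $\frac00$ are taken to be $0$. $(a)_+=\max(a,0)$ ($s$ is used only when $r<p$). Oinarov kernel with constant $D\ge1$: a Borel function $k(x,y)\ge0$ on $[0,\infty)^2$ with $k(x,y)=0$ if $x<y$ and $\frac1D(k(x,z)+k(z,y))\le k(x,y)\le D(k(x,z)+k(z,y))$ for all $x\ge z\ge y\ge0$. The functions $\sigma:[0,\infty)\to[0,\infty]$ and $\sigma^{-1}:[0,\infty)\to[0,\infty)$ are defined (with $\inf\varnothing=\infty$) by $$\sigma(x):=\inf\left\{y>0:\int_0^y u\ge2\int_0^x u\right\},\qquad \sigma^{-1}(x):=\inf\left\{y>0:\int_0^y u\ge\tfrac12\int_0^x u\right\}.$$ Put $\sigma(\infty):=\infty$; $\sigma^m$ is the $m$-fold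 composition of $\sigma$. At points $x$ with $\sigma^2(x)=\infty$ the integral (or essential supremum) over $y\ge\sigma^2(x)$ is $0$ and the integrand in the inequality defining $\mathbb B_1$ is $0$; similarly, the integrand in the inequality defining $\mathbb B_0$ is $0$ where $\sigma^3(x)=\infty$. For $0<c<d\le\infty$ and $f\in\mathfrak M^+$: $$(\mathbf H^*_{c,d}f)(x):=\chi_{[c,d)}(x)\int_x^{\sigma(d)} f(z)\,dz,\qquad (\mathbf H^*_cf)(x):=\chi_{[c,\infty)}(x)\int_x^\infty f(z)\,dz.$$ (In $\mathbb B_2$ with $r<p$, the integrand is $0$ at points $x$ with $\int_0^xu=0$.) *)

theory Defs
  imports "HOL-Probability.Essential_Supremum"
begin

text \<open>Non-negative measurable functions on \<open>[0,\<infinity>)\<close> are Lebesgue measurable functions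
  \<open>real \<Rightarrow> ennreal\<close>; their values on the negative half-line are never used. In \<open>ennreal\<close>,
  \<open>0 * \<infinity> = 0\<close>.\<close>

definition Mplus :: "(real \<Rightarrow> ennreal) set" where
  "Mplus = borel_measurable (lebesgue_on {0..})"

text \<open>Powers of extended non-negative reals. Only positive exponents are used, for which
  \<open>0\<close> and \<open>\<infinity>\<close> are mapped to themselves.\<close>

definition epowr :: "ennreal \<Rightarrow> real \<Rightarrow> ennreal"  (infixr \<open>epowr\<close> 80) where
  "x epowr a = (if x = \<infinity> then \<infinity> else ennreal (enn2real x powr a))"

definition wnorm :: "ennreal \<Rightarrow> (real \<Rightarrow> ennreal) \<Rightarrow> (real \<Rightarrow> ennreal) \<Rightarrow> ennreal" where
  "wnorm p v f =
    (if p = \<infinity> then esssup (lebesgue_on {0..}) (\<lambda>x. v x * f x)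
     else (\<integral>\<^sup>+x. f x epowr enn2real p * v x \<partial>lebesgue_on {0..}) epowr (1 / enn2real p))"

text \<open>The infimum is \<open>\<infinity>\<close> if no constant is admissible, which includes the case that
  \<open>\<Phi> f > 0\<close> for some \<open>f\<close> of norm \<open>0\<close>.\<close>

definition least_const ::
  "ennreal \<Rightarrow> (real \<Rightarrow> ennreal) \<Rightarrow> ((real \<Rightarrow> ennreal) \<Rightarrow> ennreal) \<Rightarrow> ennreal" where
  "least_const p v \<Phi> = Inf {C. \<forall>f\<in>Mplus. \<Phi> f \<le> C * wnorm p v f}"

definition opnorm ::
  "ennreal \<Rightarrow> (real \<Rightarrow> ennreal) \<Rightarrow> ennreal \<Rightarrow> (real \<Rightarrow> ennreal) \<Rightarrow>
   ((real \<Rightarrow> ennreal) \<Rightarrow> (real \<Rightarrow> ennreal)) \<Rightarrow> ennreal" where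
  "opnorm p v q \<omega> H = least_const p v (\<lambda>f. wnorm q \<omega> (H f))"

definition oinarov_kernel :: "real \<Rightarrow> (real \<Rightarrow> real \<Rightarrow> ennreal) \<Rightarrow> bool" where
  "oinarov_kernel D k \<longleftrightarrow>
     D \<ge> 1 \<and>
     (\<lambda>(x, y). k x y) \<in> borel_measurable (restrict_space borel ({0..} \<times> {0..})) \<and>
     (\<forall>x y. 0 \<le> x \<longrightarrow> x < y \<longrightarrow> k x y = 0) \<and>
     (\<forall>x z y. 0 \<le> y \<longrightarrow> y \<le> z \<longrightarrow> z \<le> x \<longrightarrow>
        ennreal (1 / D) * (k x z + k z y) \<le> k x y \<and>
        k x y \<le> ennreal D * (k x z + k z y))"

definition prim :: "(real \<Rightarrow> ennreal) \<Rightarrow> real \<Rightarrow> ennreal" where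
  "prim u x = (\<integral>\<^sup>+z\<in>{0..x}. u z \<partial>lebesgue)"

text \<open>The map \<open>\<sigma>\<close>, extended by \<open>\<sigma>(\<infinity>) = \<infinity>\<close> so that it can be iterated with \<open>^^\<close>.\<close>

definition sig :: "(real \<Rightarrow> ennreal) \<Rightarrow> ereal \<Rightarrow> ereal" where
  "sig u x = (if x = \<infinity> then \<infinity>
     else Inf (ereal ` {y. 0 < y \<and> prim u y \<ge> 2 * prim u (real_of_ereal x)}))"

text \<open>The set below contains all \<open>y > 0\<close> with \<open>y \<ge> x\<close>, hence this is a genuine infimum in the reals.\<close>

definition sig_inv :: "(real \<Rightarrow> ennreal) \<Rightarrow> real \<Rightarrow> real" where
  "sig_inv u x = Inf {y. 0 < y \<and> prim u y \<ge> prim u x / 2}"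

definition Hstar :: "real \<Rightarrow> (real \<Rightarrow> ennreal) \<Rightarrow> real \<Rightarrow> ennreal" where
  "Hstar c f x = indicator {c..} x * (\<integral>\<^sup>+z\<in>{x..}. f z \<partial>lebesgue)"

definition Hstar_between ::
  "(real \<Rightarrow> ennreal) \<Rightarrow> real \<Rightarrow> ereal \<Rightarrow> (real \<Rightarrow> ennreal) \<Rightarrow> real \<Rightarrow> ennreal" where
  "Hstar_between u c d f x =
     indicator {y. c \<le> y \<and> ereal y < d} x *
     (\<integral>\<^sup>+z\<in>{z. x \<le> z \<and> ereal z \<le> sig u d}. f z \<partial>lebesgue)"

definition S_op ::
  "ennreal \<Rightarrow> (real \<Rightarrow> ennreal) \<Rightarrow> (real \<Rightarrow> real \<Rightarrow> ennreal) \<Rightarrow> (real \<Rightarrow> ennreal) \<Rightarrow> real \<Rightarrow> ennreal"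
where
  "S_op q w k f x =
    (if q = \<infinity> then
       esssup (lebesgue_on {x..}) (\<lambda>y. k y x * w y * (\<integral>\<^sup>+z\<in>{y..}. f z \<partial>lebesgue))
     else
       (\<integral>\<^sup>+y\<in>{x..}. k y x * w y * (\<integral>\<^sup>+z\<in>{y..}. f z \<partial>lebesgue) epowr enn2real q \<partial>lebesgue)
         epowr (1 / enn2real q))"

definition C_S ::
  "real \<Rightarrow> real \<Rightarrow> ennreal \<Rightarrow> (real \<Rightarrow> ennreal) \<Rightarrow> (real \<Rightarrow> ennreal) \<Rightarrow> (real \<Rightarrow> ennreal) \<Rightarrow>
   (real \<Rightarrow> real \<Rightarrow> ennreal) \<Rightarrow> ennreal" where
  "C_S p r q u v w k = opnorm (ennreal p) v (ennreal r) u (S_op q w k)"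

text \<open>In the two integrands below, the branch \<open>_ \<Rightarrow> 0\<close> is the case \<open>\<sigma>\<^sup>3(x) = \<infinity>\<close>, respectively
  \<open>\<sigma>\<^sup>2(x) = \<infinity>\<close>.\<close>

definition B0_integrand ::
  "real \<Rightarrow> ennreal \<Rightarrow> (real \<Rightarrow> ennreal) \<Rightarrow> (real \<Rightarrow> ennreal) \<Rightarrow> (real \<Rightarrow> real \<Rightarrow> ennreal) \<Rightarrow>
   (real \<Rightarrow> ennreal) \<Rightarrow> real \<Rightarrow> ennreal" where
  "B0_integrand r q u w k f x =
    (case (sig u ^^ 3) (ereal x) of
       ereal t \<Rightarrow>
         u x *
         (if q = \<infinity> then esssup (lebesgue_on {x..t}) (\<lambda>y. k y x * w y) epowr r
          else (\<integral>\<^sup>+y\<in>{x..t}. k y x * w y \<partial>lebesgue) epowr (r / enn2real q)) *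
         (\<integral>\<^sup>+z\<in>{t..}. f z \<partial>lebesgue) epowr r
     | _ \<Rightarrow> 0)"

definition B1_integrand ::
  "real \<Rightarrow> ennreal \<Rightarrow> (real \<Rightarrow> ennreal) \<Rightarrow> (real \<Rightarrow> ennreal) \<Rightarrow> (real \<Rightarrow> real \<Rightarrow> ennreal) \<Rightarrow>
   (real \<Rightarrow> ennreal) \<Rightarrow> real \<Rightarrow> ennreal" where
  "B1_integrand r q u w k f x =
    (case (sig u ^^ 2) (ereal x) of
       ereal t \<Rightarrow>
         u x *
         (if q = \<infinity> then
            k t x epowr r *
            esssup (lebesgue_on {t..}) (\<lambda>y. w y * (\<integral>\<^sup>+z\<in>{y..}. f z \<partial>lebesgue)) epowr r
          else
            k t x epowr (r / enn2real q) *
            (\<integral>\<^sup>+y\<in>{t..}. w y * (\<integral>\<^sup>+z\<in>{y..}. f z \<partial>lebesgue) epowr enn2real q \<partial>lebesgue)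
              epowr (r / enn2real q))
     | _ \<Rightarrow> 0)"

definition B0 ::
  "real \<Rightarrow> real \<Rightarrow> ennreal \<Rightarrow> (real \<Rightarrow> ennreal) \<Rightarrow> (real \<Rightarrow> ennreal) \<Rightarrow> (real \<Rightarrow> ennreal) \<Rightarrow>
   (real \<Rightarrow> real \<Rightarrow> ennreal) \<Rightarrow> ennreal" where
  "B0 p r q u v w k = least_const (ennreal p) v
     (\<lambda>f. (\<integral>\<^sup>+x. B0_integrand r q u w k f x \<partial>lebesgue_on {0..}) epowr (1 / r))"

definition B1 ::
  "real \<Rightarrow> real \<Rightarrow> ennreal \<Rightarrow> (real \<Rightarrow> ennreal) \<Rightarrow> (real \<Rightarrow> ennreal) \<Rightarrow> (real \<Rightarrow> ennreal) \<Rightarrow>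
   (real \<Rightarrow> real \<Rightarrow> ennreal) \<Rightarrow> ennreal" where
  "B1 p r q u v w k = least_const (ennreal p) v
     (\<lambda>f. (\<integral>\<^sup>+x. B1_integrand r q u w k f x \<partial>lebesgue_on {0..}) epowr (1 / r))"

definition B2 ::
  "real \<Rightarrow> real \<Rightarrow> ennreal \<Rightarrow> (real \<Rightarrow> ennreal) \<Rightarrow> (real \<Rightarrow> ennreal) \<Rightarrow> (real \<Rightarrow> ennreal) \<Rightarrow>
   (real \<Rightarrow> real \<Rightarrow> ennreal) \<Rightarrow> ennreal" where
  "B2 p r q u v w k =
    (if p \<le> r then
       (SUP t\<in>{0<..}. prim u t epowr (1 / r) *
          opnorm (ennreal p) v q (\<lambda>y. w y * k y t) (Hstar t))
     else
       (let s = 1 / max (1 / r - 1 / p) 0 in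
        (\<integral>\<^sup>+x. (if prim u x = 0 then 0
                else u x * prim u x epowr (s / p) *
                     opnorm (ennreal p) v q (\<lambda>y. w y * k y (sig_inv u x))
                       (Hstar_between u (sig_inv u x) ((sig u ^^ 2) (ereal x))) epowr s)
           \<partial>lebesgue_on {0..}) epowr (1 / s)))"

end

theory Submission
  imports Defs
begin

text \<open>
  Write \<open>U(x) = \<integral>\<^sub>0\<^sup>x u\<close> and cut the half-line at the points \<open>x\<^sub>n\<close> with \<open>U(x\<^sub>n) = 2\<^sup>n\<close>. On the
  blocks \<open>A\<^sub>n = [x\<^sub>n, x\<^sub>n\<^sub>+\<^sub>1)\<close> every quantity in the theorem is, up to constants,
  monotone in \<open>x\<close>, so all outer integrals can be compared with sums \<open>\<Sum>\<^sub>n 2\<^sup>n c\<^sub>n\<close>. Since only step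
  functions are compared, measurability in the outer variable is never needed.

  Sufficiency. Iterating the Oinarov condition along a chain gives, for \<open>x \<in> A\<^sub>n\<close> and \<open>y \<in> A\<^sub>m\<close>, a
  bound of \<open>k(y, x)\<close> by a constant times the sum of \<open>\<lambda>\<^sup>m\<^sup>-\<^sup>n k(y, x\<^sub>m\<^sub>-\<^sub>1)\<close> and of all
  \<open>\<lambda>\<^sup>j\<^sup>-\<^sup>n k(x\<^sub>j\<^sub>+\<^sub>1, x\<^sub>j)\<close> with \<open>n \<le> j \<le> m - 2\<close>, where \<open>\<lambda> > 1\<close> is arbitrarily close to \<open>1\<close>.
  The factors \<open>\<lambda>\<^sup>i\<close> are absorbed by the geometric weight \<open>2\<^sup>n\<close>. The terms with
  \<open>k(x\<^sub>j\<^sub>+\<^sub>1, x\<^sub>j)\<close> are controlled by \<open>B\<^sub>1\<close>. In the terms local to \<open>A\<^sub>m\<close> the integral of \<open>f\<close> is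
  split at \<open>x\<^sub>m\<^sub>+\<^sub>2\<close>: the part beyond is controlled by \<open>B\<^sub>0\<close>, the part before by \<open>B\<^sub>2\<close> together with
  \<open>\<ell>\<^sup>p \<subseteq> \<ell>\<^sup>r\<close> for \<open>p \<le> r\<close> or Hoelder's inequality for \<open>r < p\<close>.

  Necessity is pointwise for \<open>B\<^sub>0\<close>, \<open>B\<^sub>1\<close> and, if \<open>p \<le> r\<close>, for \<open>B\<^sub>2\<close>. If \<open>r < p\<close>, test functions
  that nearly attain the local operator norms are superposed with suitable coefficients.
\<close>

section \<open>Arithmetic of powers on [0, \<infinity>]\<close>

lemma epowr_zero [simp]: "0 epowr a = 0"
  and epowr_top [simp]: "top epowr a = top"
  and epowr_one [simp]: "x epowr 1 = x"
  by (auto simp add: epowr_def less_top)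

lemma epowr_ennreal: "0 \<le> x \<Longrightarrow> ennreal x epowr a = ennreal (x powr a)"
  by (simp add: epowr_def)

lemma epowr_eq_0_iff [simp]: "x epowr a = 0 \<longleftrightarrow> x = 0"
  by (cases x) (auto simp: epowr_def)

lemma epowr_eq_top_iff [simp]: "x epowr a = top \<longleftrightarrow> x = top"
  by (cases x) (auto simp: epowr_def)

lemma epowr_less_top_iff [simp]: "x epowr a < top \<longleftrightarrow> x < top"
  by (simp add: less_top[symmetric])

lemma epowr_epowr: "(x epowr a) epowr b = x epowr (a * b)"
  by (cases x) (auto simp: epowr_def powr_powr)

text \<open>Exponents of any sign are covered because 0 and \<infinity> are fixed by every power,
  and both sides then agree.\<close>

lemma epowr_add: "x epowr (a + b) = x epowr a * x epowr b"
  by (cases x) (auto simp: epowr_def powr_add ennreal_mult ennreal_top_mult)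

lemma epowr_mult: "(x * y) epowr a = x epowr a * y epowr a"
proof (cases "x = top \<or> y = top")
  case True
  then show ?thesis
    by (cases "x = 0"; cases "y = 0") (auto simp: ennreal_top_mult ennreal_mult_top)
next
  case False
  then obtain x' y' where "x = ennreal x'" "y = ennreal y'" "0 \<le> x'" "0 \<le> y'"
    by (cases x; cases y) auto
  then show ?thesis
    by (simp add: epowr_ennreal powr_mult flip: ennreal_mult)
qed

lemma epowr_mono: "x \<le> y \<Longrightarrow> 0 \<le> a \<Longrightarrow> x epowr a \<le> y epowr a"
  by (cases x; cases y) (auto simp: epowr_def powr_mono2 top_unique)

text \<open>The powers with exponents a and 1 / a are mutually inverse order isomorphisms of
  [0, \<infinity>]. Roots are moved across inequalities in this way throughout.\<close>

lemma le_epowr_iff: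
  assumes "0 < a"
  shows "x \<le> y epowr (1 / a) \<longleftrightarrow> x epowr a \<le> y"
proof
  assume "x \<le> y epowr (1 / a)"
  from epowr_mono[OF this, of a] show "x epowr a \<le> y"
    using assms by (simp add: epowr_epowr)
next
  assume "x epowr a \<le> y"
  from epowr_mono[OF this, of "1 / a"] show "x \<le> y epowr (1 / a)"
    using assms by (simp add: epowr_epowr)
qed

lemma epowr_le_iff:
  assumes "0 < a"
  shows "x epowr (1 / a) \<le> y \<longleftrightarrow> x \<le> y epowr a"
  using le_epowr_iff[of "1 / a" x y] assms by simp

lemma epowr_mono_iff: "0 < a \<Longrightarrow> x epowr a \<le> y epowr a \<longleftrightarrow> x \<le> y"
  using le_epowr_iff[of a x "y epowr a"] by (simp add: epowr_epowr)

text \<open>Comparing x + y with twice the maximum gives one constant for concave and convex powers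
  alike.\<close>

lemma epowr_add_le:
  assumes "0 < a"
  shows "(x + y) epowr a \<le> 2 epowr a * (x epowr a + y epowr a)"
proof -
  have "x + y \<le> 2 * max x y"
    by (metis add_mono max.cobounded1 max.cobounded2 mult_2)
  then have "(x + y) epowr a \<le> 2 epowr a * (max x y) epowr a"
    using assms by (metis epowr_mono epowr_mult less_imp_le)
  also have "\<dots> \<le> 2 epowr a * (x epowr a + y epowr a)"
    by (intro mult_left_mono) (auto simp: max_def)
  finally show ?thesis .
qed

lemma epowr_measurable [measurable]:
  assumes [measurable]: "f \<in> borel_measurable M"
  shows "(\<lambda>x. f x epowr a) \<in> borel_measurable M"
  unfolding epowr_def by measurable

section \<open>Sums over the integers\<close>

text \<open>Counting measure makes Tonelli, additivity and reindexing by bijections special cases of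
  integration theory.\<close>

abbreviation zsum :: "(int \<Rightarrow> ennreal) \<Rightarrow> ennreal" where
  "zsum c \<equiv> (\<integral>\<^sup>+n. c n \<partial>count_space UNIV)"

lemma zsum_mono: "(\<And>n. c n \<le> d n) \<Longrightarrow> zsum c \<le> zsum d"
  by (rule nn_integral_mono)

lemma zsum_ge: "c n \<le> zsum c"
proof -
  have "c n = zsum (\<lambda>m. c m * indicator {n} m)"
    by (subst nn_integral_count_space'[of "{n}"]) auto
  also have "\<dots> \<le> zsum c"
    by (rule nn_integral_mono) (auto split: split_indicator)
  finally show ?thesis .
qed

lemma zsum_cmult: "zsum (\<lambda>n. a * c n) = a * zsum c"
  by (rule nn_integral_cmult) simp

lemma zsum_shift: "zsum (\<lambda>n. c (n + i)) = zsum c"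
proof -
  have "bij (\<lambda>n::int. n + i)"
    by (rule bij_betw_byWitness[where f' = "\<lambda>n. n - i"]) auto
  from nn_integral_bij_count_space[OF this, of c] show ?thesis .
qed

lemma zsum_suminf: "zsum (\<lambda>n. \<Sum>i. c n i) = (\<Sum>i. zsum (\<lambda>n. c n i))"
  by (rule nn_integral_suminf) simp

text \<open>Enumerate the integers: each partial sum of the enumeration runs over a finite set.
  Necessity for r < p can therefore work with finite superpositions of test functions.\<close>

lemma zsum_le_if_finite:
  assumes "\<And>K. finite K \<Longrightarrow> (\<Sum>n\<in>K. c n) \<le> b"
  shows "zsum c \<le> b"
proof -
  have "bij int_decode" by (rule bij_int_decode)
  from nn_integral_bij_count_space[OF this, of c]
  have "zsum c = (\<Sum>i. c (int_decode i))"
    by (simp add: nn_integral_count_space_nat)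
  also have "\<dots> \<le> b"
  proof (rule suminf_le_const)
    fix n
    have "(\<Sum>i<n. c (int_decode i)) = (\<Sum>m\<in>int_decode ` {..<n}. c m)"
      by (subst sum.reindex) (auto intro: inj_on_subset[OF inj_int_decode])
    then show "(\<Sum>i<n. c (int_decode i)) \<le> b"
      using assms by simp
  qed simp
  finally show ?thesis .
qed

text \<open>The embedding of \<open>\<ell>\<^sup>1\<close> into \<open>\<ell>\<^sup>a\<close>: write
  \<open>c n epowr a\<close> as \<open>c n\<close> times \<open>c n epowr (a - 1)\<close> and bound
  the second factor by the power of the whole sum.\<close>

lemma zsum_epowr_le:
  assumes "1 \<le> a"
  shows "zsum (\<lambda>n. c n epowr a) \<le> (zsum c) epowr a"
proof -
  have *: "x epowr a = x * x epowr (a - 1)" for x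
    using epowr_add[of x 1 "a - 1"] by simp
  have "zsum (\<lambda>n. c n epowr a) \<le> zsum (\<lambda>n. zsum c epowr (a - 1) * c n)"
  proof (rule zsum_mono)
    fix n
    have "c n epowr a = c n * c n epowr (a - 1)" by (rule *)
    also have "\<dots> \<le> c n * zsum c epowr (a - 1)"
      using assms by (intro mult_left_mono epowr_mono zsum_ge) auto
    finally show "c n epowr a \<le> zsum c epowr (a - 1) * c n"
      by (simp add: mult.commute)
  qed
  also have "\<dots> = zsum c epowr (a - 1) * zsum c" by (rule zsum_cmult)
  also have "\<dots> = zsum c epowr a" by (simp add: *[of "zsum c"] mult.commute)
  finally show ?thesis .
qed

text \<open>Young's inequality without its weights 1 / a and 1 / b. Whichever of the two powers is
  larger already dominates the product.\<close>

lemma ennreal_mult_le_epowr: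
  assumes "0 < a" "0 < b" "1 / a + 1 / b = 1"
  shows "x * y \<le> x epowr a + y epowr b"
proof -
  have ab: "1 + a / b = a" "1 + b / a = b"
    using assms by (auto simp: field_simps)
  show ?thesis
  proof (cases "x epowr a \<le> y epowr b")
    case True
    then have "x \<le> y epowr (b / a)"
      using le_epowr_iff[of a x "y epowr b"] assms by (simp add: epowr_epowr)
    then have "x * y \<le> y epowr (b / a) * y epowr 1"
      by (simp add: mult_right_mono)
    also have "\<dots> = y epowr b"
      using ab by (simp only: add.commute flip: epowr_add)
    finally show ?thesis by (simp add: add_increasing)
  next
    case False
    then have "y \<le> x epowr (a / b)"
      using le_epowr_iff[of b y "x epowr a"] assms by (simp add: epowr_epowr)
    then have "x * y \<le> x epowr 1 * x epowr (a / b)"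
      by (simp add: mult_left_mono)
    also have "\<dots> = x epowr a"
      using ab by (simp only: flip: epowr_add)
    finally show ?thesis by (simp add: add_increasing2)
  qed
qed

text \<open>Hoelder's inequality: normalise both sequences to total 1 and apply Young termwise. The
  factor 2 is the price of the weightless Young inequality.\<close>

lemma zsum_Holder:
  assumes ab: "0 < a" "0 < b" "a + b = 1" 
    and fin: "zsum c < top" "zsum d < top"
  shows "zsum (\<lambda>n. c n epowr a * d n epowr b) \<le> 2 * (zsum c epowr a * zsum d epowr b)"
proof (cases "zsum c = 0 \<or> zsum d = 0")
  case True
  then have "c n = 0 \<or> d n = 0" for n
    by (auto simp: nn_integral_0_iff_AE AE_count_space)
  then have eq: "c n epowr a * d n epowr b = 0" for n
    by (metis epowr_zero mult_zero_left mult_zero_right)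
  have "zsum (\<lambda>n. c n epowr a * d n epowr b) = 0"
    by (simp only: eq) simp
  then show ?thesis by simp
next
  case False
  define C where "C = zsum c"
  define E where "E = zsum d"
  have CE: "C \<noteq> 0" "E \<noteq> 0" "C \<noteq> top" "E \<noteq> top" using False fin by (auto simp: C_def E_def)
  have inv: "C * inverse C = 1" "E * inverse E = 1"
    using CE by (simp_all add: ennreal_divide_self less_top flip: divide_ennreal_def)
  have "zsum (\<lambda>n. c n epowr a * d n epowr b)
      \<le> zsum (\<lambda>n. (C epowr a * E epowr b) * (inverse C * c n) + (C epowr a * E epowr b) * (inverse E * d n))"
  proof (rule zsum_mono)
    fix n
    have "c n epowr a * d n epowr b = (C * (inverse C * c n)) epowr a * (E * (inverse E * d n)) epowr b"
      by (simp add: inv flip: mult.assoc)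
    also have "\<dots> = C epowr a * E epowr b * ((inverse C * c n) epowr a * (inverse E * d n) epowr b)"
      by (simp add: epowr_mult ac_simps)
    also have "\<dots> \<le> C epowr a * E epowr b * (inverse C * c n + inverse E * d n)"
      using ennreal_mult_le_epowr[of "1 / a" "1 / b" "(inverse C * c n) epowr a" "(inverse E * d n) epowr b"] ab
      by (intro mult_left_mono) (auto simp: epowr_epowr)
    finally show "c n epowr a * d n epowr b \<le> (C epowr a * E epowr b) * (inverse C * c n) + (C epowr a * E epowr b) * (inverse E * d n)"
      by (simp add: distrib_left)
  qed
  also have "\<dots> = (C epowr a * E epowr b) * (inverse C * C) + (C epowr a * E epowr b) * (inverse E * E)"
    by (simp add: nn_integral_add zsum_cmult flip: C_def E_def)
  also have "\<dots> = 2 * (C epowr a * E epowr b)"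
    using inv by (simp add: mult.commute[of "inverse _"] mult_2)
  finally show ?thesis by (simp add: C_def E_def)
qed

section \<open>Powers of two and a discrete Hardy inequality\<close>

definition P :: "int \<Rightarrow> ennreal" where
  "P n = ennreal (2 powr real_of_int n)"

lemma P_pos [simp]: "0 < P n" "P n \<noteq> 0" and P_less_top [simp]: "P n < top" "P n \<noteq> top"
  by (auto simp: P_def)

lemma P_add_nat: "P (n + int i) = 2 ^ i * P n"
proof -
  have "P (n + int i) = ennreal (2 ^ i * (2 powr real_of_int n))"
    by (simp add: P_def powr_add powr_realpow mult.commute)
  also have "\<dots> = ennreal (2 ^ i) * P n"
    unfolding P_def by (rule ennreal_mult) auto
  also have "ennreal (2 ^ i) = 2 ^ i"
    by (metis ennreal_numeral ennreal_power zero_le_numeral)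
  finally show ?thesis .
qed

lemma P_Suc: "P (n + 1) = 2 * P n" "P (n + 2) = 4 * P n" "P (n + 3) = 8 * P n"
  using P_add_nat[of n 1] P_add_nat[of n 2] P_add_nat[of n 3] by auto

lemma P_mono_iff [simp]: "P m \<le> P n \<longleftrightarrow> m \<le> n"
  by (simp add: P_def ennreal_le_iff)

lemma P_less_iff [simp]: "P m < P n \<longleftrightarrow> m < n"
  by (simp add: not_le[symmetric])

lemma P_exists:
  assumes "0 < t" "t < top"
  shows "\<exists>n. P n \<le> t \<and> t < P (n + 1)"
proof -
  obtain x where x: "t = ennreal x" "0 < x"
    using assms by (cases t) auto
  define n where "n = \<lfloor>log 2 x\<rfloor>"
  have "2 powr real_of_int n \<le> 2 powr (log 2 x)" "2 powr (log 2 x) < 2 powr (real_of_int (n + 1))"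
    unfolding n_def by (auto intro!: powr_mono powr_less_mono)
  then show ?thesis
    using x by (intro exI[of _ n]) (auto simp: P_def ennreal_le_iff ennreal_less_iff)
qed

text \<open>The factor \<open>\<lambda>\<^sup>i\<close> is absorbed by the decay of \<open>2\<^sup>n\<close>. Passing through the supremum of
  \<open>\<lambda>\<^sup>2\<^sup>i c\<^sub>i\<close> treats all exponents \<open>b > 0\<close> alike.\<close>

lemma suminf_weighted_epowr_le:
  fixes c :: "nat \<Rightarrow> ennreal"
  assumes b: "0 < b" and l: "1 < l"
  shows "(\<Sum>i. ennreal (l ^ i) * c i) epowr b
    \<le> ennreal (1 / (1 - 1 / l)) epowr b * (\<Sum>i. ennreal ((l powr (2 * b)) ^ i) * c i epowr b)"
proof -
  define S where "S = (\<Sum>i. ennreal ((l powr (2 * b)) ^ i) * c i epowr b)"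
  have c_le: "ennreal (l ^ i) * c i \<le> ennreal ((1 / l) ^ i) * S epowr (1 / b)" for i
  proof -
    have "((l ^ i)\<^sup>2) powr b = (l powr (2 * b)) ^ i"
    proof -
      have l0: "0 < l" "0 < l powr (2 * b)" using l by auto
      have "(l ^ i)\<^sup>2 = l powr real (i * 2)"
        by (simp only: powr_realpow[OF l0(1)] power_mult)
      then show ?thesis
        by (subst powr_realpow[OF l0(2), symmetric]) (simp add: powr_powr ac_simps)
    qed
    then have "(ennreal ((l ^ i)\<^sup>2) * c i) epowr b = ennreal ((l powr (2 * b)) ^ i) * c i epowr b"
      using l by (simp add: epowr_mult epowr_ennreal)
    also have "\<dots> \<le> S"
      unfolding S_def using sum_le_suminf[of "\<lambda>i. ennreal ((l powr (2 * b)) ^ i) * c i epowr b" "{i}"] by simp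
    finally have "ennreal ((l ^ i)\<^sup>2) * c i \<le> S epowr (1 / b)"
      using b by (simp add: le_epowr_iff)
    then have "ennreal ((1 / l) ^ i) * (ennreal ((l ^ i)\<^sup>2) * c i) \<le> ennreal ((1 / l) ^ i) * S epowr (1 / b)"
      by (rule mult_left_mono) simp
    moreover have "ennreal ((1 / l) ^ i) * (ennreal ((l ^ i)\<^sup>2) * c i) = ennreal (l ^ i) * c i"
    proof -
      have "(1 / l) ^ i * (l ^ i)\<^sup>2 = l ^ i"
        using l by (simp add: power2_eq_square power_divide)
      then show ?thesis
        using l by (simp add: mult.assoc[symmetric] ennreal_mult[symmetric])
    qed
    ultimately show ?thesis by simp
  qed
  have "(\<Sum>i. ennreal (l ^ i) * c i) \<le> (\<Sum>i. ennreal ((1 / l) ^ i) * S epowr (1 / b))"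
    by (intro suminf_le c_le) auto
  also have "\<dots> = ennreal (1 / (1 - 1 / l)) * S epowr (1 / b)"
  proof -
    have "(\<Sum>i. ennreal ((1 / l) ^ i)) = ennreal (1 / (1 - 1 / l))"
      using l by (subst suminf_ennreal2) (auto simp: suminf_geometric summable_geometric)
    then show ?thesis by simp
  qed
  finally have "(\<Sum>i. ennreal (l ^ i) * c i) epowr b \<le> (ennreal (1 / (1 - 1 / l)) * S epowr (1 / b)) epowr b"
    using b by (intro epowr_mono) auto
  then show ?thesis
    using b by (simp add: epowr_mult epowr_epowr S_def)
qed

text \<open>Replacing n + i by n as summation index turns \<open>P n\<close> into 2^(-i) times the
  shifted weight, so the sum over i becomes geometric with ratio \<open>l powr (2 * b) / 2\<close>,
  which is below 1.\<close>

lemma zsum_weighted_epowr_le: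
  assumes b: "0 < b" and l: "1 < l" "l powr (2 * b) < 2"
  shows "zsum (\<lambda>n. P n * (\<Sum>i. ennreal (l ^ i) * c (n + int i)) epowr b)
    \<le> ennreal (1 / (1 - 1 / l)) epowr b * ennreal (1 / (1 - l powr (2 * b) / 2)) * zsum (\<lambda>n. P n * c n epowr b)"
proof -
  let ?K = "ennreal (1 / (1 - 1 / l)) epowr b" and ?m = "l powr (2 * b)"
  have "zsum (\<lambda>n. P n * (\<Sum>i. ennreal (l ^ i) * c (n + int i)) epowr b)
     \<le> zsum (\<lambda>n. ?K * (\<Sum>i. ennreal ((?m / 2) ^ i) * (P (n + int i) * c (n + int i) epowr b)))"
  proof (rule zsum_mono)
    fix n
    have eq: "P n * (ennreal (?m ^ i) * c (n + int i) epowr b) = ennreal ((?m / 2) ^ i) * (P (n + int i) * c (n + int i) epowr b)" for i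
    proof -
      have "ennreal ((?m / 2) ^ i) * P (n + int i) = ennreal (?m ^ i) * P n"
      proof -
        have "(?m / 2) ^ i * 2 powr real_of_int (n + int i) = ?m ^ i * 2 powr real_of_int n"
          by (simp add: powr_add powr_realpow power_divide)
        then show ?thesis by (simp add: P_def flip: ennreal_mult)
      qed
      then show ?thesis by (simp add: ac_simps) (metis mult.assoc mult.commute)
    qed
    have "P n * (\<Sum>i. ennreal (l ^ i) * c (n + int i)) epowr b
       \<le> P n * (?K * (\<Sum>i. ennreal (?m ^ i) * c (n + int i) epowr b))"
      by (intro mult_left_mono suminf_weighted_epowr_le b l) simp
    also have "\<dots> = ?K * (\<Sum>i. P n * (ennreal (?m ^ i) * c (n + int i) epowr b))"
      by (simp add: ac_simps)
    also have "\<dots> = ?K * (\<Sum>i. ennreal ((?m / 2) ^ i) * (P (n + int i) * c (n + int i) epowr b))"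
      by (simp only: eq)
    finally show "P n * (\<Sum>i. ennreal (l ^ i) * c (n + int i)) epowr b \<le> 
      ?K * (\<Sum>i. ennreal ((?m / 2) ^ i) * (P (n + int i) * c (n + int i) epowr b))" .
  qed
  also have "\<dots> = ?K * (\<Sum>i. ennreal ((?m / 2) ^ i) * zsum (\<lambda>n. P n * c n epowr b))"
  proof -
    have "zsum (\<lambda>n. P (n + int i) * c (n + int i) epowr b) = zsum (\<lambda>n. P n * c n epowr b)" for i
      by (rule zsum_shift[of "\<lambda>n. P n * c n epowr b"])
    then show ?thesis by (simp add: zsum_cmult zsum_suminf)
  qed
  also have "\<dots> = ?K * ennreal (1 / (1 - ?m / 2)) * zsum (\<lambda>n. P n * c n epowr b)"
  proof -
    have "(\<Sum>i. ennreal ((?m / 2) ^ i)) = ennreal (1 / (1 - ?m / 2))"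
      using l by (subst suminf_ennreal2) (auto simp: suminf_geometric summable_geometric)
    then show ?thesis by (simp add: mult.assoc)
  qed
  finally show ?thesis .
qed

section \<open>Admissible constants\<close>

text \<open>The infimum is itself admissible. For positive finite norm one divides by the norm; for
  norm 0 any finite admissible constant forces the left side to vanish.\<close>

lemma least_constD:
  assumes "f \<in> Mplus" "least_const p v \<Phi> < top" "wnorm p v f < top"
  shows "\<Phi> f \<le> least_const p v \<Phi> * wnorm p v f"
proof (cases "wnorm p v f = 0")
  case True
  obtain C where "\<forall>f\<in>Mplus. \<Phi> f \<le> C * wnorm p v f"
    using assms(2) by (auto simp: least_const_def Inf_less_iff)
  then show ?thesis using assms(1) True by force
next
  case False
  have "\<Phi> f / wnorm p v f \<le> C" if "\<forall>f\<in>Mplus. \<Phi> f \<le> C * wnorm p v f" for C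
    using that assms False by (simp add: divide_le_posI_ennreal zero_less_iff_neq_zero mult.commute)
  then have "\<Phi> f / wnorm p v f \<le> least_const p v \<Phi>"
    unfolding least_const_def by (intro Inf_greatest) auto
  then have "(\<Phi> f / wnorm p v f) * wnorm p v f \<le> least_const p v \<Phi> * wnorm p v f"
    by (rule mult_right_mono) simp
  then show ?thesis
    using assms False by (simp add: ennreal_divide_times ennreal_times_divide ennreal_divide_self mult_divide_eq_ennreal)
qed

text \<open>Functions of infinite norm are harmless, but only for positive constants since
  \<open>0 * \<infinity> = 0\<close>; hence the perturbation of \<open>C\<close> in the proof.\<close>

lemma least_const_leI:
  assumes le: "\<And>f. f \<in> Mplus \<Longrightarrow> wnorm p v f < top \<Longrightarrow> \<Phi> f \<le> C * wnorm p v f"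
  shows "least_const p v \<Phi> \<le> C"
proof (rule ennreal_le_epsilon)
  fix e :: real assume e: "0 < e"
  have "\<Phi> f \<le> (C + ennreal e) * wnorm p v f" if f: "f \<in> Mplus" for f
  proof (cases "wnorm p v f < top")
    case True
    have "\<Phi> f \<le> C * wnorm p v f" using le[OF f True] .
    also have "\<dots> \<le> (C + ennreal e) * wnorm p v f" by (rule mult_right_mono) auto
    finally show ?thesis .
  next
    case False
    then show ?thesis using e by (simp add: less_top[symmetric] ennreal_mult_top)
  qed
  then show "least_const p v \<Phi> \<le> C + ennreal e"
    unfolding least_const_def by (intro Inf_lower) auto
qed

section \<open>Outer integrals and essential suprema\<close>

abbreviation "Leb \<equiv> lebesgue_on {0::real..}"

definition Efun :: "ennreal \<Rightarrow> (real \<Rightarrow> ennreal) \<Rightarrow> ennreal" where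
  "Efun q h = (if q = \<infinity> then esssup Leb h else \<integral>\<^sup>+y. h y \<partial>Leb)"

lemma Efun_mono:
  assumes "h \<in> Mplus" "\<And>y. 0 \<le> y \<Longrightarrow> h y \<le> h' y"
  shows "Efun q h \<le> Efun q h'"
proof -
  have "AE y in Leb. h y \<le> h' y" by (rule AE_I2) (simp add: assms)
  then show ?thesis
    using assms(1) by (auto simp: Efun_def Mplus_def intro!: esssup_AE_mono nn_integral_mono_AE)
qed

text \<open>For the essential supremum, the countably many exceptional null sets are joined into
  one.\<close>

lemma Efun_suminf:
  assumes "\<And>i::nat. h i \<in> Mplus"
  shows "Efun q (\<lambda>y. \<Sum>i. h i y) \<le> (\<Sum>i. Efun q (h i))"
proof -
  have [measurable]: "h i \<in> borel_measurable Leb" for i using assms by (simp add: Mplus_def)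
  have "esssup Leb (\<lambda>y. \<Sum>i. h i y) \<le> (\<Sum>i. esssup Leb (h i))"
  proof (rule esssup_I)
    have "AE y in Leb. \<forall>i. h i y \<le> esssup Leb (h i)"
      unfolding AE_all_countable by (intro allI esssup_AE)
    then show "AE y in Leb. (\<Sum>i. h i y) \<le> (\<Sum>i. esssup Leb (h i))"
      by eventually_elim (intro suminf_le; auto)
  qed measurable
  then show ?thesis by (simp add: Efun_def nn_integral_suminf)
qed

lemma Efun_zero [simp]: "Efun q (\<lambda>_. 0) = 0"
proof -
  have "esssup Leb (\<lambda>_. 0::ennreal) \<le> 0" by (rule esssup_I) auto
  then show ?thesis by (simp add: Efun_def)
qed

lemma Efun_add:
  assumes "g \<in> Mplus" "h \<in> Mplus"
  shows "Efun q (\<lambda>y. g y + h y) \<le> Efun q g + Efun q h"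
proof -
  have [measurable]: "g \<in> borel_measurable Leb" "h \<in> borel_measurable Leb"
    using assms by (simp_all add: Mplus_def)
  have "esssup Leb (\<lambda>y. g y + h y) \<le> esssup Leb g + esssup Leb h"
  proof (rule esssup_I)
    show "AE y in Leb. g y + h y \<le> esssup Leb g + esssup Leb h"
      using esssup_AE[of g Leb] esssup_AE[of h Leb] by eventually_elim (rule add_mono)
  qed measurable
  then show ?thesis by (simp add: Efun_def nn_integral_add)
qed

lemma Efun_cmult:
  assumes "h \<in> Mplus"
  shows "Efun q (\<lambda>y. c * h y) = c * Efun q h"
proof (cases "q = \<infinity>")
  case False
  then show ?thesis using assms by (simp add: Efun_def Mplus_def nn_integral_cmult)
next
  case True
  have h [measurable]: "h \<in> borel_measurable Leb" using assms by (simp add: Mplus_def)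
  have upper: "esssup Leb (\<lambda>y. a * g y) \<le> a * esssup Leb g" if [measurable]: "g \<in> borel_measurable Leb"
    for a :: ennreal and g
  proof (rule esssup_I)
    show "AE y in Leb. a * g y \<le> a * esssup Leb g"
      using esssup_AE[of g Leb] by eventually_elim (auto intro: mult_left_mono)
  qed measurable
  have "c * esssup Leb h \<le> esssup Leb (\<lambda>y. c * h y)"
  proof (cases "c = 0 \<or> c = top")
    case False
    have inv: "inverse c * c = 1"
      using False by (simp add: ennreal_divide_self less_top mult.commute[of "inverse c"] flip: divide_ennreal_def)
    have "esssup Leb h = esssup Leb (\<lambda>y. inverse c * (c * h y))"
      by (simp add: mult.assoc[symmetric] inv)
    also have "\<dots> \<le> inverse c * esssup Leb (\<lambda>y. c * h y)" by (rule upper) simp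
    finally have "c * esssup Leb h \<le> c * (inverse c * esssup Leb (\<lambda>y. c * h y))"
      by (rule mult_left_mono) simp
    then show ?thesis using inv by (simp add: mult.assoc[symmetric] mult.commute[of c])
  next
    case True
    show ?thesis
    proof (cases "esssup Leb h = 0 \<or> c = 0")
      case False
      then have "c = top" using True by simp
      \<comment> \<open>For c = \<infinity> division is impossible. Instead, \<open>top * h\<close>
        is infinite on the set where h is positive, which has positive measure.\<close>
      from False have "0 < emeasure Leb {y \<in> space Leb. h y > 0}"
        by (intro esssup_pos_measure h) (simp add: zero_less_iff_neq_zero)
      also have "{y \<in> space Leb. h y > 0} = {y \<in> space Leb. top * h y > b}" if "b < top" for b
        using that by (auto simp: ennreal_top_mult zero_less_iff_neq_zero)
      finally have pos: "0 < emeasure Leb {y \<in> space Leb. top * h y > b}" if "b < top" for b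
        using that by simp
      have "\<not> esssup Leb (\<lambda>y. top * h y) < top"
      proof
        assume "esssup Leb (\<lambda>y. top * h y) < top"
        from pos[OF this] esssup_zero_measure[of Leb "\<lambda>y. top * h y"] show False by simp
      qed
      then have "esssup Leb (\<lambda>y. top * h y) = top" using less_top by blast
      then show ?thesis using \<open>c = top\<close> by simp
    qed auto
  qed
  with upper[OF h, of c] True show ?thesis by (simp add: Efun_def)
qed

text \<open>As 0 is the least value in \<open>ennreal\<close>, extension by 0 outside T does not
  change which constants are almost everywhere upper bounds.\<close>

lemma esssup_lebesgue_on:
  assumes g: "g \<in> Mplus" and T: "T \<subseteq> {0..}" "T \<in> sets lebesgue"
  shows "esssup (lebesgue_on T) g = esssup Leb (\<lambda>y. indicator T y * g y)"
proof -
  have [measurable]: "g \<in> borel_measurable Leb" using g by (simp add: Mplus_def)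
  have T': "T \<in> sets Leb" using T by (simp add: sets_restrict_space_iff)
  have gT: "g \<in> borel_measurable (lebesgue_on T)"
    using measurable_restrict_mono[of g lebesgue "{0..}" borel T] g T(1) by (simp add: Mplus_def)
  have m: "(\<lambda>y. indicator T y * g y) \<in> borel_measurable Leb"
    using T' by measurable
  have "(AE y in lebesgue_on T. g y \<le> z) \<longleftrightarrow> (AE y in Leb. indicator T y * g y \<le> z)" for z
    using T by (simp add: AE_restrict_space_iff) (rule AE_cong; auto split: split_indicator)
  then show ?thesis by (simp add: esssup_eq_AE gT m)
qed

lemma nn_integral_indicator_Leb:
  assumes "T \<subseteq> {0..}"
  shows "(\<integral>\<^sup>+y\<in>T. g y \<partial>lebesgue) = (\<integral>\<^sup>+y. indicator T y * g y \<partial>Leb)"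
  using assms by (subst nn_integral_restrict_space) (auto intro!: nn_integral_cong split: split_indicator)

lemma Efun_indicator:
  assumes "g \<in> Mplus" "T \<subseteq> {0..}" "T \<in> sets lebesgue"
  shows "Efun q (\<lambda>y. indicator T y * g y) =
    (if q = \<infinity> then esssup (lebesgue_on T) g else \<integral>\<^sup>+y\<in>T. g y \<partial>lebesgue)"
  using assms by (simp add: Efun_def esssup_lebesgue_on nn_integral_indicator_Leb)

text \<open>With \<open>gam \<infinity> = 1\<close>, both cases of \<open>q\<close> take the form
  \<open>wnorm q \<omega> h = E(\<omega> h\<^sup>\<gamma>)\<^sup>1\<^sup>/\<^sup>\<gamma>\<close> with \<open>E\<close> the integral or the essential supremum,
  and need not be distinguished any further.\<close>

definition gam :: "ennreal \<Rightarrow> real" where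
  "gam q = (if q = \<infinity> then 1 else enn2real q)"

lemma gam_pos: "0 < q \<Longrightarrow> 0 < gam q"
  by (auto simp: gam_def enn2real_positive_iff less_top)

lemma wnorm_eq_Efun: "wnorm q \<omega> g = Efun q (\<lambda>y. \<omega> y * g y epowr gam q) epowr (1 / gam q)"
  by (auto simp: wnorm_def Efun_def gam_def mult.commute)

definition tail :: "(real \<Rightarrow> ennreal) \<Rightarrow> real \<Rightarrow> ennreal" where
  "tail f y = (\<integral>\<^sup>+z\<in>{y..}. f z \<partial>lebesgue)"

lemma Mplus_indicator [intro]: 
  assumes "g \<in> Mplus" "T \<inter> {0..} \<in> sets lebesgue"
  shows "(\<lambda>y. indicator T y * g y) \<in> Mplus"
proof -
  have [measurable]: "g \<in> borel_measurable Leb" using assms by (simp add: Mplus_def)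
  have [measurable]: "T \<inter> {0..} \<in> sets Leb" using assms by (simp add: sets_restrict_space_iff)
  have "(\<lambda>y. indicator (T \<inter> {0..}) y * g y) \<in> borel_measurable Leb" by measurable
  also have "?this \<longleftrightarrow> (\<lambda>y. indicator T y * g y) \<in> borel_measurable Leb"
    by (intro measurable_cong) (auto split: split_indicator)
  finally show ?thesis by (simp add: Mplus_def)
qed

lemma Mplus_mult [intro]: "f \<in> Mplus \<Longrightarrow> g \<in> Mplus \<Longrightarrow> (\<lambda>y. f y * g y) \<in> Mplus"
  and Mplus_add [intro]: "f \<in> Mplus \<Longrightarrow> g \<in> Mplus \<Longrightarrow> (\<lambda>y. f y + g y) \<in> Mplus"
  and Mplus_epowr [intro]: "f \<in> Mplus \<Longrightarrow> (\<lambda>y. f y epowr a) \<in> Mplus"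
  and Mplus_const [intro]: "(\<lambda>y. c) \<in> Mplus"
  by (simp_all add: Mplus_def)

lemma is_interval_borel:
  fixes S :: "real set"
  assumes "is_interval S"
  shows "S \<in> sets borel"
  using is_real_interval[OF assms] by (elim exE disjE) simp_all

text \<open>The superlevel sets are intervals. This provides measurability of tails as functions of
  their left end point.\<close>

lemma borel_measurable_antimono_real:
  fixes g :: "real \<Rightarrow> ennreal"
  assumes "antimono g"
  shows "g \<in> borel_measurable borel"
proof (rule borel_measurableI_greater)
  fix c
  have "is_interval {x. c < g x}"
    unfolding is_interval_1 using less_le_trans[OF _ antimonoD[OF assms]] by blast
  then show "{x \<in> space borel. c < g x} \<in> sets borel"
    by (simp add: is_interval_borel)
qed

lemma Mplus_antimono: "antimono g \<Longrightarrow> g \<in> Mplus"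
  unfolding Mplus_def
  by (intro measurable_restrict_space1 measurable_completion)
     (simp add: borel_measurable_antimono_real)

lemma set_nn_integral_antimono:
  assumes "antimono T"
  shows "antimono (\<lambda>y. \<integral>\<^sup>+z\<in>T y. f z \<partial>M)"
proof (rule antimonoI)
  fix x y :: 'a assume "x \<le> y"
  then have "T y \<subseteq> T x" by (rule antimonoD[OF assms])
  then show "(\<integral>\<^sup>+z\<in>T y. f z \<partial>M) \<le> (\<integral>\<^sup>+z\<in>T x. f z \<partial>M)"
    by (auto intro!: nn_integral_mono split: split_indicator)
qed

lemma Mplus_tail: "tail f \<in> Mplus"
  unfolding tail_def by (intro Mplus_antimono set_nn_integral_antimono) (auto simp: antimono_def)

section \<open>Level sets of the primitive\<close>

locale weight =
  fixes u :: "real \<Rightarrow> ennreal"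
  assumes u: "u \<in> Mplus"
    and fin: "\<And>t. 0 < t \<Longrightarrow> (\<integral>\<^sup>+x\<in>{0..t}. u x \<partial>lebesgue) < \<infinity>"
begin

abbreviation "U \<equiv> prim u"

definition "mu = density Leb u"

text \<open>The blocks are level sets of U, so they make sense even if U is bounded:
  \<open>R n\<close> is then empty for large n and the last non-empty block is a half-line.
  \<open>X n\<close> is the cut point x_n, with dummy value 0 if U never reaches 2^n.\<close>

definition R :: "int \<Rightarrow> real set" where "R n = {y. 0 \<le> y \<and> P n \<le> U y}"
definition A :: "int \<Rightarrow> real set" where "A n = R n - R (n + 1)"
definition X :: "int \<Rightarrow> real" where "X n = (if R n = {} then 0 else Inf (R n))"

lemma u_meas [measurable]: "u \<in> borel_measurable Leb"
  using u by (simp add: Mplus_def)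

lemma sets_mu [simp]: "sets mu = sets Leb"
  by (simp add: mu_def)

lemma sets_LebI: "S \<subseteq> {0..} \<Longrightarrow> S \<in> sets borel \<Longrightarrow> S \<in> sets Leb"
  by (simp add: sets_restrict_space_iff)

lemma mu_eq: 
  assumes "S \<subseteq> {0..}" "S \<in> sets borel"
  shows "emeasure mu S = (\<integral>\<^sup>+z\<in>S. u z \<partial>lebesgue)"
  using sets_LebI[OF assms] assms
  by (simp add: mu_def emeasure_density nn_integral_indicator_Leb mult.commute)

lemma U_eq_mu: "U x = emeasure mu {0..x}"
  by (simp add: prim_def mu_eq)

lemma mu_singleton: "0 \<le> x \<Longrightarrow> emeasure mu {x} = 0"
proof -
  assume "0 \<le> x"
  moreover have "(\<integral>\<^sup>+z\<in>{x}. u z \<partial>lebesgue) = 0"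
    by (rule nn_integral_null_set) auto
  ultimately show ?thesis by (simp add: mu_eq)
qed

lemma U_zero [simp]: "U 0 = 0"
  by (simp add: U_eq_mu mu_singleton)

lemma U_neg: "x < 0 \<Longrightarrow> U x = 0"
  by (simp add: U_eq_mu)

lemma U_mono: "x \<le> y \<Longrightarrow> U x \<le> U y"
  unfolding U_eq_mu by (intro emeasure_mono) (auto intro!: sets_LebI)

lemma U_less_top [simp]: "U x < top" "U x \<noteq> top"
proof -
  show "U x < top"
    using fin[of x] U_zero U_neg[of x] by (cases "0 < x"; cases "x = 0") (auto simp: prim_def)
  then show "U x \<noteq> top" by simp
qed

lemma less_if_U_less: "U x < U y \<Longrightarrow> x < y"
  using U_mono[of y x] by (cases "x < y") auto

lemma mu_Ico:
  assumes "0 \<le> x" "x \<le> y"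
  shows "U y = U x + emeasure mu {x..<y}"
proof -
  have "U y = emeasure mu (({0..x} - {x}) \<union> {x..<y} \<union> {y})"
    unfolding U_eq_mu using assms by (intro arg_cong[where f = "emeasure mu"]) auto
  also have "\<dots> = emeasure mu (({0..x} - {x}) \<union> {x..<y})"
    using assms
    by (intro emeasure_Un_null_set) (auto simp: null_sets_def mu_singleton intro!: sets_LebI)
  also have "\<dots> = emeasure mu ({0..x} - {x}) + emeasure mu {x..<y}"
    using assms by (intro plus_emeasure[symmetric]) (auto intro!: sets_LebI)
  also have "emeasure mu ({0..x} - {x}) = U x"
    unfolding U_eq_mu using assms
    by (intro emeasure_Diff_null_set) (auto simp: null_sets_def mu_singleton intro!: sets_LebI)
  finally show ?thesis .
qed

text \<open>Dominated convergence: the indicators of the intervals from 0 to \<open>s n\<close>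
  converge at every point except a.\<close>

lemma U_continuous: "continuous_on S U"
proof (rule continuous_on_sequentiallyI)
  fix s a assume s: "s \<longlonglongrightarrow> (a::real)"
  define b where "b = \<bar>a\<bar> + 1"
  have ev: "eventually (\<lambda>n. s n < b) sequentially"
    using order_tendstoD(2)[OF s, of b] by (simp add: b_def)
  \<comment> \<open>Cutting the sequence at b makes the dominating function valid for every n, not
    only eventually.\<close>
  define s' where "s' n = min (s n) b" for n
  have s': "s' \<longlonglongrightarrow> a"
  proof -
    have "min a b = a" by (simp add: b_def)
    then show ?thesis
      using tendsto_min[OF s tendsto_const[of b]] by (simp add: s'_def[abs_def])
  qed
  have "(\<lambda>n. \<integral>\<^sup>+z. u z * indicator {0..s' n} z \<partial>Leb) \<longlonglongrightarrow> (\<integral>\<^sup>+z. u z * indicator {0..a} z \<partial>Leb)"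
  proof (rule nn_integral_dominated_convergence[where w = "\<lambda>z. u z * indicator {0..b} z"])
    show "(\<integral>\<^sup>+ z. u z * indicator {0..b} z \<partial>Leb) < \<infinity>"
      using fin[of b] by (simp add: b_def nn_integral_indicator_Leb mult.commute)
    have "{a} \<inter> {0..} \<in> null_sets Leb"
      by (cases "0 \<le> a") (auto simp: null_sets_restrict_space)
    then have "AE z in Leb. z \<noteq> a"
      by (rule AE_I') auto
    then show "AE z in Leb. (\<lambda>n. u z * indicator {0..s' n} z) \<longlonglongrightarrow> u z * indicator {0..a} z"
    proof eventually_elim
      case (elim z)
      have "eventually (\<lambda>n. u z * indicator {0..s' n} z = u z * indicator {0..a} z) sequentially"
      proof (cases "z < a")
        case True
        from order_tendstoD(1)[OF s' this] show ?thesis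
          by eventually_elim (use True in \<open>auto split: split_indicator\<close>)
      next
        case False
        with elim have "a < z" by simp
        from order_tendstoD(2)[OF s' this] show ?thesis
          by eventually_elim (use \<open>a < z\<close> in \<open>auto split: split_indicator\<close>)
      qed
      then show ?case by (rule tendsto_eventually)
    qed
  qed (auto simp: s'_def intro!: borel_measurable_times_ennreal borel_measurable_indicator
      sets_LebI split: split_indicator)
  then have "(\<lambda>n. U (s' n)) \<longlonglongrightarrow> U a"
    by (simp add: prim_def nn_integral_indicator_Leb mult.commute)
  moreover have "eventually (\<lambda>n. U (s' n) = U (s n)) sequentially"
    using ev by eventually_elim (simp add: s'_def)
  ultimately show "(\<lambda>n. U (s n)) \<longlonglongrightarrow> U a"
    by (rule Lim_transform_eventually)
qed

text \<open>The intermediate value theorem reaches the level t, and closedness of the level set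
  gives a least point. This one fact yields the cut points as well as \<sigma> and its
  inverse.\<close>

lemma U_level:
  assumes t: "0 < t" and b: "t \<le> U b"
  shows "\<exists>a. 0 < a \<and> U a = t \<and> (\<forall>y. t \<le> U y \<longleftrightarrow> a \<le> y)"
proof -
  have b0: "0 \<le> b" using t b U_neg[of b] by (cases "b < 0") auto
  define S where "S = {y \<in> {0..b}. U y = t}"
  have ex: "\<exists>x. 0 \<le> x \<and> x \<le> y \<and> U x = t" if "0 \<le> y" "t \<le> U y" for y
    using IVT'[of U 0 t y] that t U_continuous by auto
  have "closed S"
    unfolding S_def by (rule continuous_closed_preimage_constant[OF U_continuous]) simp
  moreover have "S \<noteq> {}" "bdd_below S" using ex[OF b0 b] by (auto simp: S_def)
  ultimately have mem: "Inf S \<in> S" by (intro closed_contains_Inf)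
  have "t \<le> U y \<longleftrightarrow> Inf S \<le> y" for y
  proof
    assume y: "t \<le> U y"
    then have "0 \<le> y" using t U_neg[of y] by (cases "y < 0") auto
    from ex[OF this y] obtain x where x: "0 \<le> x" "x \<le> y" "U x = t" by auto
    show "Inf S \<le> y"
    proof (cases "x \<le> b")
      case True
      then have "x \<in> S" using x by (simp add: S_def)
      then have "Inf S \<le> x" using \<open>bdd_below S\<close> by (rule cInf_lower)
      then show ?thesis using x by simp
    qed (use x mem in \<open>auto simp: S_def\<close>)
  next
    assume "Inf S \<le> y"
    then show "t \<le> U y" using U_mono[of "Inf S" y] mem by (auto simp: S_def)
  qed
  moreover have "0 < Inf S"
    using mem t by (cases "Inf S = 0") (auto simp: S_def)
  moreover have "U (Inf S) = t"
    using mem by (simp add: S_def)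
  ultimately show ?thesis by blast
qed

lemma R_iff: "y \<in> R n \<longleftrightarrow> P n \<le> U y"
proof -
  have "0 \<le> y" if "P n \<le> U y"
    using that U_neg[of y] by (cases "y < 0") auto
  then show ?thesis by (auto simp: R_def)
qed

lemma A_iff: "y \<in> A n \<longleftrightarrow> P n \<le> U y \<and> U y < P (n + 1)"
  by (auto simp: A_def R_iff)

lemma A_pos: "y \<in> A n \<Longrightarrow> 0 < U y"
  by (auto simp: A_iff intro: less_le_trans[OF P_pos(1)])

lemma R_subset: "R n \<subseteq> {0..}" and A_subset: "A n \<subseteq> {0..}"
  by (auto simp: R_def A_def)

lemma R_antimono: "m \<le> n \<Longrightarrow> R n \<subseteq> R m"
  using order_trans[OF P_mono_iff[THEN iffD2]] by (fastforce simp: R_iff)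

lemma R_up: "x \<in> R n \<Longrightarrow> x \<le> y \<Longrightarrow> y \<in> R n"
  unfolding R_iff by (rule order_trans[OF _ U_mono])

lemma X_props:
  assumes "R n \<noteq> {}"
  shows "U (X n) = P n" "R n = {X n..}" "0 < X n"
proof -
  obtain b where "P n \<le> U b" using assms by (auto simp: R_iff)
  from U_level[OF P_pos(1) this] obtain a where a: "0 < a" "U a = P n" "\<And>y. P n \<le> U y \<longleftrightarrow> a \<le> y"
    by blast
  have "R n = {a..}" using a(3) by (simp add: set_eq_iff R_iff)
  moreover from this have "X n = a" by (simp add: X_def)
  ultimately show "U (X n) = P n" "R n = {X n..}" "0 < X n" using a(1,2) by simp_all
qed

lemma X_nonneg: "0 \<le> X n"
  using X_props(3)[of n] by (cases "R n = {}") (auto simp: X_def)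

lemma X_mono: "R n \<noteq> {} \<Longrightarrow> m \<le> n \<Longrightarrow> X m \<le> X n"
  using R_antimono[of m n] X_props(2)[of m] X_props(2)[of n] by (cases "R m = {}") auto

lemma X_le: "x \<in> R n \<Longrightarrow> X n \<le> x"
  using X_props(2)[of n] by auto

lemma le_X_if_A: "x \<in> A n \<Longrightarrow> R m \<noteq> {} \<Longrightarrow> n < m \<Longrightarrow> x \<le> X m"
  using X_props(1)[of m] less_if_U_less[of x "X m"] less_le_trans[of "U x" "P (n + 1)" "P m"]
  by (simp add: A_iff)

lemma R_borel [measurable]: "R n \<in> sets borel"
  using X_props(2)[of n] by (cases "R n = {}") auto

lemma A_borel [measurable]: "A n \<in> sets borel"
  unfolding A_def by measurable

lemma A_disjoint:
  assumes "x \<in> A m" "x \<in> A n"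
  shows "m = n"
proof -
  have "m < n + 1" if "x \<in> A m" "x \<in> A n" for m n
    using that le_less_trans[of "P m" "U x" "P (n + 1)"] by (simp add: A_iff)
  from this[OF assms] this[OF assms(2,1)] show ?thesis by simp
qed

lemma A_exists: "0 < U x \<Longrightarrow> \<exists>n. x \<in> A n"
  using P_exists[of "U x"] by (auto simp: A_iff)

text \<open>If x_(n+1) exists, the block has mass 2^(n+1) - 2^n. Without it, only an upper bound is
  available.\<close>

lemma mu_A_eq:
  assumes "R (n + 1) \<noteq> {}"
  shows "emeasure mu (A n) = P n"
proof -
  have R: "R n \<noteq> {}" using R_antimono[of n "n + 1"] assms by auto
  have "A n = {X n..<X (n + 1)}"
    using X_props(2)[OF R] X_props(2)[OF assms] by (auto simp: A_def)
  moreover have "U (X (n + 1)) = U (X n) + emeasure mu {X n..<X (n + 1)}"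
    using X_mono[OF assms, of n] X_nonneg by (intro mu_Ico) auto
  ultimately show ?thesis
    using X_props(1)[OF R] X_props(1)[OF assms] by (simp add: P_Suc mult_2)
qed

lemma mu_A_le: "emeasure mu (A n) \<le> P n"
proof (cases "R n = {} \<or> R (n + 1) \<noteq> {}")
  case True
  then show ?thesis
  proof
    assume "R n = {}"
    then show ?thesis by (simp add: A_def)
  qed (simp add: mu_A_eq)
next
  case False
  \<comment> \<open>This is the last block, a half-line. It is exhausted by bounded intervals, on
    which U stays below 2^(n+1).\<close>
  then have A: "A n = (\<Union>j::nat. {X n..<X n + real j})"
    using X_props(2)[of n] 
    by (auto simp: A_def) (use reals_Archimedean2 in \<open>force simp: less_diff_eq[symmetric] diff_less_eq[symmetric] add.commute\<close>)
  have "emeasure mu {X n..<X n + real j} \<le> P n" for j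
  proof -
    have "P n + emeasure mu {X n..<X n + real j} = U (X n + real j)"
      using X_props(1)[of n] False mu_Ico[of "X n" "X n + real j"] X_nonneg by simp
    also have "\<dots> \<le> P (n + 1)"
      using False R_iff[of "X n + real j" "n + 1"] by auto
    finally show ?thesis by (simp add: P_Suc mult_2)
  qed
  moreover have "emeasure mu (A n) = (SUP j. emeasure mu {X n..<X n + real j})"
    unfolding A using X_nonneg[of n]
    by (intro SUP_emeasure_incseq[symmetric]) (auto simp: incseq_def intro!: sets_LebI)
  ultimately show ?thesis by (simp add: SUP_le_iff)
qed

text \<open>The zero set of U on [0, j] is compact and contains its largest point, up to which U,
  that is the mass of u, is 0. Hence the points outside all blocks contribute nothing.\<close>

lemma AE_U_zero: "AE x in Leb. U x = 0 \<longrightarrow> u x = 0"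
proof -
  define Z where "Z = {x. 0 \<le> x \<and> U x = 0}"
  have meas: "Z \<in> sets borel"
  proof (rule is_interval_borel)
    show "is_interval Z"
      unfolding is_interval_1 Z_def using U_mono by fastforce
  qed
  have "emeasure mu (Z \<inter> {0..real j}) = 0" for j :: nat
  proof (cases "Z \<inter> {0..real j} = {}")
    case False
    have "closed (Z \<inter> {0..real j})"
    proof -
      have "Z \<inter> {0..real j} = {x \<in> {0..real j}. U x = 0}" by (auto simp: Z_def)
      then show ?thesis
        using continuous_closed_preimage_constant[OF U_continuous, of "{0..real j}" 0] by simp
    qed
    moreover have bdd: "bdd_above (Z \<inter> {0..real j})" by auto
    ultimately have "Sup (Z \<inter> {0..real j}) \<in> Z \<inter> {0..real j}"
      using False by (intro closed_contains_Sup)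
    then have "U (Sup (Z \<inter> {0..real j})) = 0" by (simp add: Z_def)
    moreover have "Z \<inter> {0..real j} \<subseteq> {0..Sup (Z \<inter> {0..real j})}"
      using cSup_upper[OF _ bdd] by auto
    ultimately show ?thesis
      using emeasure_mono[of "Z \<inter> {0..real j}" "{0..Sup (Z \<inter> {0..real j})}" mu] sets_LebI
      by (simp add: U_eq_mu)
  qed simp
  then have "emeasure mu (\<Union>j::nat. Z \<inter> {0..real j}) = 0"
    using meas by (intro emeasure_UN_eq_0) (auto intro!: sets_LebI)
  moreover have "(\<Union>j::nat. Z \<inter> {0..real j}) = Z"
    using real_arch_simple by (auto simp: Z_def)
  ultimately have "emeasure mu Z = 0" by simp
  then have "AE x in mu. x \<notin> Z"
    using meas by (intro AE_not_in) (auto simp: null_sets_def Z_def intro!: sets_LebI)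
  then have "AE x in Leb. 0 < u x \<longrightarrow> x \<notin> Z"
    unfolding mu_def by (subst (asm) AE_density) simp_all
  moreover have "AE x in Leb. 0 \<le> x" by (rule AE_I2) simp
  ultimately show ?thesis
    by eventually_elim (auto simp: Z_def zero_less_iff_neq_zero)
qed

lemma zsum_indicator_A: "x \<in> A n \<Longrightarrow> zsum (\<lambda>m. indicator (A m) x * c m) = c n"
  by (subst nn_integral_count_space'[of "{n}"]) (auto split: split_indicator dest: A_disjoint)

lemma nn_integral_step:
  "(\<integral>\<^sup>+x. u x * zsum (\<lambda>n. indicator (A n) x * b n) \<partial>Leb) = zsum (\<lambda>n. emeasure mu (A n) * b n)"
proof -
  have AL: "A n \<in> sets Leb" for n by (intro sets_LebI A_subset A_borel)
  have "(\<integral>\<^sup>+x. u x * zsum (\<lambda>n. indicator (A n) x * b n) \<partial>Leb)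
      = (\<integral>\<^sup>+x. zsum (\<lambda>n. u x * (indicator (A n) x * b n)) \<partial>Leb)"
    by (simp add: nn_integral_cmult)
  also have "\<dots> = zsum (\<lambda>n. \<integral>\<^sup>+x. u x * (indicator (A n) x * b n) \<partial>Leb)"
    using AL by (intro nn_integral_count_space_nn_integral) auto
  also have "\<dots> = zsum (\<lambda>n. emeasure mu (A n) * b n)"
  proof -
    have "(\<integral>\<^sup>+x. u x * (indicator (A n) x * b n) \<partial>Leb) = emeasure mu (A n) * b n" for n
      using AL by (simp add: mu_def emeasure_density mult.assoc[symmetric] nn_integral_multc)
    then show ?thesis by simp
  qed
  finally show ?thesis .
qed

text \<open>The blocks cover all points with U > 0, and u vanishes almost everywhere else. So h may
  be replaced by its block bounds, and each block has mass at most \<open>P n\<close>.\<close>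

lemma step_upper:
  assumes "\<And>n x. x \<in> A n \<Longrightarrow> h x \<le> b n"
  shows "(\<integral>\<^sup>+x. u x * h x \<partial>Leb) \<le> zsum (\<lambda>n. P n * b n)"
proof -
  have "(\<integral>\<^sup>+x. u x * h x \<partial>Leb) \<le> (\<integral>\<^sup>+x. u x * zsum (\<lambda>n. indicator (A n) x * b n) \<partial>Leb)"
  proof (rule nn_integral_mono_AE)
    show "AE x in Leb. u x * h x \<le> u x * zsum (\<lambda>n. indicator (A n) x * b n)"
      using AE_U_zero
    proof eventually_elim
      case (elim x)
      show ?case
      proof (cases "U x = 0")
        case False
        then obtain n where n: "x \<in> A n" using A_exists[of x] by (auto simp: zero_less_iff_neq_zero)
        then show ?thesis using assms by (simp add: zsum_indicator_A mult_left_mono)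
      qed (use elim in simp)
    qed
  qed
  also have "\<dots> \<le> zsum (\<lambda>n. P n * b n)"
    unfolding nn_integral_step by (intro zsum_mono mult_right_mono mu_A_le) simp
  finally show ?thesis .
qed

text \<open>The actual mass of \<open>A n\<close> is kept, because the last block may have mass
  below \<open>P n\<close>.\<close>

lemma step_lower:
  assumes "\<And>n x. x \<in> A n \<Longrightarrow> u x * b n \<le> g x"
  shows "zsum (\<lambda>n. emeasure mu (A n) * b n) \<le> (\<integral>\<^sup>+x. g x \<partial>Leb)"
proof -
  have "u x * zsum (\<lambda>n. indicator (A n) x * b n) \<le> g x" for x
  proof (cases "\<exists>n. x \<in> A n")
    case True
    then show ?thesis using assms by (auto simp: zsum_indicator_A)
  next
    case False
    then have "indicator (A n) x * b n = 0" for n by simp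
    then have "zsum (\<lambda>n. indicator (A n) x * b n) = 0" by (simp only:) simp
    then show ?thesis by simp
  qed
  then show ?thesis
    unfolding nn_integral_step[symmetric] by (intro nn_integral_mono)
qed

subsection \<open>The maps \<open>\<sigma>\<close> and \<open>\<sigma>\<^sup>-\<^sup>1\<close>\<close>

lemma sig_nonneg: "0 \<le> sig u x"
  by (auto simp: sig_def intro!: Inf_greatest)

text \<open>If U reaches the level 2 U(x), the infimum is the least point from
  \<open>U_level\<close>; otherwise it is taken over the empty set.\<close>

lemma sig_step:
  assumes "0 < U x"
  shows "sig u (ereal x) = \<infinity> \<and> (\<forall>y. U y < 2 * U x) \<or>
    (\<exists>t. sig u (ereal x) = ereal t \<and> U t = 2 * U x)"
proof (cases "\<exists>b. 2 * U x \<le> U b")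
  case False
  then have "{y. 0 < y \<and> 2 * U x \<le> U y} = {}" by auto
  have "sig u (ereal x) = Inf (ereal ` {y. 0 < y \<and> 2 * U x \<le> U y})"
    by (simp add: sig_def)
  also have "\<dots> = \<infinity>"
    unfolding \<open>{y. 0 < y \<and> 2 * U x \<le> U y} = {}\<close> by (simp add: top_ereal_def)
  finally have "sig u (ereal x) = \<infinity>" .
  then show ?thesis using False by (auto simp: not_le)
next
  case True
  then obtain b where b: "2 * U x \<le> U b" by auto
  have "0 < 2 * U x" using assms by (simp add: ennreal_zero_less_mult_iff)
  from U_level[OF this b] obtain a where a: "0 < a" "U a = 2 * U x" "\<And>y. 2 * U x \<le> U y \<longleftrightarrow> a \<le> y"
    by auto
  have "sig u (ereal x) = Inf (ereal ` {y. 0 < y \<and> a \<le> y})" by (simp add: sig_def a(3))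
  also have "\<dots> = ereal a"
    using a(1) by (intro Inf_eqI) auto
  finally show ?thesis using a by auto
qed

text \<open>Each application doubles U, and positivity of U persists so that \<open>sig_step\<close>
  applies again. Once \<infinity> is reached it stays, while the bound on U only becomes
  weaker.\<close>

lemma sig_iter:
  assumes "0 < U x"
  shows "(sig u ^^ n) (ereal x) = \<infinity> \<and> (\<forall>y. U y < 2 ^ n * U x) \<or>
    (\<exists>t. (sig u ^^ n) (ereal x) = ereal t \<and> U t = 2 ^ n * U x)"
proof (induction n)
  case (Suc n)
  show ?case
  proof (cases "(sig u ^^ n) (ereal x) = \<infinity>")
    case True
    moreover have "U y < 2 ^ Suc n * U x" if "U y < 2 ^ n * U x" for y
    proof -
      have "2 ^ n * U x \<le> 2 * (2 ^ n * U x)"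
        by (simp add: mult_2)
      then show ?thesis using that by (simp add: mult.assoc)
    qed
    moreover have "sig u \<infinity> = \<infinity>" by (simp add: sig_def)
    ultimately show ?thesis using Suc by auto
  next
    case False
    then obtain t where t: "(sig u ^^ n) (ereal x) = ereal t" "U t = 2 ^ n * U x"
      using Suc by auto
    have "U t \<noteq> 0" using assms t(2) by auto
    then have "0 < U t" using zero_less_iff_neq_zero by blast
    from sig_step[OF this] show ?thesis using t by (simp add: mult.assoc)
  qed
qed simp

text \<open>Positions relative to iterates of \<sigma> are read off from values of U alone; the
  infinite case is included.\<close>

lemma less_sig_iter:
  assumes "0 < U x" "U y < 2 ^ n * U x"
  shows "ereal y < (sig u ^^ n) (ereal x)"
  using sig_iter[OF assms(1), of n] assms(2) less_if_U_less[of y] by auto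

lemma sig_iter_exists:
  assumes "0 < U x" "2 ^ n * U x \<le> U b"
  obtains t where "(sig u ^^ n) (ereal x) = ereal t" "U t = 2 ^ n * U x"
  using sig_iter[OF assms(1), of n] assms(2) by (auto simp: not_less[symmetric])

lemma sig_inv_props:
  assumes "0 < U x"
  shows "U (sig_inv u x) = U x / 2" "0 < sig_inv u x"
proof -
  have h: "0 < U x / 2" "U x / 2 \<le> U x"
    using assms by (auto simp: ennreal_zero_less_divide divide_le_posI_ennreal mult_2)
  from U_level[OF h] obtain a where a: "0 < a" "U a = U x / 2" "\<And>y. U x / 2 \<le> U y \<longleftrightarrow> a \<le> y"
    by auto
  then have "{y. 0 < y \<and> U x / 2 \<le> U y} = {a..}" by auto
  then have "sig_inv u x = a" by (simp add: sig_inv_def)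
  then show "U (sig_inv u x) = U x / 2" "0 < sig_inv u x" using a by auto
qed

end

section \<open>Oinarov kernels\<close>

text \<open>Constants change sides through this equivalence, which avoids division in
  \<open>ennreal\<close>.\<close>

lemma ennreal_inverse_powr_le_iff:
  assumes "0 < D"
  shows "ennreal (D powr - a) * x \<le> y \<longleftrightarrow> x \<le> ennreal (D powr a) * y"
proof -
  have *: "ennreal (D powr a) * ennreal (D powr - a) = 1"
    using assms by (simp add: powr_minus flip: ennreal_mult)
  show ?thesis
  proof
    assume "ennreal (D powr - a) * x \<le> y"
    then have "ennreal (D powr a) * (ennreal (D powr - a) * x) \<le> ennreal (D powr a) * y"
      by (rule mult_left_mono) simp
    then show "x \<le> ennreal (D powr a) * y" by (simp add: * flip: mult.assoc)
  next
    assume "x \<le> ennreal (D powr a) * y"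
    then have "ennreal (D powr - a) * x \<le> ennreal (D powr - a) * (ennreal (D powr a) * y)"
      by (rule mult_left_mono) simp
    then show "ennreal (D powr - a) * x \<le> y"
      using * by (simp add: mult.commute[of "ennreal (D powr - a)"] flip: mult.assoc)
  qed
qed

locale kernel =
  fixes D :: real and k :: "real \<Rightarrow> real \<Rightarrow> ennreal"
  assumes K: "oinarov_kernel D k"
begin

lemma D_ge_1: "1 \<le> D" and D_pos: "0 < D"
  using K by (auto simp: oinarov_kernel_def)

lemma dd_ge_1: "1 \<le> ennreal D"
  using D_ge_1 by simp

lemma k_zero: "0 \<le> x \<Longrightarrow> x < y \<Longrightarrow> k x y = 0"
  using K by (simp add: oinarov_kernel_def)

lemma k_upper: "0 \<le> y \<Longrightarrow> y \<le> z \<Longrightarrow> z \<le> x \<Longrightarrow> k x y \<le> ennreal D * (k x z + k z y)"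
  using K by (simp add: oinarov_kernel_def)

lemma k_lower:
  assumes "0 \<le> y" "y \<le> z" "z \<le> x"
  shows "k x z \<le> ennreal D * k x y" "k z y \<le> ennreal D * k x y"
proof -
  have "ennreal (D powr - 1) * (k x z + k z y) \<le> k x y"
    using K assms D_pos by (simp add: oinarov_kernel_def powr_minus inverse_eq_divide)
  then have *: "k x z + k z y \<le> ennreal D * k x y"
    using D_pos by (subst (asm) ennreal_inverse_powr_le_iff) auto
  show "k x z \<le> ennreal D * k x y" "k z y \<le> ennreal D * k x y"
    using order_trans[OF _ *] by (simp_all add: add_increasing add_increasing2)
qed

text \<open>Extend k by 0 to the plane and compose with the continuous map from y to (y, x).\<close>

lemma k_Mplus:
  assumes "0 \<le> x"
  shows "(\<lambda>y. k y x) \<in> Mplus"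
proof -
  have "{0::real..} \<times> {0::real..} \<in> sets borel"
    by (intro borel_closed closed_Times) auto
  then have [measurable]: "(\<lambda>z. (case z of (x, y) \<Rightarrow> k x y) * indicator ({0..} \<times> {0..}) z) \<in> borel_measurable borel"
    using K by (simp add: oinarov_kernel_def borel_measurable_restrict_space_iff_ennreal)
  have [measurable]: "(\<lambda>y::real. (y, x)) \<in> borel_measurable borel" 
    by (intro borel_measurable_continuous_onI continuous_intros)
  have "(\<lambda>y. (\<lambda>z. (case z of (x, y) \<Rightarrow> k x y) * indicator ({0..} \<times> {0..}) z) (y, x)) \<in> borel_measurable borel"
    by (rule measurable_compose[of "\<lambda>y. (y, x)" borel borel]) measurable
  then have "(\<lambda>y. (\<lambda>z. (case z of (x, y) \<Rightarrow> k x y) * indicator ({0..} \<times> {0..}) z) (y, x)) \<in> borel_measurable Leb"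
    by (intro measurable_restrict_space1 measurable_completion) simp
  also have "?this \<longleftrightarrow> (\<lambda>y. k y x) \<in> borel_measurable Leb"
    using assms by (intro measurable_cong) auto
  finally show ?thesis by (simp add: Mplus_def)
qed

text \<open>Peeling off the last link costs one factor D per step. Too crude for long chains, it is
  applied only to at most N links.\<close>

lemma k_chain_power:
  assumes "1 \<le> L" "0 \<le> z 0" "\<And>i. i < L \<Longrightarrow> z i \<le> z (Suc i)"
  shows "k (z L) (z 0) \<le> ennreal D ^ L * (\<Sum>i<L. k (z (Suc i)) (z i))"
  using assms
proof (induction L rule: nat_induct_at_least)
  case base
  show ?case using mult_right_mono[OF dd_ge_1, of "k (z (Suc 0)) (z 0)"] by simp
next
  case (Suc L)
  have mono: "z 0 \<le> z i" if "i \<le> L" for i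
    using that Suc.prems(2) by (induction i) (auto intro: order_trans Suc_leD)
  have "k (z (Suc L)) (z 0) \<le> ennreal D * (k (z (Suc L)) (z L) + k (z L) (z 0))"
    using Suc.prems mono[of L] by (intro k_upper) auto
  also have "\<dots> \<le> ennreal D * (ennreal D ^ L * k (z (Suc L)) (z L) + ennreal D ^ L * (\<Sum>i<L. k (z (Suc i)) (z i)))"
    using mult_right_mono[OF one_le_power[OF dd_ge_1], of "k (z (Suc L)) (z L)" L] Suc
    by (intro mult_left_mono add_mono) auto
  also have "\<dots> = ennreal D ^ Suc L * (\<Sum>i<Suc L. k (z (Suc i)) (z i))"
    by (simp add: algebra_simps)
  finally show ?case .
qed

text \<open>Splitting a long chain after every \<open>N\<close> links costs one factor \<open>D \<le> \<lambda>\<^sup>N\<close> per \<open>N\<close> links,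
  so the loss grows only like \<open>\<lambda>\<^sup>i\<close> with \<open>\<lambda>\<close> as close to \<open>1\<close> as desired.\<close>

lemma k_chain:
  assumes N: "1 \<le> N" "D \<le> l ^ N" and l: "1 \<le> l"
    and L: "1 \<le> L" and z: "0 \<le> z 0" "\<And>i. i < L \<Longrightarrow> z i \<le> z (Suc i)"
  shows "k (z L) (z 0) \<le> ennreal (D ^ (N + 1)) * (\<Sum>i<L. ennreal (l ^ i) * k (z (Suc i)) (z i))"
  using L z
proof (induction L arbitrary: z rule: less_induct)
  case (less L)
  have mono: "z 0 \<le> z i" if "i \<le> L" for i
    using that less.prems(3) by (induction i) (auto intro: order_trans Suc_leD)
  have l1: "1 \<le> ennreal (l ^ i)" for i using l by simp
  have sum_le: "(\<Sum>i<m. k (z (Suc i)) (z i)) \<le> (\<Sum>i<m. ennreal (l ^ i) * k (z (Suc i)) (z i))" for m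
    using mult_right_mono[OF l1] by (intro sum_mono) (metis mult_1 zero_le)
  have DP: "ennreal D ^ m = ennreal (D ^ m)" for m
    using D_pos by (simp add: ennreal_power)
  show ?case
  proof (cases "L \<le> N")
    case True
    have "k (z L) (z 0) \<le> ennreal D ^ L * (\<Sum>i<L. k (z (Suc i)) (z i))"
      using less.prems by (rule k_chain_power)
    also have "\<dots> \<le> ennreal (D ^ (N + 1)) * (\<Sum>i<L. ennreal (l ^ i) * k (z (Suc i)) (z i))"
      unfolding DP using True D_ge_1 by (intro mult_mono sum_le ennreal_leI power_increasing) auto
    finally show ?thesis .
  next
    case False
    define y where "y i = z (i + N)" for i
    have "k (z L) (z 0) \<le> ennreal D * (k (z L) (z N) + k (z N) (z 0))"
    proof (rule k_upper)
      \<comment> \<open>The chain is only known to increase up to L, so it is frozen from L on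
        before monotonicity is invoked.\<close>
      show "z N \<le> z L"
        using lift_Suc_mono_le[of "\<lambda>i. z (min i L)" N L] less.prems(3) False
        by (auto simp: min_def not_less_eq_eq split: if_splits)
    qed (use less.prems mono[of N] False in auto)
    also have "k (z L) (z N) = k (y (L - N)) (y 0)" using False by (simp add: y_def)
    also have "\<dots> \<le> ennreal (D ^ (N + 1)) * (\<Sum>i<L - N. ennreal (l ^ i) * k (y (Suc i)) (y i))"
      using False N less.prems(3) mono[of N] less.prems(2) by (intro less.IH) (auto simp: y_def)
    also have "k (z N) (z 0) \<le> ennreal D ^ N * (\<Sum>i<N. k (z (Suc i)) (z i))"
      using less.prems False N by (intro k_chain_power) auto
    also have "\<dots> \<le> ennreal D ^ N * (\<Sum>i<N. ennreal (l ^ i) * k (z (Suc i)) (z i))"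
      by (intro mult_left_mono sum_le) simp
    also have "ennreal D * (ennreal (D ^ (N + 1)) * (\<Sum>i<L - N. ennreal (l ^ i) * k (y (Suc i)) (y i))
         + ennreal D ^ N * (\<Sum>i<N. ennreal (l ^ i) * k (z (Suc i)) (z i)))
       = ennreal (D ^ (N + 1)) * ((\<Sum>i<L - N. ennreal (D * l ^ i) * k (y (Suc i)) (y i))
         + (\<Sum>i<N. ennreal (l ^ i) * k (z (Suc i)) (z i)))"
    proof -
      have "ennreal D * ennreal D ^ N = ennreal (D ^ (N + 1))"
        unfolding DP[symmetric] by simp
      then have 1: "ennreal D * (ennreal D ^ N * x) = ennreal (D ^ (N + 1)) * x" for x
        by (simp only: flip: mult.assoc)
      have "ennreal D * (\<Sum>i<L - N. ennreal (l ^ i) * k (y (Suc i)) (y i))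
          = (\<Sum>i<L - N. ennreal (D * l ^ i) * k (y (Suc i)) (y i))"
        using D_pos l by (simp add: sum_distrib_left ennreal_mult mult.assoc)
      then have 2: "ennreal D * (c * (\<Sum>i<L - N. ennreal (l ^ i) * k (y (Suc i)) (y i)))
          = c * (\<Sum>i<L - N. ennreal (D * l ^ i) * k (y (Suc i)) (y i))" for c
        by (simp only: mult.left_commute[of _ c])
      show ?thesis by (simp only: distrib_left 1 2)
    qed
    \<comment> \<open>The extra D on the remaining chain is traded for \<open>l ^ N\<close>, exactly
      the weight gained by shifting its indices back by N.\<close>
    also have "\<dots> \<le> ennreal (D ^ (N + 1)) * ((\<Sum>i<L - N. ennreal (l ^ (i + N)) * k (y (Suc i)) (y i))
         + (\<Sum>i<N. ennreal (l ^ i) * k (z (Suc i)) (z i)))"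
    proof (intro mult_left_mono add_mono sum_mono mult_right_mono ennreal_leI order_refl)
      fix i
      show "D * l ^ i \<le> l ^ (i + N)"
        using mult_right_mono[OF N(2), of "l ^ i"] l by (simp add: power_add mult.commute)
    qed auto
    also have "\<dots> = ennreal (D ^ (N + 1)) * (\<Sum>i<L. ennreal (l ^ i) * k (z (Suc i)) (z i))"
    proof -
      have "(\<Sum>i<L. ennreal (l ^ i) * k (z (Suc i)) (z i))
          = (\<Sum>i<N. ennreal (l ^ i) * k (z (Suc i)) (z i)) + (\<Sum>i<L - N. ennreal (l ^ (i + N)) * k (y (Suc i)) (y i))"
        using sum.atLeastLessThan_concat[of 0 N L "\<lambda>i. ennreal (l ^ i) * k (z (Suc i)) (z i)"]
          sum.atLeastLessThan_shift_0[of "\<lambda>i. ennreal (l ^ i) * k (z (Suc i)) (z i)" N L] False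
        by (simp add: y_def atLeast0LessThan add.commute)
      then show ?thesis by (simp add: add.commute)
    qed
    finally show ?thesis by (simp add: add_mono mult_left_mono)
  qed
qed

end

section \<open>Scaling of least constants, integrals and tails\<close>

lemma least_const_scaled_le:
  assumes c: "c < top"
    and le: "\<And>f. f \<in> Mplus \<Longrightarrow> wnorm p v f < top \<Longrightarrow> c * \<Phi> f \<le> C * wnorm p v f"
  shows "c * least_const p v \<Phi> \<le> C"
proof (cases "c = 0")
  case False
  then have inv: "c * inverse c = 1"
    using c by (simp add: ennreal_divide_self flip: divide_ennreal_def)
  have "least_const p v \<Phi> \<le> inverse c * C"
  proof (rule least_const_leI)
    fix f assume "f \<in> Mplus" "wnorm p v f < top"
    from mult_left_mono[OF le[OF this], of "inverse c"]
    show "\<Phi> f \<le> inverse c * C * wnorm p v f"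
      using inv by (simp add: mult.commute[of "inverse c"] mult.assoc[symmetric])
  qed
  from mult_left_mono[OF this, of c] show ?thesis
    using inv by (simp flip: mult.assoc)
qed simp

lemma least_const_mono:
  assumes c: "0 < c"
    and le: "\<And>f. f \<in> Mplus \<Longrightarrow> \<Phi> f \<le> c * \<Psi> f"
  shows "least_const p v \<Phi> \<le> c * least_const p v \<Psi>"
proof (cases "least_const p v \<Psi> < top")
  case True
  show ?thesis
  proof (rule least_const_leI)
    fix f assume f: "f \<in> Mplus" "wnorm p v f < top"
    have "\<Phi> f \<le> c * \<Psi> f" by (rule le) fact
    also have "\<dots> \<le> c * (least_const p v \<Psi> * wnorm p v f)"
      by (intro mult_left_mono least_constD f True) simp
    finally show "\<Phi> f \<le> c * least_const p v \<Psi> * wnorm p v f" by (simp add: mult.assoc)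
  qed
next
  case False
  then show ?thesis using c by (simp add: less_top[symmetric] ennreal_mult_top)
qed

text \<open>Argue on the simple functions below h, so that this also applies to integrands such as
  \<open>B1_integrand\<close> whose measurability in x is not established.\<close>

lemma nn_integral_cmult_le: "c * (\<integral>\<^sup>+x. h x \<partial>M) \<le> (\<integral>\<^sup>+x. c * h x \<partial>M)"
proof -
  have "c * integral\<^sup>S M f \<le> (\<integral>\<^sup>+x. c * h x \<partial>M)" if f: "simple_function M f" "f \<le> h" for f
  proof -
    have "c * integral\<^sup>S M f = (\<integral>\<^sup>+x. c * f x \<partial>M)"
      using borel_measurable_simple_function[OF f(1)]
      by (simp add: nn_integral_eq_simple_integral[OF f(1), symmetric] nn_integral_cmult)
    also have "\<dots> \<le> (\<integral>\<^sup>+x. c * h x \<partial>M)"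
      using f(2) by (intro nn_integral_mono mult_left_mono) (auto simp: le_fun_def)
    finally show ?thesis .
  qed
  then show ?thesis
    unfolding nn_integral_def[of M h]
    by (subst SUP_mult_left_ennreal) (auto intro!: SUP_least)
qed

lemma tail_mono: 
  assumes "0 \<le> x" "\<And>y. 0 \<le> y \<Longrightarrow> f y \<le> g y"
  shows "tail f x \<le> tail g x"
  unfolding tail_def using assms by (auto intro!: nn_integral_mono split: split_indicator)

lemma tail_cmult:
  assumes "f \<in> Mplus" "0 \<le> x"
  shows "tail (\<lambda>y. c * f y) x = c * tail f x"
proof -
  have [measurable]: "f \<in> borel_measurable Leb" using assms by (simp add: Mplus_def)
  have "{x..} \<in> sets Leb" using assms by (simp add: sets_restrict_space_iff)
  then show ?thesis
    using assms unfolding tail_def by (simp add: nn_integral_indicator_Leb nn_integral_cmult mult.left_commute)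
qed

section \<open>The operator S written through \<open>Efun\<close>\<close>

locale setting = weight u + kernel D k for u D k +
  fixes p r :: real and q :: ennreal and v w :: "real \<Rightarrow> ennreal"
  assumes p: "1 \<le> p" and r: "0 < r" and q: "0 < q"
    and v: "v \<in> Mplus" and w: "w \<in> Mplus"
begin

abbreviation "g \<equiv> gam q"
text \<open>S is a power 1 / g of an inner \<open>Efun\<close>, so the outer exponent r acts on that
  quantity as b.\<close>

definition "b = r / g"
abbreviation "S \<equiv> S_op q w k"
abbreviation "nrm \<equiv> wnorm (ennreal p) v"
abbreviation "CS \<equiv> C_S p r q u v w k"

definition Sker :: "(real \<Rightarrow> ennreal) \<Rightarrow> real \<Rightarrow> real \<Rightarrow> ennreal" where
  "Sker f x y = indicator {x..} y * (k y x * w y * tail f y epowr g)"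

lemma g_pos: "0 < g" using gam_pos q by simp
lemma b_pos: "0 < b" using g_pos r by (simp add: b_def)

lemma g_b: "g * b = r" "1 / g * r = b"
  using g_pos by (simp_all add: b_def)

lemma core_Mplus: "0 \<le> x \<Longrightarrow> (\<lambda>y. k y x * w y * tail f y epowr g) \<in> Mplus"
  by (intro Mplus_mult Mplus_epowr k_Mplus w Mplus_tail)

lemma Sker_Mplus: "0 \<le> x \<Longrightarrow> Sker f x \<in> Mplus"
  unfolding Sker_def by (intro Mplus_indicator core_Mplus) auto

lemma S_eq:
  assumes "0 \<le> x"
  shows "S f x = Efun q (Sker f x) epowr (1 / g)"
proof -
  have "Efun q (Sker f x) = (if q = \<infinity> then esssup (lebesgue_on {x..}) (\<lambda>y. k y x * w y * tail f y epowr g) 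
      else \<integral>\<^sup>+y\<in>{x..}. k y x * w y * tail f y epowr g \<partial>lebesgue)"
    unfolding Sker_def using assms by (intro Efun_indicator core_Mplus) auto
  then show ?thesis
    by (simp add: S_op_def gam_def tail_def)
qed

lemma S_epowr: "0 \<le> x \<Longrightarrow> S f x epowr r = Efun q (Sker f x) epowr b"
  using g_pos by (simp add: S_eq epowr_epowr b_def)

text \<open>Homogeneity and monotonicity of S together: it serves to normalise a test function and
  to bound S of a superposition below by each of its members.\<close>

lemma S_ge:
  assumes "0 \<le> x" "f \<in> Mplus" "\<And>y. 0 \<le> y \<Longrightarrow> c * f y \<le> h y"
  shows "c * S f x \<le> S h x"
proof -
  have "c epowr g * Efun q (Sker f x) = Efun q (\<lambda>y. c epowr g * Sker f x y)"
    by (intro Efun_cmult[symmetric] Sker_Mplus assms)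
  also have "\<dots> \<le> Efun q (Sker h x)"
  proof (rule Efun_mono)
    fix y :: real assume y: "0 \<le> y"
    have "c * tail f y \<le> tail h y"
      using tail_mono[OF y, of "\<lambda>y. c * f y" h] assms(3) by (simp add: tail_cmult assms y)
    then have "(c * tail f y) epowr g \<le> tail h y epowr g"
      using g_pos by (intro epowr_mono) auto
    then have "(k y x * w y) * (c * tail f y) epowr g \<le> (k y x * w y) * tail h y epowr g"
      by (rule mult_left_mono) simp
    then show "c epowr g * Sker f x y \<le> Sker h x y"
      by (auto simp: Sker_def epowr_mult ac_simps split: split_indicator)
  qed (intro Mplus_mult Mplus_const Sker_Mplus assms)
  finally have "(c epowr g * Efun q (Sker f x)) epowr (1 / g) \<le> Efun q (Sker h x) epowr (1 / g)"
    using g_pos by (intro epowr_mono) auto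
  then show ?thesis using g_pos assms(1) by (simp add: epowr_mult epowr_epowr S_eq)
qed

lemma wnorm_r: "wnorm (ennreal r) u h = (\<integral>\<^sup>+x. u x * h x epowr r \<partial>Leb) epowr (1 / r)"
  using r by (simp add: wnorm_def mult.commute)

lemma nrm_epowr: "nrm f epowr p = (\<integral>\<^sup>+x. f x epowr p * v x \<partial>Leb)"
  using p by (simp add: wnorm_def epowr_epowr)

lemma CS_alt: "CS = least_const (ennreal p) v (\<lambda>f. (\<integral>\<^sup>+x. u x * S f x epowr r \<partial>Leb) epowr (1 / r))"
  by (simp add: C_S_def opnorm_def wnorm_r)

lemma CS_D:
  assumes "f \<in> Mplus" "CS < top" "nrm f < top"
  shows "(\<integral>\<^sup>+x. u x * S f x epowr r \<partial>Leb) \<le> (CS * nrm f) epowr r"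
proof -
  have "(\<integral>\<^sup>+x. u x * S f x epowr r \<partial>Leb) epowr (1 / r) \<le> CS * nrm f"
    using least_constD[of f "ennreal p" v "\<lambda>f. (\<integral>\<^sup>+x. u x * S f x epowr r \<partial>Leb) epowr (1 / r)"] assms
    by (simp add: CS_alt)
  then show ?thesis using r by (simp add: epowr_le_iff)
qed

section \<open>The conditions are necessary\<close>

text \<open>For y between x and t = \<sigma>^3(x) the tail of f at y is at least its tail at t,
  which may therefore be pulled out of the inner integral.\<close>

lemma B0_le: "B0 p r q u v w k \<le> 1 * CS"
  unfolding B0_def CS_alt
proof (rule least_const_mono, simp)
  fix f assume f: "f \<in> Mplus"
  have "B0_integrand r q u w k f x \<le> u x * S f x epowr r" if x: "0 \<le> x" for x
  proof (cases "(sig u ^^ 3) (ereal x)")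
    case (real t)
    let ?h = "\<lambda>y. indicator {x..t} y * (k y x * w y)"
    have m: "(\<lambda>y. k y x * w y) \<in> Mplus" by (intro Mplus_mult k_Mplus w x)
    have m': "?h \<in> Mplus" by (intro Mplus_indicator m) auto
    have "B0_integrand r q u w k f x = u x * (Efun q ?h epowr b * tail f t epowr r)"
      using x m by (subst Efun_indicator) (auto simp: B0_integrand_def real b_def gam_def tail_def mult.assoc)
    also have "Efun q ?h epowr b * tail f t epowr r = (tail f t epowr g * Efun q ?h) epowr b"
      by (simp add: epowr_mult epowr_epowr g_b mult.commute)
    also have "tail f t epowr g * Efun q ?h = Efun q (\<lambda>y. tail f t epowr g * ?h y)"
      by (intro Efun_cmult[symmetric] m')
    also have "\<dots> \<le> Efun q (Sker f x)"
    proof (rule Efun_mono)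
      fix y :: real
      have "tail f t \<le> tail f y" if "y \<le> t"
        unfolding tail_def using that by (auto intro!: nn_integral_mono split: split_indicator)
      then have "tail f t epowr g \<le> tail f y epowr g" if "y \<le> t"
        using that g_pos by (intro epowr_mono) auto
      then show "tail f t epowr g * ?h y \<le> Sker f x y"
        by (auto simp: Sker_def mult.commute[of "tail f t epowr g"] mult_left_mono split: split_indicator)
    qed (intro Mplus_mult Mplus_const m')
    finally show ?thesis
      using b_pos by (simp add: S_epowr x epowr_mono mult_left_mono)
  qed (auto simp: B0_integrand_def)
  then have "(\<integral>\<^sup>+x. B0_integrand r q u w k f x \<partial>Leb) \<le> (\<integral>\<^sup>+x. u x * S f x epowr r \<partial>Leb)"
    by (intro nn_integral_mono) simp
  then show "(\<integral>\<^sup>+x. B0_integrand r q u w k f x \<partial>Leb) epowr (1 / r)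
      \<le> 1 * (\<integral>\<^sup>+x. u x * S f x epowr r \<partial>Leb) epowr (1 / r)"
    using r by (simp add: epowr_mono)
qed

lemma sig_iter_nonneg:
  assumes "0 \<le> x" "(sig u ^^ n) (ereal x) = ereal t"
  shows "0 \<le> t"
proof (cases n)
  case 0
  then show ?thesis using assms by simp
next
  case (Suc m)
  then show ?thesis using sig_nonneg[of "(sig u ^^ m) (ereal x)"] assms(2) by simp
qed

lemma powr_inverse_mult_le:
  assumes "x \<le> ennreal D * y"
  shows "ennreal (D powr - 1) * x \<le> y"
  using assms D_pos by (subst ennreal_inverse_powr_le_iff) auto

text \<open>For y beyond t = \<sigma>^2(x) the Oinarov condition gives k(t, x) \<le> D k(y, x), so
  the kernel in \<open>B1\<close> is dominated by the one in S.\<close>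

lemma B1_le: "ennreal (D powr - (1 / g)) * B1 p r q u v w k \<le> CS"
proof -
  have "B1 p r q u v w k \<le> ennreal (D powr (1 / g)) * CS"
    unfolding B1_def CS_alt
  proof (rule least_const_mono)
    show "0 < ennreal (D powr (1 / g))" using D_pos by simp
    fix f assume f: "f \<in> Mplus"
    have "ennreal (D powr - b) * B1_integrand r q u w k f x \<le> u x * S f x epowr r" if x: "0 \<le> x" for x
    proof (cases "(sig u ^^ 2) (ereal x)")
      case (real t)
      have t: "0 \<le> t" using sig_iter_nonneg[OF x real] .
      let ?h = "\<lambda>y. indicator {t..} y * (w y * tail f y epowr g)"
      have m: "(\<lambda>y. w y * tail f y epowr g) \<in> Mplus" by (intro Mplus_mult Mplus_epowr w Mplus_tail)
      have m': "?h \<in> Mplus" by (intro Mplus_indicator m) (use t in auto)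
      have "B1_integrand r q u w k f x = u x * (k t x * Efun q ?h) epowr b"
        using x t m by (subst Efun_indicator)
          (auto simp: B1_integrand_def real b_def gam_def tail_def mult.assoc epowr_mult)
      then have "ennreal (D powr - b) * B1_integrand r q u w k f x
          = u x * (ennreal (D powr - 1) * (k t x * Efun q ?h)) epowr b"
        by (simp only: epowr_mult epowr_ennreal[OF powr_ge_zero] powr_powr mult_minus1 mult.left_commute)
      also have "ennreal (D powr - 1) * (k t x * Efun q ?h) = Efun q (\<lambda>y. ennreal (D powr - 1) * k t x * ?h y)"
        using Efun_cmult[OF m', of q "ennreal (D powr - 1) * k t x"] by (simp only: mult.assoc)
      also have "\<dots> \<le> Efun q (Sker f x)"
      proof (rule Efun_mono)
        fix y :: real
        \<comment> \<open>If t < x the left side is 0 by \<open>k_zero\<close>, so both orders of x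
          and t are covered.\<close>
        have "ennreal (D powr - 1) * k t x \<le> indicator {x..} y * k y x" if "t \<le> y"
        proof (cases "x \<le> t")
          case True
          have "ennreal (D powr - 1) * k t x \<le> k y x"
            by (rule powr_inverse_mult_le, rule k_lower) (use that x True in auto)
          then show ?thesis using that True by simp
        qed (use k_zero t in auto)
        from mult_right_mono[OF this, of "w y * tail f y epowr g"]
        show "ennreal (D powr - 1) * k t x * ?h y \<le> Sker f x y"
          by (cases "t \<le> y") (auto simp: Sker_def ac_simps)
      qed (intro Mplus_mult Mplus_const m')
      finally show ?thesis
        using b_pos by (simp add: S_epowr x epowr_mono mult_left_mono)
    qed (auto simp: B1_integrand_def)
    then have "(\<integral>\<^sup>+x. ennreal (D powr - b) * B1_integrand r q u w k f x \<partial>Leb) \<le> (\<integral>\<^sup>+x. u x * S f x epowr r \<partial>Leb)"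
      by (intro nn_integral_mono) simp
    then have "ennreal (D powr - b) * (\<integral>\<^sup>+x. B1_integrand r q u w k f x \<partial>Leb) \<le> (\<integral>\<^sup>+x. u x * S f x epowr r \<partial>Leb)"
      by (rule order_trans[OF nn_integral_cmult_le])
    then have "(\<integral>\<^sup>+x. B1_integrand r q u w k f x \<partial>Leb) \<le> ennreal (D powr b) * (\<integral>\<^sup>+x. u x * S f x epowr r \<partial>Leb)"
      using D_pos by (simp add: ennreal_inverse_powr_le_iff)
    then have "(\<integral>\<^sup>+x. B1_integrand r q u w k f x \<partial>Leb) epowr (1 / r)
        \<le> (ennreal (D powr b) * (\<integral>\<^sup>+x. u x * S f x epowr r \<partial>Leb)) epowr (1 / r)"
      using r by (intro epowr_mono) auto
    then show "(\<integral>\<^sup>+x. B1_integrand r q u w k f x \<partial>Leb) epowr (1 / r)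
        \<le> ennreal (D powr (1 / g)) * (\<integral>\<^sup>+x. u x * S f x epowr r \<partial>Leb) epowr (1 / r)"
      using r by (simp add: epowr_mult epowr_ennreal powr_powr b_def)
  qed
  then show ?thesis using D_pos by (simp add: ennreal_inverse_powr_le_iff)
qed

text \<open>For x \<le> c \<le> y one has k(y, c) \<le> D k(y, x). The majorant
  \<open>indicator {c..} y * tail f y\<close> fits both \<open>Hstar\<close> and
  \<open>Hstar_between\<close>.\<close>

lemma wnorm_le_S:
  assumes x: "0 \<le> x" "x \<le> c" and H: "H \<in> Mplus" "\<And>y. 0 \<le> y \<Longrightarrow> H y \<le> indicator {c..} y * tail f y"
  shows "ennreal (D powr - (1 / g)) * wnorm q (\<lambda>y. w y * k y c) H \<le> S f x"
proof -
  have m: "(\<lambda>y. w y * k y c * H y epowr g) \<in> Mplus"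
    by (intro Mplus_mult Mplus_epowr w k_Mplus H) (use x in auto)
  have "Efun q (\<lambda>y. w y * k y c * H y epowr g) \<le> Efun q (\<lambda>y. ennreal D * Sker f x y)"
  proof (rule Efun_mono[OF m])
    fix y :: real assume y: "0 \<le> y"
    show "w y * k y c * H y epowr g \<le> ennreal D * Sker f x y"
    proof (cases "c \<le> y")
      case True
      then have "H y epowr g \<le> tail f y epowr g"
        using H(2)[OF y] g_pos by (intro epowr_mono) auto
      moreover have "k y c \<le> ennreal D * k y x" using x True by (intro k_lower) auto
      ultimately have "w y * k y c * H y epowr g \<le> w y * (ennreal D * k y x) * tail f y epowr g"
        by (intro mult_mono) auto
      then show ?thesis using True x by (simp add: Sker_def ac_simps)
    next
      case False
      then show ?thesis using H(2)[OF y] by simp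
    qed
  qed
  also have "\<dots> = ennreal D * Efun q (Sker f x)"
    by (intro Efun_cmult Sker_Mplus x)
  finally have "Efun q (\<lambda>y. w y * k y c * H y epowr g) epowr (1 / g) \<le> (ennreal D * Efun q (Sker f x)) epowr (1 / g)"
    using g_pos by (intro epowr_mono) auto
  then have "wnorm q (\<lambda>y. w y * k y c) H \<le> ennreal (D powr (1 / g)) * S f x"
    using D_pos by (simp add: wnorm_eq_Efun epowr_mult epowr_ennreal S_eq x)
  then show ?thesis using D_pos by (simp add: ennreal_inverse_powr_le_iff)
qed

text \<open>The loss incurred by moving the kernel's base point in
  \<open>wnorm_le_S\<close>.\<close>

definition e :: ennreal where "e = ennreal (D powr - (1 / g))"

lemma e_pos: "0 < e" "e < top" "e \<noteq> 0"
  using D_pos by (auto simp: e_def)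

lemma Hstar_Mplus: "0 \<le> t \<Longrightarrow> Hstar t f \<in> Mplus"
  using Mplus_indicator[OF Mplus_tail, of "{t..}" f] by (simp add: Hstar_def[abs_def] tail_def)

lemma Hstar_between_Mplus: "Hstar_between u c d f \<in> Mplus"
proof -
  have "antimono (\<lambda>y. \<integral>\<^sup>+z\<in>{z. y \<le> z \<and> ereal z \<le> sig u d}. f z \<partial>lebesgue)"
    by (rule set_nn_integral_antimono) (auto simp: antimono_def)
  moreover have "is_interval ({y. c \<le> y \<and> ereal y < d} \<inter> {0..})"
    unfolding is_interval_1 by auto (meson ereal_less_eq(3) le_less_trans)
  then have "{y. c \<le> y \<and> ereal y < d} \<inter> {0..} \<in> sets lebesgue"
    by (intro sets_completionI_sets) (simp add: is_interval_borel)
  ultimately show ?thesis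
    unfolding Hstar_between_def[abs_def] by (intro Mplus_indicator Mplus_antimono)
qed

lemma Hstar_between_le:
  "Hstar_between u c d f y \<le> indicator {c..} y * tail f y"
  unfolding Hstar_between_def tail_def
  by (intro mult_mono nn_integral_mono) (auto split: split_indicator)

text \<open>A Chebyshev argument: keep only the part of the outer integral over T.\<close>

lemma S_lower:
  assumes CS: "CS < top" and T: "T \<subseteq> {0..}" "T \<in> sets borel"
    and f: "f \<in> Mplus" "nrm f < top"
    and le: "\<And>x. x \<in> T \<Longrightarrow> a \<le> S f x"
  shows "emeasure mu T epowr (1 / r) * a \<le> CS * nrm f"
proof -
  have TL: "T \<in> sets Leb" using T by (rule sets_LebI)
  have "emeasure mu T * a epowr r = (\<integral>\<^sup>+x. u x * (indicator T x * a epowr r) \<partial>Leb)"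
    using TL by (simp add: mu_def emeasure_density nn_integral_multc mult.assoc[symmetric])
  also have "\<dots> \<le> (\<integral>\<^sup>+x. u x * S f x epowr r \<partial>Leb)"
    using le r by (intro nn_integral_mono mult_left_mono) (auto intro!: epowr_mono split: split_indicator)
  also have "\<dots> \<le> (CS * nrm f) epowr r" by (rule CS_D) fact+
  finally have "(emeasure mu T epowr (1 / r) * a) epowr r \<le> (CS * nrm f) epowr r"
    using r by (simp add: epowr_mult[of "_ epowr _"] epowr_epowr)
  then show ?thesis using r by (simp add: epowr_mono_iff)
qed

lemma opnorm_lower:
  assumes CS: "CS < top" and T: "T \<subseteq> {0..}" "T \<in> sets borel" "emeasure mu T < top"
    and le: "\<And>f x. f \<in> Mplus \<Longrightarrow> x \<in> T \<Longrightarrow> e * \<Phi> f \<le> S f x"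
  shows "emeasure mu T epowr (1 / r) * (e * least_const (ennreal p) v \<Phi>) \<le> CS"
proof -
  have "(emeasure mu T epowr (1 / r) * e) * least_const (ennreal p) v \<Phi> \<le> CS"
  proof (rule least_const_scaled_le)
    show "emeasure mu T epowr (1 / r) * e < top"
      using T(3) e_pos by (simp add: ennreal_mult_less_top)
    fix f assume f: "f \<in> Mplus" "nrm f < top"
    from S_lower[OF CS T(1,2) f le[OF f(1)]]
    show "emeasure mu T epowr (1 / r) * e * \<Phi> f \<le> CS * nrm f"
      by (simp add: mult.assoc)
  qed
  then show ?thesis by (simp add: mult.assoc)
qed

text \<open>Take T = [0, t], whose mass is U(t): there S f is at least e times the norm of
  \<open>Hstar t f\<close>.\<close>

lemma B2_le_if_p_le_r:
  assumes "p \<le> r"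
  shows "e * B2 p r q u v w k \<le> CS"
proof (cases "CS < top")
  case CS: True
  have "prim u t epowr (1 / r) * opnorm (ennreal p) v q (\<lambda>y. w y * k y t) (Hstar t)
      \<le> ennreal (D powr (1 / g)) * CS" if t: "0 < t" for t
  proof -
    have "emeasure mu {0..t} epowr (1 / r) * (e * opnorm (ennreal p) v q (\<lambda>y. w y * k y t) (Hstar t)) \<le> CS"
      unfolding opnorm_def
    proof (rule opnorm_lower[OF CS])
      show "emeasure mu {0..t} < top" unfolding U_eq_mu[symmetric] by simp
      fix f :: "real \<Rightarrow> ennreal" and x
      assume "f \<in> Mplus" "x \<in> {0..t}"
      then show "e * wnorm q (\<lambda>y. w y * k y t) (Hstar t f) \<le> S f x"
        unfolding e_def using t by (intro wnorm_le_S Hstar_Mplus) (auto simp: Hstar_def tail_def)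
    qed auto
    then show ?thesis
      using D_pos unfolding U_eq_mu[symmetric] e_def
      by (simp add: mult.left_commute[of "_ epowr _"] ennreal_inverse_powr_le_iff del: U_eq_mu)
  qed
  then have "B2 p r q u v w k \<le> ennreal (D powr (1 / g)) * CS"
    using assms by (auto simp: B2_def intro!: SUP_least)
  then show ?thesis using D_pos by (simp add: e_def ennreal_inverse_powr_le_iff)
qed (simp add: less_top[symmetric])

section \<open>Local operator norms and test functions for r < p\<close>

definition loc_norm :: "real \<Rightarrow> ennreal" where
  "loc_norm x = opnorm (ennreal p) v q (\<lambda>y. w y * k y (sig_inv u x))
     (Hstar_between u (sig_inv u x) ((sig u ^^ 2) (ereal x)))"

text \<open>Taking the supremum over a block makes the integrand of \<open>B2\<close> comparable
  with a step function.\<close>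

definition sup_norm :: "int \<Rightarrow> ennreal" where "sup_norm n = (SUP x\<in>A n. loc_norm x)"

text \<open>Going back two blocks suffices: U(z) < 2^(n-1) \<le> U(x) / 2, hence z lies to the left
  of \<open>sig_inv u x\<close>.\<close>

lemma loc_norm_lower:
  assumes x: "x \<in> A n" and z: "z \<in> A (n - 2)"
  shows "e * wnorm q (\<lambda>y. w y * k y (sig_inv u x))
     (Hstar_between u (sig_inv u x) ((sig u ^^ 2) (ereal x)) f) \<le> S f z"
proof -
  have "U z < P (n - 1)" using z by (simp add: A_iff)
  also have "P (n - 1) \<le> U x / 2"
  proof -
    have "P (n - 1) * 2 \<le> U x" using x P_Suc(1)[of "n - 1"] by (simp add: A_iff mult.commute)
    from divide_right_mono_ennreal[OF this, of 2] show ?thesis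
      by (simp add: mult_divide_eq_ennreal)
  qed
  also have "\<dots> = U (sig_inv u x)" using sig_inv_props[OF A_pos[OF x]] by simp
  finally have "z < sig_inv u x" by (rule less_if_U_less)
  then show ?thesis
    unfolding e_def using z A_subset[of "n - 2"]
    by (intro wnorm_le_S Hstar_between_Mplus Hstar_between_le) auto
qed

text \<open>A point of \<open>A n\<close> witnesses that x_(n-1) exists, so the block two earlier
  has full mass.\<close>

lemma mu_A_minus_2:
  assumes "A n \<noteq> {}"
  shows "emeasure mu (A (n - 2)) = P (n - 2)"
proof (rule mu_A_eq)
  obtain x where "x \<in> A n" using assms by auto
  then have "x \<in> R (n - 2 + 1)"
    using R_antimono[of "n - 2 + 1" n] by (auto simp: A_def)
  then show "R (n - 2 + 1) \<noteq> {}" by auto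
qed

lemma loc_norm_less_top:
  assumes CS: "CS < top" and x: "x \<in> A n"
  shows "P (n - 2) epowr (1 / r) * (e * loc_norm x) \<le> CS"
proof -
  have A: "A n \<noteq> {}" using x by auto
  show ?thesis
    using opnorm_lower[OF CS, of "A (n - 2)"] loc_norm_lower[OF x] A_subset[of "n - 2"]
    unfolding mu_A_minus_2[OF A] loc_norm_def opnorm_def by simp
qed

text \<open>Finiteness makes half the supremum strictly smaller than a positive supremum, so
  near-extremal choices exist.\<close>

lemma sup_norm_less_top:
  assumes CS: "CS < top"
  shows "sup_norm n < top"
proof -
  have "P (n - 2) epowr (1 / r) * e * sup_norm n \<le> CS"
    unfolding sup_norm_def
    by (subst SUP_mult_left_ennreal) (auto intro!: SUP_least loc_norm_less_top CS simp: mult.assoc)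
  then have "P (n - 2) epowr (1 / r) * e * sup_norm n < top" using CS by simp
  then show ?thesis using e_pos by (auto simp: ennreal_mult_less_top)
qed

lemma nrm_cmult: "f \<in> Mplus \<Longrightarrow> nrm (\<lambda>y. c * f y) = c * nrm f"
proof -
  assume f: "f \<in> Mplus"
  have [measurable]: "(\<lambda>x. f x epowr p * v x) \<in> borel_measurable Leb"
    using Mplus_mult[OF Mplus_epowr[OF f] v] by (simp add: Mplus_def)
  show ?thesis
    using p by (simp add: wnorm_def epowr_mult mult.assoc nn_integral_cmult epowr_epowr)
qed

text \<open>Choose a point whose local norm exceeds half the supremum, then a function violating
  that half as a constant, and normalise it. The factor 2 records the half.\<close>

lemma test_function:
  assumes CS: "CS < top"
  shows "\<exists>h\<in>Mplus. nrm h \<le> 1 \<and> (\<forall>z\<in>A (n - 2). e * sup_norm n \<le> 2 * S h z)"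
proof (cases "sup_norm n = 0")
  case True
  have "nrm (\<lambda>_. 0) = 0" using p by (simp add: wnorm_def)
  then show ?thesis using True by (intro bexI[of _ "\<lambda>_. 0"]) auto
next
  case False
  have "sup_norm n / 2 < sup_norm n"
    using sup_norm_less_top[OF CS, of n] False
    by (cases "sup_norm n") (auto simp: ennreal_divide_numeral ennreal_less_iff)
  then obtain x where x: "x \<in> A n" "sup_norm n / 2 < loc_norm x"
    by (auto simp: sup_norm_def less_SUP_iff)
  define \<Phi> where "\<Phi> f = wnorm q (\<lambda>y. w y * k y (sig_inv u x))
     (Hstar_between u (sig_inv u x) ((sig u ^^ 2) (ereal x)) f)" for f
  have loc_norm: "loc_norm x = least_const (ennreal p) v \<Phi>" by (simp add: loc_norm_def opnorm_def \<Phi>_def[abs_def])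
  obtain f where f: "f \<in> Mplus" "nrm f < top" "sup_norm n / 2 * nrm f < \<Phi> f"
    using x(2) least_const_leI[of "ennreal p" v \<Phi> "sup_norm n / 2"] unfolding loc_norm by (meson not_le)
  have le: "e * \<Phi> f \<le> S f z" if "z \<in> A (n - 2)" for z
    using loc_norm_lower[OF x(1) that] by (simp add: \<Phi>_def)
  have A: "A n \<noteq> {}" using x by auto
  \<comment> \<open>A function of norm 0 would have \<open>\<Phi> f = 0\<close> by
    \<open>S_lower\<close>, since \<open>A (n - 2)\<close> has positive mass; this contradicts the
    strict inequality in the choice of f.\<close>
  have nz: "nrm f \<noteq> 0"
  proof
    assume "nrm f = 0"
    then have "P (n - 2) epowr (1 / r) * (e * \<Phi> f) \<le> 0"
      using S_lower[OF CS A_subset[of "n - 2"] A_borel f(1,2) le] mu_A_minus_2[OF A] by simp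
    then have "\<Phi> f = 0" using e_pos by simp
    then show False using f(3) by simp
  qed
  define c where "c = inverse (nrm f)"
  have c: "c * nrm f = 1"
    using nz f(2) by (simp add: c_def ennreal_divide_self mult.commute[of "inverse _"] flip: divide_ennreal_def)
  have "e * sup_norm n \<le> 2 * S (\<lambda>y. c * f y) z" if z: "z \<in> A (n - 2)" for z
  proof -
    have z0: "0 \<le> z" using z A_subset[of "n - 2"] by auto
    have two: "2 * (x / 2) = x" for x :: ennreal
      by (simp add: ennreal_times_divide mult_divide_eq_ennreal mult.commute[of 2])
    have "e * sup_norm n = 2 * (c * (e * (sup_norm n / 2 * nrm f)))"
      using c two[of "sup_norm n"] by (metis (no_types, lifting) mult.assoc mult.commute mult.right_neutral)
    also have "\<dots> \<le> 2 * (c * (e * \<Phi> f))"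
      using f(3) by (intro mult_left_mono) auto
    also have "\<dots> \<le> 2 * (c * S f z)"
      by (intro mult_left_mono le z) auto
    also have "\<dots> \<le> 2 * S (\<lambda>y. c * f y) z"
      by (intro mult_left_mono S_ge z0 f) auto
    finally show ?thesis .
  qed
  moreover have "nrm (\<lambda>y. c * f y) \<le> 1" using c by (simp add: nrm_cmult f)
  ultimately show ?thesis by (intro bexI[of _ "\<lambda>y. c * f y"]) (auto intro: f)
qed

lemma s_eqs:
  assumes "r < p"
  defines "s \<equiv> 1 / max (1 / r - 1 / p) 0"
  shows "0 < s" "s / r = p / (p - r)" "1 + s / p = s / r" "1 - r / p = r / s" "r / s + r / p = 1"
proof -
  have "1 / p < 1 / r" using assms(1) r by (simp add: frac_less2)
  then have s: "s = r * p / (p - r)"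
    using r p by (simp add: s_def max_def field_simps)
  show "0 < s" "s / r = p / (p - r)" "1 + s / p = s / r" "1 - r / p = r / s" "r / s + r / p = 1"
    unfolding s using assms(1) r p by (simp_all add: field_simps)
qed

text \<open>Test functions \<open>\<Squnion>\<^sub>n a\<^sub>n h\<^sub>n\<close>: a supremum rather than a sum, so that no disjointness of the
  supports is needed for the upper bound of the norm.\<close>

lemma sup_norm_sum_le:
  assumes rp: "r < p" and CS: "CS < top"
  defines "s \<equiv> 1 / max (1 / r - 1 / p) 0"
  shows "((e / 2) epowr r / 4) epowr (s / r) * zsum (\<lambda>n. P n epowr (s / r) * sup_norm n epowr s) \<le> CS epowr s"
proof -
  note s = s_eqs[OF rp, folded s_def]
  \<comment> \<open>The 4 is the ratio of \<open>P n\<close> to \<open>P (n - 2)\<close>; e / 2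
    comes from \<open>test_function\<close>.\<close>
  define \<kappa> where "\<kappa> = (e / 2) epowr r / 4"
  obtain h where h: "\<And>n. h n \<in> Mplus" "\<And>n. nrm (h n) \<le> 1"
      "\<And>n z. z \<in> A (n - 2) \<Longrightarrow> e * sup_norm n \<le> 2 * S (h n) z"
    using test_function[OF CS] by metis
  \<comment> \<open>The equality case of Hoelder: with this choice both the p-th power of the
    coefficient and the resulting lower bound for S equal the n-th summand, up to \<kappa>.\<close>
  define a where "a n = (P n * sup_norm n epowr r) epowr (1 / (p - r))" for n
  have a_top: "a n < top" for n
    using sup_norm_less_top[OF CS, of n] by (simp add: a_def ennreal_mult_less_top)
  have a_p: "a n epowr p = P n epowr (s / r) * sup_norm n epowr s" for n
  proof -
    have "r * (1 / (p - r)) * p = s" "1 / (p - r) * p = s / r"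
      using s(2) r rp by (simp_all add: field_simps)
    then show ?thesis by (simp only: a_def epowr_mult epowr_epowr)
  qed
  have a_r: "P n * sup_norm n epowr r * a n epowr r = a n epowr p" for n
  proof -
    have "P n * sup_norm n epowr r = a n epowr (p - r)" using rp by (simp add: a_def epowr_epowr)
    then show ?thesis by (simp flip: epowr_add)
  qed
  have "\<kappa> epowr (s / r) * (\<Sum>n\<in>K. a n epowr p) \<le> CS epowr s" if K: "finite K" for K
  proof -
    define Z where "Z = (\<Sum>n\<in>K. a n epowr p)"
    have Z_top: "Z < top" using a_top K by (simp add: Z_def)
    define f where "f y = (SUP n\<in>K. a n * h n y)" for y
    have f: "f \<in> Mplus"
    proof -
      have [measurable]: "h n \<in> borel_measurable Leb" for n using h(1) by (simp add: Mplus_def)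
      have "(\<lambda>y. SUP n\<in>K. a n * h n y) \<in> borel_measurable Leb"
        using K by (intro borel_measurable_SUP countable_finite) auto
      then show ?thesis by (simp add: f_def[abs_def] Mplus_def)
    qed
    have "nrm f epowr p \<le> Z"
    proof -
      have m: "(\<lambda>y. h n y epowr p * v y) \<in> borel_measurable Leb" for n
        using Mplus_mult[OF Mplus_epowr[OF h(1)] v] by (simp add: Mplus_def)
      have "f y epowr p \<le> (\<Sum>n\<in>K. a n epowr p * h n y epowr p)" for y
      proof -
        \<comment> \<open>The p-th power of a supremum is at most the sum of the p-th
          powers.\<close>
        have "f y \<le> (\<Sum>n\<in>K. a n epowr p * h n y epowr p) epowr (1 / p)"
          unfolding f_def
        proof (rule SUP_least)
          fix n assume "n \<in> K"
          then have "(a n * h n y) epowr p \<le> (\<Sum>n\<in>K. a n epowr p * h n y epowr p)"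
            using K member_le_sum[of n K "\<lambda>n. a n epowr p * h n y epowr p"]
            by (simp add: epowr_mult)
          then show "a n * h n y \<le> (\<Sum>n\<in>K. a n epowr p * h n y epowr p) epowr (1 / p)"
            using p by (simp add: le_epowr_iff)
        qed
        then show ?thesis using p by (simp add: le_epowr_iff)
      qed
      then have "nrm f epowr p \<le> (\<integral>\<^sup>+y. (\<Sum>n\<in>K. a n epowr p * (h n y epowr p * v y)) \<partial>Leb)"
        unfolding nrm_epowr
        by (intro nn_integral_mono) (metis (no_types, lifting) mult.assoc mult_right_mono sum.cong sum_distrib_right zero_le)
      also have "\<dots> = (\<Sum>n\<in>K. a n epowr p * nrm (h n) epowr p)"
        using m by (simp add: nn_integral_sum nn_integral_cmult nrm_epowr)
      also have "\<dots> \<le> Z"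
        unfolding Z_def
      proof (rule sum_mono)
        fix n
        have "nrm (h n) epowr p \<le> 1"
          using epowr_mono[OF h(2)[of n], of p] p by (simp add: epowr_def)
        from mult_left_mono[OF this, of "a n epowr p"]
        show "a n epowr p * nrm (h n) epowr p \<le> a n epowr p" by simp
      qed
      finally show ?thesis .
    qed
    then have nrm_f: "nrm f \<le> Z epowr (1 / p)" using p by (simp add: le_epowr_iff)
    then have nrm_top: "nrm f < top" using Z_top by (auto intro: le_less_trans)
    have S_f: "a n * (e / 2 * sup_norm n) \<le> S f x" if n: "n \<in> K" and x: "x \<in> A (n - 2)" for n x
    proof -
      have x0: "0 \<le> x" using x A_subset[of "n - 2"] by auto
      have "e / 2 * sup_norm n \<le> S (h n) x"
        using divide_right_mono_ennreal[OF h(3)[OF x], of 2] mult_divide_eq_ennreal[of 2 "S (h n) x"]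
        by (simp add: ennreal_divide_times mult.commute[of 2] flip: ennreal_times_divide)
      then have "a n * (e / 2 * sup_norm n) \<le> a n * S (h n) x" by (rule mult_left_mono) simp
      also have "\<dots> \<le> S f x"
        using n by (intro S_ge x0 h) (auto simp: f_def intro: SUP_upper)
      finally show ?thesis .
    qed
    have "\<kappa> * Z \<le> zsum (\<lambda>m. emeasure mu (A m) * (indicator K (m + 2) * (a (m + 2) * (e / 2 * sup_norm (m + 2))) epowr r))"
    proof -
      have "\<kappa> * Z = (\<Sum>n\<in>K. \<kappa> * a n epowr p)" by (simp add: Z_def sum_distrib_left)
      also have "\<dots> = (\<Sum>n\<in>K. emeasure mu (A (n - 2)) * (a n * (e / 2 * sup_norm n)) epowr r)"
      proof (rule sum.cong)
        fix n
        show "\<kappa> * a n epowr p = emeasure mu (A (n - 2)) * (a n * (e / 2 * sup_norm n)) epowr r"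
        proof (cases "A n = {}")
          case True
          \<comment> \<open>On an empty block the supremum is 0, so its coefficient vanishes and the
            mass of \<open>A (n - 2)\<close> does not matter.\<close>
          then have "sup_norm n = 0" by (simp add: sup_norm_def bot_ennreal)
          moreover from this have "a n = 0" by (simp add: a_def)
          ultimately show ?thesis by simp
        next
          case False
          have "\<kappa> * a n epowr p = (e / 2) epowr r / 4 * (4 * P (n - 2) * sup_norm n epowr r * a n epowr r)"
            using P_Suc(2)[of "n - 2"] a_r[of n] by (simp add: \<kappa>_def)
          also have "\<dots> = (e / 2) epowr r * (P (n - 2) * sup_norm n epowr r * a n epowr r)"
          proof -
            have "x / 4 * (4 * y) = x * y" for x y :: ennreal
              by (simp add: ennreal_divide_times ennreal_times_divide mult_divide_eq_ennreal ac_simps flip: mult.assoc)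
            then show ?thesis by (simp add: mult.assoc)
          qed
          finally show ?thesis
            unfolding mu_A_minus_2[OF False] by (simp add: epowr_mult ac_simps)
        qed
      qed simp
      also have "\<dots> = zsum (\<lambda>n. emeasure mu (A (n - 2)) * (indicator K n * (a n * (e / 2 * sup_norm n)) epowr r))"
        using K by (subst nn_integral_count_space'[of K]) auto
      also have "\<dots> = zsum (\<lambda>m. emeasure mu (A m) * (indicator K (m + 2) * (a (m + 2) * (e / 2 * sup_norm (m + 2))) epowr r))"
        by (subst zsum_shift[of _ 2, symmetric]) simp
      finally show ?thesis by simp
    qed
    also have "\<dots> \<le> (\<integral>\<^sup>+x. u x * S f x epowr r \<partial>Leb)"
    proof (rule step_lower)
      fix m x assume x: "x \<in> A m"
      have "(a (m + 2) * (e / 2 * sup_norm (m + 2))) epowr r \<le> S f x epowr r" if "m + 2 \<in> K"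
        using S_f[OF that, of x] x r by (intro epowr_mono) auto
      then show "u x * (indicator K (m + 2) * (a (m + 2) * (e / 2 * sup_norm (m + 2))) epowr r) \<le> u x * S f x epowr r"
        by (intro mult_left_mono) (auto split: split_indicator)
    qed
    also have "\<dots> \<le> (CS * nrm f) epowr r" by (rule CS_D[OF f CS nrm_top])
    also have "\<dots> \<le> CS epowr r * Z epowr (r / p)"
      using epowr_mono[OF nrm_f, of r] r by (simp add: epowr_mult epowr_epowr mult_left_mono)
    finally have main: "\<kappa> * Z \<le> CS epowr r * Z epowr (r / p)" .
    show ?thesis
    proof (cases "Z = 0")
      case False
      \<comment> \<open>Since r / s + r / p = 1, the power r / p of Z can be cancelled; Z is finite
        because K is.\<close>
      have "\<kappa> * Z epowr (r / s) * Z epowr (r / p) \<le> CS epowr r * Z epowr (r / p)"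
        using main s(5) by (simp add: mult.assoc flip: epowr_add)
      then have "\<kappa> * Z epowr (r / s) \<le> CS epowr r"
        using False Z_top ennreal_mult_le_mult_iff[of "Z epowr (r / p)" "\<kappa> * Z epowr (r / s)" "CS epowr r"]
        by (simp add: mult.commute)
      then have "(\<kappa> * Z epowr (r / s)) epowr (s / r) \<le> (CS epowr r) epowr (s / r)"
        using s(1) r by (intro epowr_mono) auto
      then show ?thesis using s(1) r by (simp add: epowr_mult epowr_epowr Z_def)
    qed (simp add: Z_def)
  qed
  then have "zsum (\<lambda>n. \<kappa> epowr (s / r) * a n epowr p) \<le> CS epowr s"
    by (intro zsum_le_if_finite) (simp flip: sum_distrib_left)
  then show ?thesis by (simp add: zsum_cmult a_p \<kappa>_def)
qed

text \<open>On \<open>A n\<close> the integrand is bounded using U(x) < 2^(n+1) and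
  \<open>sup_norm n\<close>. Replacing 2^(n+1) by 2^n produces the factor
  \<open>2 epowr (1 / p)\<close> after the final root.\<close>

lemma B2_le_if_r_less_p:
  assumes rp: "r < p"
  defines "s \<equiv> 1 / max (1 / r - 1 / p) 0"
  shows "((e / 2) epowr r / 4) epowr (1 / r) * B2 p r q u v w k \<le> 2 epowr (1 / p) * CS"
proof (cases "CS < top")
  case CS: True
  note s = s_eqs[OF rp, folded s_def]
  define h where "h x = (if U x = 0 then 0 else U x epowr (s / p) * loc_norm x epowr s)" for x
  have "(if U x = 0 then 0 else u x * U x epowr (s / p) * loc_norm x epowr s) = u x * h x" for x
    by (simp add: h_def mult.assoc)
  moreover have "B2 p r q u v w k =
      (\<integral>\<^sup>+x. (if U x = 0 then 0 else u x * U x epowr (s / p) * loc_norm x epowr s) \<partial>Leb) epowr (1 / s)"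
    unfolding B2_def Let_def loc_norm_def s_def using rp by simp
  ultimately have "B2 p r q u v w k = (\<integral>\<^sup>+x. u x * h x \<partial>Leb) epowr (1 / s)"
    by simp
  then have "B2 p r q u v w k epowr s = (\<integral>\<^sup>+x. u x * h x \<partial>Leb)"
    using s(1) by (simp add: epowr_epowr)
  also have "\<dots> \<le> zsum (\<lambda>n. P n * (P (n + 1) epowr (s / p) * sup_norm n epowr s))"
  proof (rule step_upper)
    fix n x assume x: "x \<in> A n"
    have "U x epowr (s / p) * loc_norm x epowr s \<le> P (n + 1) epowr (s / p) * sup_norm n epowr s"
      using x s(1) p by (intro mult_mono epowr_mono) (auto simp: A_iff sup_norm_def intro: SUP_upper)
    then show "h x \<le> P (n + 1) epowr (s / p) * sup_norm n epowr s"
      by (simp add: h_def)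
  qed
  also have "\<dots> = zsum (\<lambda>n. 2 epowr (s / p) * (P n epowr (s / r) * sup_norm n epowr s))"
  proof -
    have "P n * P n epowr (s / p) = P n epowr (s / r)" for n
      using epowr_add[of "P n" 1 "s / p"] by (simp add: s(3))
    moreover have "P n * (P (n + 1) epowr (s / p) * sup_norm n epowr s) = 2 epowr (s / p) * (P n * P n epowr (s / p) * sup_norm n epowr s)" for n
      unfolding P_Suc epowr_mult by (simp only: ac_simps)
    ultimately show ?thesis by simp
  qed
  also have "\<dots> = 2 epowr (s / p) * zsum (\<lambda>n. P n epowr (s / r) * sup_norm n epowr s)"
    by (rule zsum_cmult)
  finally have "((e / 2) epowr r / 4) epowr (s / r) * B2 p r q u v w k epowr s
      \<le> ((e / 2) epowr r / 4) epowr (s / r) * (2 epowr (s / p) * zsum (\<lambda>n. P n epowr (s / r) * sup_norm n epowr s))"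
    by (rule mult_left_mono) simp
  also have "\<dots> = 2 epowr (s / p) * (((e / 2) epowr r / 4) epowr (s / r) * zsum (\<lambda>n. P n epowr (s / r) * sup_norm n epowr s))"
    by (rule mult.left_commute)
  also have "\<dots> \<le> 2 epowr (s / p) * CS epowr s"
    using sup_norm_sum_le[OF rp CS] by (intro mult_left_mono) (auto simp: s_def)
  finally have "(((e / 2) epowr r / 4) epowr (1 / r) * B2 p r q u v w k) epowr s \<le> (2 epowr (1 / p) * CS) epowr s"
    by (simp add: epowr_mult epowr_epowr)
  then show ?thesis
    using s(1) by (simp add: epowr_mono_iff)
qed (simp add: less_top[symmetric] ennreal_mult_top)

end

section \<open>The conditions are sufficient\<close>

context setting
begin

section \<open>Quantities attached to the blocks\<close>

definition kap :: "int \<Rightarrow> ennreal" where "kap m = k (X (m + 1)) (X m)"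
text \<open>\<open>Fr\<close> and \<open>Fm\<close> split the tail at x_(m+2). Using
  \<open>R (m + 2)\<close> and its complement keeps the splitting correct when x_(m+2) does not
  exist: then \<open>Fr\<close> is 0 and \<open>Fm\<close> is the whole tail.\<close>

definition Fr :: "(real \<Rightarrow> ennreal) \<Rightarrow> int \<Rightarrow> ennreal" where
  "Fr f m = (\<integral>\<^sup>+z\<in>R (m + 2). f z \<partial>lebesgue)"
definition Fm :: "(real \<Rightarrow> ennreal) \<Rightarrow> int \<Rightarrow> real \<Rightarrow> ennreal" where
  "Fm f m y = (\<integral>\<^sup>+z\<in>{y..} - R (m + 2). f z \<partial>lebesgue)"
text \<open>On \<open>A m\<close> the kernel is based at x_(m-1), one block to the left: this is the
  last link of the chain in \<open>kernel_decomposition\<close>, and every point of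
  \<open>A (m - 2)\<close> lies to its left, as required for \<open>B0\<close>.\<close>

definition Cker :: "int \<Rightarrow> real \<Rightarrow> ennreal" where
  "Cker m y = indicator (A m) y * (k y (X (m - 1)) * w y)"
definition Eker :: "(real \<Rightarrow> ennreal) \<Rightarrow> int \<Rightarrow> real \<Rightarrow> ennreal" where
  "Eker f m y = indicator (A m) y * (k y (X (m - 1)) * w y * tail f y epowr g)"
definition Vker :: "(real \<Rightarrow> ennreal) \<Rightarrow> int \<Rightarrow> real \<Rightarrow> ennreal" where
  "Vker f m y = indicator (A m) y * (k y (X (m - 1)) * w y * Fm f m y epowr g)"
definition Gker :: "(real \<Rightarrow> ennreal) \<Rightarrow> int \<Rightarrow> real \<Rightarrow> ennreal" where
  "Gker f m y = indicator (R (m + 2)) y * (w y * tail f y epowr g)"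

lemma A_Int_lebesgue: "A m \<inter> {0..} \<in> sets lebesgue" and R_Int_lebesgue: "R m \<inter> {0..} \<in> sets lebesgue"
  by (auto intro!: sets_completionI_sets sets.Int)

lemma Fm_Mplus: "Fm f m \<in> Mplus"
  unfolding Fm_def by (intro Mplus_antimono set_nn_integral_antimono) (auto simp: antimono_def)

lemma kers_Mplus: "Cker m \<in> Mplus" "Eker f m \<in> Mplus" "Vker f m \<in> Mplus" "Gker f m \<in> Mplus"
  unfolding Cker_def Eker_def Vker_def Gker_def
  by (intro Mplus_indicator Mplus_mult Mplus_epowr k_Mplus X_nonneg w Mplus_tail Fm_Mplus
      A_Int_lebesgue R_Int_lebesgue)+

text \<open>Apply \<open>k_chain\<close> to the cut points between x and y. Full blocks contribute
  \<open>kap\<close>, and the last link ends at y itself.\<close>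

lemma kernel_decomposition:
  assumes N: "1 \<le> N" "D \<le> l ^ N" and l: "1 \<le> l"
    and x: "x \<in> A n" and y: "y \<in> A (n + int L)" and xy: "x \<le> y"
  shows "k y x \<le> ennreal (D ^ (N + 2)) * (\<Sum>i<Suc L. ennreal (l ^ i) *
    (indicator (A (n + int i)) y * k y (X (n + int i - 1)) + kap (n + int i) * indicator (R (n + int i + 2)) y))"
    (is "_ \<le> _ * (\<Sum>i<Suc L. ?t i)")
proof -
  have DD: "ennreal (D ^ (N + 2)) = ennreal D * ennreal (D ^ (N + 1))"
    using D_pos by (simp flip: ennreal_mult)
  have yR: "y \<in> R m" if "m \<le> n + int L" for m
    using y R_antimono[OF that] by (auto simp: A_def)
  have x0: "X n \<le> x" "X (n - 1) \<le> x" "0 \<le> x"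
    using x X_le[of x n] X_le[of x "n - 1"] R_antimono[of "n - 1" n] R_subset[of n] by (auto simp: A_def)
  show ?thesis
  proof (cases L)
    case 0
    have "k y x \<le> ennreal D * k y (X (n - 1))"
      using x0 xy X_nonneg by (intro k_lower) auto
    also have "\<dots> \<le> ennreal (D ^ (N + 2)) * k y (X (n - 1))"
      using D_ge_1 self_le_power[of D "N + 2"] by (intro mult_right_mono ennreal_leI) auto
    also have "\<dots> \<le> ennreal (D ^ (N + 2)) * ?t 0"
      using y 0 by (intro mult_left_mono) (auto simp: add_increasing2)
    finally show ?thesis using 0 by simp
  next
    case (Suc L')
    \<comment> \<open>The cut point \<open>X (n + int L)\<close> is skipped in favour of y, so the
      last link starts at \<open>X (n + int L - 1)\<close>.\<close>
    define z where "z i = (if i < L then X (n + int i) else y)" for i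
    have "k y x \<le> ennreal D * k y (X n)"
      using x0 xy X_nonneg by (intro k_lower) auto
    also have "k y (X n) = k (z L) (z 0)" using Suc by (simp add: z_def)
    also have "\<dots> \<le> ennreal (D ^ (N + 1)) * (\<Sum>i<L. ennreal (l ^ i) * k (z (Suc i)) (z i))"
    proof (rule k_chain[OF N l])
      show "1 \<le> L" "0 \<le> z 0" using Suc X_nonneg by (auto simp: z_def)
      fix i assume i: "i < L"
      show "z i \<le> z (Suc i)"
      proof (cases "Suc i < L")
        case True
        then have "R (n + int (Suc i)) \<noteq> {}" using yR[of "n + int (Suc i)"] by auto
        then show ?thesis using True by (auto simp: z_def intro!: X_mono)
      next
        case False
        then show ?thesis using i yR[of "n + int i"] by (auto simp: z_def intro!: X_le)
      qed
    qed
    also have "(\<Sum>i<L. ennreal (l ^ i) * k (z (Suc i)) (z i)) \<le> (\<Sum>i<Suc L. ?t i)"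
    proof -
      have 1: "ennreal (l ^ i) * k (z (Suc i)) (z i) \<le> ?t i" if "i < L'" for i
      proof -
        have "k (z (Suc i)) (z i) = kap (n + int i)" using that Suc by (simp add: z_def kap_def ac_simps)
        moreover have "y \<in> R (n + int i + 2)" using that Suc by (intro yR) auto
        ultimately show ?thesis by (intro mult_left_mono) (auto simp: add_increasing)
      qed
      \<comment> \<open>The last link has index L - 1 in the chain but is booked at index L, the
        block containing y; its weight only grows.\<close>
      have "ennreal (l ^ L') * k (z (Suc L')) (z L') \<le> ennreal (l ^ L) * (indicator (A (n + int L)) y * k y (X (n + int L - 1)))"
        using Suc y l by (auto simp: z_def intro!: mult_mono ennreal_leI)
      also have "\<dots> \<le> ?t L" by (intro mult_left_mono) auto
      finally have 2: "ennreal (l ^ L') * k (z (Suc L')) (z L') \<le> ?t L" .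
      have "(\<Sum>i<L. ennreal (l ^ i) * k (z (Suc i)) (z i)) \<le> (\<Sum>i<L'. ?t i) + ?t L"
        unfolding Suc using 1 2 unfolding Suc by (auto intro!: add_mono sum_mono)
      also have "\<dots> \<le> (\<Sum>i<Suc L. ?t i)"
        unfolding Suc by (simp add: add_increasing2 add.assoc add_left_mono)
      finally show ?thesis .
    qed
    finally show ?thesis
      unfolding DD by (simp add: mult.assoc mult_left_mono)
  qed
qed

text \<open>The length of the chain depends on y, so the finite sums are enlarged to one series
  before \<open>Efun\<close> is taken termwise.\<close>

lemma Efun_Sker_le:
  assumes N: "1 \<le> N" "D \<le> l ^ N" and l: "1 \<le> l" and x: "x \<in> A n"
  shows "Efun q (Sker f x) \<le> ennreal (D ^ (N + 2)) * (\<Sum>i. ennreal (l ^ i) *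
    (Efun q (Eker f (n + int i)) + kap (n + int i) * Efun q (Gker f (n + int i))))"
proof -
  have x0: "0 \<le> x" using x A_subset[of n] by auto
  define H where "H i y = ennreal (l ^ i) * (Eker f (n + int i) y + kap (n + int i) * Gker f (n + int i) y)" for i y
  have H: "H i \<in> Mplus" for i
    unfolding H_def by (intro Mplus_mult Mplus_add Mplus_const kers_Mplus)
  have "(\<lambda>y. \<Sum>i. H i y) \<in> Mplus"
    using H by (simp add: Mplus_def)
  have "Efun q (Sker f x) \<le> Efun q (\<lambda>y. ennreal (D ^ (N + 2)) * (\<Sum>i. H i y))"
  proof (rule Efun_mono[OF Sker_Mplus[OF x0]])
    fix y :: real assume "0 \<le> y"
    show "Sker f x y \<le> ennreal (D ^ (N + 2)) * (\<Sum>i. H i y)"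
    proof (cases "x \<le> y")
      case True
      have "0 < U y" using A_pos[OF x] U_mono[OF True] by (rule less_le_trans)
      then obtain m where m: "y \<in> A m" using A_exists by auto
      have "n \<le> m"
      proof -
        have "P n \<le> U y" using x U_mono[OF True] by (auto simp: A_iff intro: order_trans)
        also have "\<dots> < P (m + 1)" using m by (simp add: A_iff)
        finally show ?thesis by simp
      qed
      then obtain L where L: "m = n + int L" using zle_iff_zadd by auto
      have "Sker f x y = k y x * (w y * tail f y epowr g)"
        using True by (simp add: Sker_def mult.assoc)
      also have "\<dots> \<le> ennreal (D ^ (N + 2)) * (\<Sum>i<Suc L. ennreal (l ^ i) *
          (indicator (A (n + int i)) y * k y (X (n + int i - 1)) + kap (n + int i) * indicator (R (n + int i + 2)) y))
           * (w y * tail f y epowr g)"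
        using m unfolding L by (intro mult_right_mono kernel_decomposition N l x True) auto
      also have "\<dots> = ennreal (D ^ (N + 2)) * (\<Sum>i<Suc L. H i y)"
        unfolding mult.assoc[of "ennreal (D ^ (N + 2))"] sum_distrib_right
        by (intro arg_cong2[where f = "(*)"] sum.cong refl)
          (simp only: H_def Eker_def Gker_def distrib_right distrib_left ac_simps)
      also have "\<dots> \<le> ennreal (D ^ (N + 2)) * (\<Sum>i. H i y)"
        by (intro mult_left_mono sum_le_suminf) auto
      finally show ?thesis .
    qed (simp add: Sker_def)
  qed
  also have "\<dots> = ennreal (D ^ (N + 2)) * Efun q (\<lambda>y. \<Sum>i. H i y)"
    by (rule Efun_cmult) fact
  also have "\<dots> \<le> ennreal (D ^ (N + 2)) * (\<Sum>i. Efun q (H i))"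
    by (intro mult_left_mono Efun_suminf H) auto
  also have "\<dots> \<le> ennreal (D ^ (N + 2)) * (\<Sum>i. ennreal (l ^ i) *
    (Efun q (Eker f (n + int i)) + kap (n + int i) * Efun q (Gker f (n + int i))))"
  proof (intro mult_left_mono suminf_le)
    fix i
    have "Efun q (H i) = ennreal (l ^ i) * Efun q (\<lambda>y. Eker f (n + int i) y + kap (n + int i) * Gker f (n + int i) y)"
      unfolding H_def by (intro Efun_cmult Mplus_add Mplus_mult Mplus_const kers_Mplus)
    also have "\<dots> \<le> ennreal (l ^ i) * (Efun q (Eker f (n + int i)) + Efun q (\<lambda>y. kap (n + int i) * Gker f (n + int i) y))"
      by (intro mult_left_mono Efun_add Mplus_mult Mplus_const kers_Mplus) auto
    finally show "Efun q (H i) \<le> ennreal (l ^ i) *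
      (Efun q (Eker f (n + int i)) + kap (n + int i) * Efun q (Gker f (n + int i)))"
      by (simp add: Efun_cmult kers_Mplus)
  qed auto
  finally show ?thesis .
qed

text \<open>The block bounds on S are summed against \<open>P n\<close>, and the weights
  \<open>l ^ i\<close> disappear by \<open>zsum_weighted_epowr_le\<close>.\<close>

lemma S_integral_le:
  assumes N: "1 \<le> N" "D \<le> l ^ N" and l: "1 < l" "l powr (2 * b) < 2"
  shows "(\<integral>\<^sup>+x. u x * S f x epowr r \<partial>Leb) \<le>
    ennreal (D ^ (N + 2)) epowr b * (ennreal (1 / (1 - 1 / l)) epowr b * ennreal (1 / (1 - l powr (2 * b) / 2))) * 2 epowr b *
     (zsum (\<lambda>n. P n * Efun q (Eker f n) epowr b) + zsum (\<lambda>n. P n * (kap n * Efun q (Gker f n)) epowr b))"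
proof -
  define c where "c n = Efun q (Eker f n) + kap n * Efun q (Gker f n)" for n
  let ?D = "ennreal (D ^ (N + 2)) epowr b"
  let ?L = "ennreal (1 / (1 - 1 / l)) epowr b * ennreal (1 / (1 - l powr (2 * b) / 2))"
  have "(\<integral>\<^sup>+x. u x * S f x epowr r \<partial>Leb) \<le> zsum (\<lambda>n. P n * (?D * (\<Sum>i. ennreal (l ^ i) * c (n + int i)) epowr b))"
  proof (rule step_upper)
    fix n x assume x: "x \<in> A n"
    then have "0 \<le> x" using A_subset[of n] by auto
    then have "S f x epowr r = Efun q (Sker f x) epowr b" by (rule S_epowr)
    also have "\<dots> \<le> (ennreal (D ^ (N + 2)) * (\<Sum>i. ennreal (l ^ i) * c (n + int i))) epowr b"
      using b_pos l x unfolding c_def by (intro epowr_mono Efun_Sker_le N) auto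
    finally show "S f x epowr r \<le> ?D * (\<Sum>i. ennreal (l ^ i) * c (n + int i)) epowr b"
      by (simp only: epowr_mult)
  qed
  also have "\<dots> = ?D * zsum (\<lambda>n. P n * (\<Sum>i. ennreal (l ^ i) * c (n + int i)) epowr b)"
    by (simp only: mult.left_commute[of _ ?D] zsum_cmult)
  also have "\<dots> \<le> ?D * (?L * zsum (\<lambda>n. P n * c n epowr b))"
    by (intro mult_left_mono zsum_weighted_epowr_le b_pos l) simp
  also have "zsum (\<lambda>n. P n * c n epowr b) \<le> zsum (\<lambda>n. 2 epowr b * (P n * Efun q (Eker f n) epowr b + P n * (kap n * Efun q (Gker f n)) epowr b))"
  proof (rule zsum_mono)
    fix n
    have "P n * c n epowr b \<le> P n * (2 epowr b * (Efun q (Eker f n) epowr b + (kap n * Efun q (Gker f n)) epowr b))"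
      unfolding c_def by (intro mult_left_mono epowr_add_le b_pos) simp
    then show "P n * c n epowr b \<le> 2 epowr b * (P n * Efun q (Eker f n) epowr b + P n * (kap n * Efun q (Gker f n)) epowr b)"
      by (simp only: mult.left_commute distrib_left)
  qed
  also have "\<dots> = 2 epowr b * (zsum (\<lambda>n. P n * Efun q (Eker f n) epowr b) + zsum (\<lambda>n. P n * (kap n * Efun q (Gker f n)) epowr b))"
    by (subst zsum_cmult) (simp add: nn_integral_add)
  finally show ?thesis
    by (simp add: mult_left_mono mult.assoc)
qed

text \<open>Split the tail into \<open>Fm\<close> and \<open>Fr\<close>. The inner power g costs
  \<open>2 epowr g\<close>, which becomes \<open>2 epowr r\<close> under the power b; the outer
  power costs \<open>2 epowr b\<close>.\<close>

lemma Eker_le: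
  assumes f: "f \<in> Mplus"
  shows "Efun q (Eker f m) epowr b
    \<le> 2 epowr r * 2 epowr b * (Efun q (Vker f m) epowr b + Efun q (Cker m) epowr b * Fr f m epowr r)"
proof -
  let ?c = "Fr f m epowr g"
  have mc: "(\<lambda>y. Vker f m y + ?c * Cker m y) \<in> Mplus" "(\<lambda>y. ?c * Cker m y) \<in> Mplus"
    by (intro Mplus_add Mplus_mult Mplus_const kers_Mplus)+
  have "Efun q (Eker f m) \<le> Efun q (\<lambda>y. 2 epowr g * (Vker f m y + ?c * Cker m y))"
  proof (rule Efun_mono[OF kers_Mplus(2)])
    fix y :: real assume y: "0 \<le> y"
    have "tail f y \<le> Fm f m y + Fr f m"
    proof -
      have 1: "({y..} - R (m + 2)) \<inter> {0..} \<in> sets lebesgue"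
        by (auto intro!: sets_completionI_sets sets.Int sets.Diff)
      have [measurable]: "(\<lambda>z. indicator ({y..} - R (m + 2)) z * f z) \<in> borel_measurable Leb"
        "(\<lambda>z. indicator (R (m + 2)) z * f z) \<in> borel_measurable Leb"
        using Mplus_indicator[OF f 1] Mplus_indicator[OF f R_Int_lebesgue] by (auto simp: Mplus_def)
      have "tail f y = (\<integral>\<^sup>+z. indicator {y..} z * f z \<partial>Leb)"
        unfolding tail_def using y by (intro nn_integral_indicator_Leb) auto
      also have "\<dots> \<le> (\<integral>\<^sup>+z. indicator ({y..} - R (m + 2)) z * f z + indicator (R (m + 2)) z * f z \<partial>Leb)"
        by (intro nn_integral_mono) (auto split: split_indicator)
      also have "\<dots> = (\<integral>\<^sup>+z. indicator ({y..} - R (m + 2)) z * f z \<partial>Leb) + (\<integral>\<^sup>+z. indicator (R (m + 2)) z * f z \<partial>Leb)"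
        by (rule nn_integral_add) measurable
      also have "\<dots> = Fm f m y + Fr f m"
        unfolding Fm_def Fr_def using y R_subset[of "m + 2"]
        by (intro arg_cong2[where f = "(+)"] nn_integral_indicator_Leb[symmetric]) auto
      finally show ?thesis by simp
    qed
    then have "tail f y epowr g \<le> (Fm f m y + Fr f m) epowr g"
      using g_pos by (intro epowr_mono) auto
    also have "\<dots> \<le> 2 epowr g * (Fm f m y epowr g + ?c)"
      using g_pos by (rule epowr_add_le)
    finally have "indicator (A m) y * (k y (X (m - 1)) * w y) * tail f y epowr g
        \<le> indicator (A m) y * (k y (X (m - 1)) * w y) * (2 epowr g * (Fm f m y epowr g + ?c))"
      by (rule mult_left_mono) simp
    then show "Eker f m y \<le> 2 epowr g * (Vker f m y + ?c * Cker m y)"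
      by (simp only: Eker_def Vker_def Cker_def distrib_left ac_simps)
  qed
  also have "\<dots> = 2 epowr g * Efun q (\<lambda>y. Vker f m y + ?c * Cker m y)"
    by (intro Efun_cmult mc)
  also have "\<dots> \<le> 2 epowr g * (Efun q (Vker f m) + Efun q (\<lambda>y. ?c * Cker m y))"
    by (intro mult_left_mono Efun_add mc kers_Mplus) simp
  also have "Efun q (\<lambda>y. ?c * Cker m y) = ?c * Efun q (Cker m)"
    by (intro Efun_cmult kers_Mplus)
  finally have "Efun q (Eker f m) epowr b \<le> (2 epowr g * (Efun q (Vker f m) + ?c * Efun q (Cker m))) epowr b"
    using b_pos by (intro epowr_mono) auto
  also have "\<dots> = 2 epowr r * (Efun q (Vker f m) + ?c * Efun q (Cker m)) epowr b"
    by (simp add: epowr_mult epowr_epowr g_b)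
  also have "\<dots> \<le> 2 epowr r * (2 epowr b * (Efun q (Vker f m) epowr b + (?c * Efun q (Cker m)) epowr b))"
    by (intro mult_left_mono epowr_add_le b_pos) simp
  finally show ?thesis
    by (simp add: epowr_mult epowr_epowr g_b ac_simps)
qed

section \<open>Discrete forms of the three conditions\<close>

lemma B_D:
  assumes "f \<in> Mplus" "nrm f < top" "least_const (ennreal p) v (\<lambda>f. (\<integral>\<^sup>+x. I f x \<partial>Leb) epowr (1 / r)) < top"
  shows "(\<integral>\<^sup>+x. I f x \<partial>Leb)
    \<le> (least_const (ennreal p) v (\<lambda>f. (\<integral>\<^sup>+x. I f x \<partial>Leb) epowr (1 / r)) * nrm f) epowr r"
  using least_constD[of f "ennreal p" v "\<lambda>f. (\<integral>\<^sup>+x. I f x \<partial>Leb) epowr (1 / r)"] assms r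
  by (simp add: epowr_le_iff)

lemma mu_A_eq_if: "R m \<noteq> {} \<Longrightarrow> n < m \<Longrightarrow> emeasure mu (A n) = P n"
  using R_antimono[of "n + 1" m] by (intro mu_A_eq) auto

text \<open>U at the j-th iterate is 2^j U(x), so that iterate lies in block n + j; existence of the
  next cut point makes it finite.\<close>

lemma sig_iter_in_A:
  assumes x: "x \<in> A n" and R: "R (n + int j + 1) \<noteq> {}"
  shows "\<exists>t. (sig u ^^ j) (ereal x) = ereal t \<and> 0 \<le> t \<and> R (n + int j + 1) \<subseteq> {t..} \<and>
    (\<forall>i \<le> n + int j. X i \<le> t) \<and> x \<le> X (n + 1)"
proof -
  have U: "0 < U x" using A_pos[OF x] .
  have lt: "2 ^ j * U x < P (n + int j + 1)"
  proof -
    have "U x < P (n + 1)" using x by (simp add: A_iff)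
    then have "U x * 2 ^ j < P (n + 1) * 2 ^ j"
    proof (rule ennreal_mult_strict_right_mono)
      have "(2::ennreal) ^ j \<noteq> 0" by simp
      then show "0 < (2::ennreal) ^ j" using zero_less_iff_neq_zero by blast
    qed (simp add: power_less_top_ennreal)
    also have "P (n + 1) * 2 ^ j = P (n + int j + 1)"
      using P_add_nat[of "n + 1" j] by (simp add: ac_simps)
    finally show ?thesis by (simp add: mult.commute)
  qed
  then have "2 ^ j * U x \<le> U (X (n + int j + 1))"
    using X_props(1)[OF R] by simp
  from sig_iter_exists[OF U this] obtain t where t: "(sig u ^^ j) (ereal x) = ereal t" "U t = 2 ^ j * U x" .
  have le: "P (n + int j) \<le> U t"
    unfolding t P_add_nat using x by (intro mult_left_mono) (auto simp: A_iff)
  then have tR: "t \<in> R (n + int j)" by (simp add: R_iff)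
  show ?thesis
  proof (intro exI[of _ t] conjI allI impI t(1))
    show "0 \<le> t" using tR R_subset by auto
    show "R (n + int j + 1) \<subseteq> {t..}"
    proof
      fix y assume "y \<in> R (n + int j + 1)"
      then have "U t < U y" using lt t by (auto simp: R_iff intro: less_le_trans)
      then show "y \<in> {t..}" using less_if_U_less by fastforce
    qed
    fix i assume "i \<le> n + int j"
    from R_antimono[OF this] show "X i \<le> t"
      using tR by (intro X_le) auto
  next
    show "x \<le> X (n + 1)"
      using R R_antimono[of "n + 1" "n + int j + 1"] by (intro le_X_if_A[OF x]) auto
  qed
qed

text \<open>For x in \<open>A n\<close>, the block \<open>A (n + 2)\<close> lies between x and
  \<sigma>^3(x), while \<open>R (n + 4)\<close> lies beyond. The shift by two blocks costs the
  factor 4.\<close>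

lemma B0_discrete:
  assumes f: "f \<in> Mplus" "nrm f < top" and B: "B0 p r q u v w k < top"
  shows "ennreal (D powr - b) * zsum (\<lambda>m. P m * (Efun q (Cker m) epowr b * Fr f m epowr r))
    \<le> 4 * (B0 p r q u v w k * nrm f) epowr r"
proof -
  define T where "T m = ennreal (D powr - b) * (Efun q (Cker m) epowr b * Fr f m epowr r)" for m
  \<comment> \<open>Only if x_(m+2) is missing can \<sigma>^3 be infinite on
    \<open>A (m - 2)\<close> or the mass of that block fall short, and then the term is 0.\<close>
  have T_zero: "T m = 0" if "R (m + 2) = {}" for m
    using that by (simp add: T_def Fr_def)
  have "zsum (\<lambda>n. emeasure mu (A n) * T (n + 2)) \<le> (\<integral>\<^sup>+x. B0_integrand r q u w k f x \<partial>Leb)"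
  proof (rule step_lower)
    fix n x assume x: "x \<in> A n"
    show "u x * T (n + 2) \<le> B0_integrand r q u w k f x"
    proof (cases "R (n + 2 + 2) = {}")
      case False
      have x0: "0 \<le> x" using x A_subset[of n] by auto
      have n4: "n + int 3 + 1 = n + 4" "n + 2 + 2 = n + 4" by simp_all
      then have "R (n + int 3 + 1) \<noteq> {}" using False by simp
      from sig_iter_in_A[OF x this, unfolded n4] obtain t where t: "(sig u ^^ 3) (ereal x) = ereal t"
        "0 \<le> t" "R (n + 4) \<subseteq> {t..}" "x \<le> X (n + 1)" by blast
      let ?h = "\<lambda>y. indicator {x..t} y * (k y x * w y)"
      have m: "(\<lambda>y. k y x * w y) \<in> Mplus" by (intro Mplus_mult k_Mplus w x0)
      have m': "?h \<in> Mplus" by (intro Mplus_indicator m) auto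
      have int: "B0_integrand r q u w k f x = u x * (Efun q ?h epowr b * tail f t epowr r)"
        using x0 m by (subst Efun_indicator) (auto simp: B0_integrand_def t b_def gam_def tail_def mult.assoc)
      have "Efun q (Cker (n + 2)) \<le> Efun q (\<lambda>y. ennreal D * ?h y)"
      proof (rule Efun_mono[OF kers_Mplus(1)])
        fix y :: real
        show "Cker (n + 2) y \<le> ennreal D * ?h y"
        proof (cases "y \<in> A (n + 2)")
          case True
          have y: "X (n + 1) \<le> y"
            using True R_antimono[of "n + 1" "n + 2"] by (intro X_le) (auto simp: A_def)
          have "y \<le> t"
          proof -
            have "ereal y < (sig u ^^ 3) (ereal x)"
            proof (rule less_sig_iter[OF A_pos[OF x]])
              have "U y < P (n + 3)" using True by (simp add: A_iff add.assoc)
              also have "\<dots> \<le> 2 ^ 3 * U x"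
                unfolding P_Suc using x by (intro mult_mono) (auto simp: A_iff)
              finally show "U y < 2 ^ 3 * U x" .
            qed
            then show ?thesis by (simp add: t)
          qed
          moreover have "k y (X (n + 1)) \<le> ennreal D * k y x"
            using t(4) y x0 by (intro k_lower) auto
          then have "k y (X (n + 1)) * w y \<le> ennreal D * k y x * w y"
            by (rule mult_right_mono) simp
          ultimately show ?thesis
            using True y t(4) by (simp add: Cker_def ac_simps)
        qed (simp add: Cker_def)
      qed
      also have "\<dots> = ennreal D * Efun q ?h" by (rule Efun_cmult[OF m'])
      finally have "Efun q (Cker (n + 2)) epowr b \<le> (ennreal D * Efun q ?h) epowr b"
        using b_pos by (intro epowr_mono) auto
      then have "ennreal (D powr - b) * Efun q (Cker (n + 2)) epowr b \<le> Efun q ?h epowr b"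
        using D_pos by (simp add: epowr_mult epowr_ennreal ennreal_inverse_powr_le_iff)
      moreover have "Fr f (n + 2) epowr r \<le> tail f t epowr r"
        using t(3) r unfolding Fr_def tail_def
        by (intro epowr_mono nn_integral_mono) (auto simp: add.assoc split: split_indicator)
      ultimately show ?thesis
        unfolding int T_def mult.assoc[symmetric, of "ennreal (D powr - b)"]
        by (intro mult_left_mono mult_mono) auto
    qed (simp add: T_zero)
  qed
  also have "\<dots> \<le> (B0 p r q u v w k * nrm f) epowr r"
    using B_D[OF f] B unfolding B0_def by blast
  finally have "4 * zsum (\<lambda>n. emeasure mu (A n) * T (n + 2)) \<le> 4 * (B0 p r q u v w k * nrm f) epowr r"
    by (rule mult_left_mono) simp
  also have "4 * zsum (\<lambda>n. emeasure mu (A n) * T (n + 2)) = zsum (\<lambda>n. P (n + 2) * T (n + 2))"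
  proof -
    have "4 * (emeasure mu (A n) * T (n + 2)) = P (n + 2) * T (n + 2)" for n
      using mu_A_eq_if[of "n + 2 + 2" n] T_zero[of "n + 2"]
      by (cases "R (n + 2 + 2) = {}") (auto simp: P_Suc mult.assoc)
    then show ?thesis by (simp flip: zsum_cmult)
  qed
  also have "\<dots> = zsum (\<lambda>m. P m * T m)" by (rule zsum_shift)
  also have "\<dots> = ennreal (D powr - b) * zsum (\<lambda>m. P m * (Efun q (Cker m) epowr b * Fr f m epowr r))"
    by (simp only: T_def mult.left_commute[of "P _"] zsum_cmult)
  finally show ?thesis .
qed

text \<open>For x in \<open>A n\<close> the point t = \<sigma>^2(x) lies in block n + 2. Enlarging
  the interval from x_(n+1), x_(n+2) first to x_(n+1), t and then to x, t costs one D each time. The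
  shift by one block costs 2.\<close>

lemma B1_discrete:
  assumes f: "f \<in> Mplus" "nrm f < top" and B: "B1 p r q u v w k < top"
  shows "ennreal (D powr - (2 * b)) * zsum (\<lambda>m. P m * (kap m * Efun q (Gker f m)) epowr b)
    \<le> 2 * (B1 p r q u v w k * nrm f) epowr r"
proof -
  define T where "T m = ennreal (D powr - (2 * b)) * (kap m * Efun q (Gker f m)) epowr b" for m
  have T_zero: "T m = 0" if "R (m + 2) = {}" for m
    using that by (simp add: T_def Gker_def[abs_def])
  have "zsum (\<lambda>n. emeasure mu (A n) * T (n + 1)) \<le> (\<integral>\<^sup>+x. B1_integrand r q u w k f x \<partial>Leb)"
  proof (rule step_lower)
    fix n x assume x: "x \<in> A n"
    show "u x * T (n + 1) \<le> B1_integrand r q u w k f x"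
    proof (cases "R (n + 1 + 2) = {}")
      case False
      have x0: "0 \<le> x" using x A_subset[of n] by auto
      have n3: "n + int 2 + 1 = n + 3" "n + 1 + 2 = n + 3" by simp_all
      then have ne: "R (n + int 2 + 1) \<noteq> {}" using False by simp
      from sig_iter_in_A[OF x this, unfolded n3] obtain t where t: "(sig u ^^ 2) (ereal x) = ereal t"
        "0 \<le> t" "R (n + 3) \<subseteq> {t..}" "\<And>i. i \<le> n + int 2 \<Longrightarrow> X i \<le> t" "x \<le> X (n + 1)"
        by blast
      have t4: "X (n + 2) \<le> t" using t(4)[of "n + 2"] by simp
      let ?h = "\<lambda>y. indicator {t..} y * (w y * tail f y epowr g)"
      have m: "(\<lambda>y. w y * tail f y epowr g) \<in> Mplus" by (intro Mplus_mult Mplus_epowr w Mplus_tail)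
      have m': "?h \<in> Mplus" by (intro Mplus_indicator m) (use t in auto)
      have int: "B1_integrand r q u w k f x = u x * (k t x * Efun q ?h) epowr b"
        using x0 t m by (subst Efun_indicator)
          (auto simp: B1_integrand_def b_def gam_def tail_def mult.assoc epowr_mult)
      have XX: "X (n + 1) \<le> X (n + 2)"
        using R_antimono[of "n + 2" "n + 3"] ne by (intro X_mono) (auto simp: add.assoc)
      have "kap (n + 1) \<le> ennreal D * k t (X (n + 1))"
        unfolding kap_def using t4 XX X_nonneg[of "n + 1"] by (simp add: add.assoc) (intro k_lower; simp)
      also have "\<dots> \<le> ennreal D * (ennreal D * k t x)"
        using t(5) t4 XX x0 by (intro mult_left_mono k_lower) auto
      also have "\<dots> = ennreal (D powr 2) * k t x"
        using D_pos by (simp add: power2_eq_square ennreal_mult mult.assoc)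
      finally have kap: "kap (n + 1) \<le> ennreal (D powr 2) * k t x" .
      have "Efun q (Gker f (n + 1)) \<le> Efun q ?h"
        using t(3) by (intro Efun_mono kers_Mplus) (auto simp: Gker_def add.assoc split: split_indicator)
      with kap have "(kap (n + 1) * Efun q (Gker f (n + 1))) epowr b \<le> (ennreal (D powr 2) * k t x * Efun q ?h) epowr b"
        using b_pos by (intro epowr_mono mult_mono) auto
      also have "\<dots> = ennreal (D powr (2 * b)) * (k t x * Efun q ?h) epowr b"
        by (simp only: epowr_mult epowr_ennreal[OF powr_ge_zero] powr_powr mult.assoc)
      finally have "T (n + 1) \<le> (k t x * Efun q ?h) epowr b"
        unfolding T_def using D_pos by (subst ennreal_inverse_powr_le_iff) auto
      then show ?thesis unfolding int by (rule mult_left_mono) simp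
    qed (simp add: T_zero)
  qed
  also have "\<dots> \<le> (B1 p r q u v w k * nrm f) epowr r"
    using B_D[OF f] B unfolding B1_def by blast
  finally have "2 * zsum (\<lambda>n. emeasure mu (A n) * T (n + 1)) \<le> 2 * (B1 p r q u v w k * nrm f) epowr r"
    by (rule mult_left_mono) simp
  also have "2 * zsum (\<lambda>n. emeasure mu (A n) * T (n + 1)) = zsum (\<lambda>n. P (n + 1) * T (n + 1))"
  proof -
    have "2 * (emeasure mu (A n) * T (n + 1)) = P (n + 1) * T (n + 1)" for n
      using mu_A_eq_if[of "n + 1 + 2" n] T_zero[of "n + 1"]
      by (cases "R (n + 1 + 2) = {}") (auto simp: P_Suc mult.assoc)
    then show ?thesis by (simp flip: zsum_cmult)
  qed
  also have "\<dots> = zsum (\<lambda>m. P m * T m)" by (rule zsum_shift)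
  also have "\<dots> = ennreal (D powr - (2 * b)) * zsum (\<lambda>m. P m * (kap m * Efun q (Gker f m)) epowr b)"
    by (simp only: T_def mult.left_commute[of "P _"] zsum_cmult)
  finally show ?thesis .
qed

text \<open>\<open>V\<^sub>m\<close> only sees \<open>f\<close> on two consecutive blocks, so the norms of these restrictions are
  \<open>\<ell>\<^sup>p\<close>-summable.\<close>

definition fblock :: "(real \<Rightarrow> ennreal) \<Rightarrow> int \<Rightarrow> real \<Rightarrow> ennreal" where
  "fblock f m z = indicator (R m - R (m + 2)) z * f z"

lemma fblock_Mplus: "f \<in> Mplus \<Longrightarrow> fblock f m \<in> Mplus"
  unfolding fblock_def by (intro Mplus_indicator) (auto intro!: sets_completionI_sets sets.Int sets.Diff)

lemma zsum_indicator_le: "zsum (\<lambda>m. indicator (A m) z * c) \<le> c"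
proof (cases "\<exists>m. z \<in> A m")
  case True
  then show ?thesis using zsum_indicator_A[of z _ "\<lambda>_. c"] by auto
next
  case False
  then have "indicator (A m) z * c = 0" for m by simp
  then have "zsum (\<lambda>m. indicator (A m) z * c) = 0" by (simp only:) simp
  then show ?thesis by simp
qed

text \<open>Each point lies in at most one block, and \<open>fblock f m\<close> only involves blocks
  m and m + 1, so it is counted at most twice.\<close>

lemma zsum_fblock:
  assumes f: "f \<in> Mplus"
  shows "zsum (\<lambda>m. nrm (fblock f m) epowr p) \<le> 2 * nrm f epowr p"
proof -
  have m [measurable]: "(\<lambda>z. fblock f m z epowr p * v z) \<in> borel_measurable Leb" for m
    using Mplus_mult[OF Mplus_epowr[OF fblock_Mplus[OF f]] v] by (simp add: Mplus_def)
  have [measurable]: "(\<lambda>z. f z epowr p * v z) \<in> borel_measurable Leb"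
    using Mplus_mult[OF Mplus_epowr[OF f] v] by (simp add: Mplus_def)
  have "zsum (\<lambda>m. nrm (fblock f m) epowr p) = (\<integral>\<^sup>+z. zsum (\<lambda>m. fblock f m z epowr p * v z) \<partial>Leb)"
    unfolding nrm_epowr by (intro nn_integral_count_space_nn_integral[symmetric]) auto
  also have "\<dots> \<le> (\<integral>\<^sup>+z. 2 * (f z epowr p * v z) \<partial>Leb)"
  proof (rule nn_integral_mono)
    fix z
    let ?c = "f z epowr p * v z"
    have "zsum (\<lambda>m. fblock f m z epowr p * v z) \<le> zsum (\<lambda>m. indicator (A m) z * ?c + indicator (A (m + 1)) z * ?c)"
      by (rule zsum_mono) (auto simp: fblock_def A_def add.assoc split: split_indicator)
    also have "\<dots> = zsum (\<lambda>m. indicator (A m) z * ?c) + zsum (\<lambda>m. indicator (A (m + 1)) z * ?c)"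
      by (rule nn_integral_add) auto
    also have "zsum (\<lambda>m. indicator (A (m + 1)) z * ?c) = zsum (\<lambda>m. indicator (A m) z * ?c)"
      by (rule zsum_shift)
    also have "zsum (\<lambda>m. indicator (A m) z * ?c) + zsum (\<lambda>m. indicator (A m) z * ?c) \<le> ?c + ?c"
      by (intro add_mono zsum_indicator_le)
    finally show "zsum (\<lambda>m. fblock f m z epowr p * v z) \<le> 2 * ?c" by (simp add: mult_2)
  qed
  also have "\<dots> = 2 * nrm f epowr p" by (simp add: nn_integral_cmult nrm_epowr)
  finally show ?thesis .
qed

lemma nrm_fblock_le: "nrm (fblock f m) \<le> nrm f"
proof -
  have "nrm (fblock f m) epowr p \<le> nrm f epowr p"
    unfolding nrm_epowr by (intro nn_integral_mono) (auto simp: fblock_def split: split_indicator)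
  then show ?thesis using p by (simp add: epowr_mono_iff)
qed

lemma Fm_le_fblock:
  assumes "y \<in> A m"
  shows "Fm f m y \<le> (\<integral>\<^sup>+z\<in>{z. y \<le> z \<and> z \<notin> R (m + 2)}. fblock f m z \<partial>lebesgue)"
  unfolding Fm_def
proof (rule nn_integral_mono)
  fix z
  show "f z * indicator ({y..} - R (m + 2)) z \<le> fblock f m z * indicator {z. y \<le> z \<and> z \<notin> R (m + 2)} z"
    using R_up[of y m z] assms by (auto simp: fblock_def A_def split: split_indicator)
qed

text \<open>Moves the base point x_(m-1) further left to c, where the operator in \<open>B2\<close>
  has its kernel.\<close>

lemma Vker_le_wnorm:
  assumes c: "0 \<le> c" "c \<le> X (m - 1)"
    and H: "\<And>y. y \<in> A m \<Longrightarrow> Fm f m y \<le> H y"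
  shows "Efun q (Vker f m) epowr b \<le> ennreal (D powr b) * wnorm q (\<lambda>y. w y * k y c) H epowr r"
proof -
  have "Vker f m y \<le> ennreal D * (w y * k y c * H y epowr g)" for y
  proof (cases "y \<in> A m")
    case True
    have "X (m - 1) \<le> y" using True R_antimono[of "m - 1" m] by (intro X_le) (auto simp: A_def)
    then have "k y (X (m - 1)) \<le> ennreal D * k y c" using c by (intro k_lower) auto
    moreover have "Fm f m y epowr g \<le> H y epowr g" using H[OF True] g_pos by (intro epowr_mono) auto
    ultimately have "k y (X (m - 1)) * w y * Fm f m y epowr g \<le> ennreal D * k y c * w y * H y epowr g"
      by (intro mult_mono) auto
    then show ?thesis using True by (simp add: Vker_def ac_simps)
  qed (simp add: Vker_def)
  then have "ennreal (D powr - 1) * Vker f m y \<le> w y * k y c * H y epowr g" for y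
    by (rule powr_inverse_mult_le)
  then have "Efun q (\<lambda>y. ennreal (D powr - 1) * Vker f m y) \<le> Efun q (\<lambda>y. w y * k y c * H y epowr g)"
    by (intro Efun_mono Mplus_mult Mplus_const kers_Mplus)
  then have "ennreal (D powr - 1) * Efun q (Vker f m) \<le> Efun q (\<lambda>y. w y * k y c * H y epowr g)"
    by (simp only: Efun_cmult[OF kers_Mplus(3)])
  then have "Efun q (Vker f m) \<le> ennreal (D powr 1) * Efun q (\<lambda>y. w y * k y c * H y epowr g)"
    using D_pos by (subst (asm) ennreal_inverse_powr_le_iff) auto
  then have "Efun q (Vker f m) epowr b \<le> (ennreal (D powr 1) * Efun q (\<lambda>y. w y * k y c * H y epowr g)) epowr b"
    using b_pos by (intro epowr_mono) auto
  also have "\<dots> = ennreal (D powr b) * wnorm q (\<lambda>y. w y * k y c) H epowr r"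
    using D_pos by (simp add: epowr_mult epowr_ennreal wnorm_eq_Efun epowr_epowr b_def)
  finally show ?thesis .
qed

text \<open>Use t = x_(m-1) in the supremum, where U(t) is half of 2^m. The block norms are then
  summed by \<open>zsum_epowr_le\<close> with exponent r / p.\<close>

lemma B2_discrete_p_le_r:
  assumes f: "f \<in> Mplus" "nrm f < top" and B: "B2 p r q u v w k < top" and pr: "p \<le> r"
  shows "zsum (\<lambda>m. P m * Efun q (Vker f m) epowr b)
    \<le> 2 * ennreal (D powr b) * 2 epowr (r / p) * (B2 p r q u v w k * nrm f) epowr r"
proof -
  let ?B = "B2 p r q u v w k"
  have block: "P m * Efun q (Vker f m) epowr b \<le> 2 * ennreal (D powr b) * ?B epowr r * (nrm (fblock f m) epowr p) epowr (r / p)" for m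
  proof (cases "A m = {}")
    case True
    then have "Vker f m = (\<lambda>_. 0)" by (simp add: Vker_def fun_eq_iff)
    then show ?thesis by simp
  next
    case False
    define c where "c = X (m - 1)"
    have R: "R (m - 1) \<noteq> {}" using False R_antimono[of "m - 1" m] by (auto simp: A_def)
    have c: "0 < c" "U c = P (m - 1)" using X_props[OF R] by (simp_all add: c_def)
    let ?N = "opnorm (ennreal p) v q (\<lambda>y. w y * k y c) (Hstar c)"
    have "prim u c epowr (1 / r) * ?N \<le> ?B"
      using pr c(1) unfolding B2_def by (auto intro!: SUP_upper2[of c])
    then have PN: "P (m - 1) epowr (1 / r) * ?N \<le> ?B" by (simp add: c)
    then have "P (m - 1) epowr (1 / r) * ?N < top" using B by (rule le_less_trans)
    then have "?N < top" by (auto simp: ennreal_mult_less_top)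
    have Fm: "Fm f m y \<le> Hstar c (fblock f m) y" if y: "y \<in> A m" for y
    proof -
      have "c \<le> y" unfolding c_def using y R_antimono[of "m - 1" m] by (intro X_le) (auto simp: A_def)
      moreover have "(\<integral>\<^sup>+z\<in>{z. y \<le> z \<and> z \<notin> R (m + 2)}. fblock f m z \<partial>lebesgue) \<le> (\<integral>\<^sup>+z\<in>{y..}. fblock f m z \<partial>lebesgue)"
        by (intro nn_integral_mono) (auto split: split_indicator)
      ultimately show ?thesis
        using order_trans[OF Fm_le_fblock[OF y]] by (simp add: Hstar_def)
    qed
    have "P m * Efun q (Vker f m) epowr b
        \<le> P m * (ennreal (D powr b) * wnorm q (\<lambda>y. w y * k y c) (Hstar c (fblock f m)) epowr r)"
      using c by (intro mult_left_mono Vker_le_wnorm Fm) (auto simp: c_def)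
    also have "\<dots> \<le> P m * (ennreal (D powr b) * (?N * nrm (fblock f m)) epowr r)"
      using r \<open>?N < top\<close> le_less_trans[OF nrm_fblock_le f(2)] unfolding opnorm_def
      by (intro mult_left_mono epowr_mono least_constD fblock_Mplus f) auto
    also have "\<dots> = 2 * ennreal (D powr b) * (P (m - 1) epowr (1 / r) * ?N) epowr r * nrm (fblock f m) epowr r"
      using P_Suc(1)[of "m - 1"] r by (simp add: epowr_mult epowr_epowr ac_simps)
    also have "\<dots> \<le> 2 * ennreal (D powr b) * ?B epowr r * nrm (fblock f m) epowr r"
      using r by (intro mult_right_mono mult_left_mono epowr_mono PN) auto
    finally show ?thesis using p by (simp add: epowr_epowr)
  qed
  have "zsum (\<lambda>m. P m * Efun q (Vker f m) epowr b)
      \<le> zsum (\<lambda>m. 2 * ennreal (D powr b) * ?B epowr r * (nrm (fblock f m) epowr p) epowr (r / p))"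
    by (rule zsum_mono[OF block])
  also have "\<dots> = 2 * ennreal (D powr b) * ?B epowr r * zsum (\<lambda>m. (nrm (fblock f m) epowr p) epowr (r / p))"
    by (rule zsum_cmult)
  also have "\<dots> \<le> 2 * ennreal (D powr b) * ?B epowr r * (2 * nrm f epowr p) epowr (r / p)"
  proof (rule mult_left_mono)
    have "zsum (\<lambda>m. (nrm (fblock f m) epowr p) epowr (r / p)) \<le> zsum (\<lambda>m. nrm (fblock f m) epowr p) epowr (r / p)"
      using pr p by (intro zsum_epowr_le) simp
    also have "\<dots> \<le> (2 * nrm f epowr p) epowr (r / p)"
      using r p by (intro epowr_mono zsum_fblock f) auto
    finally show "zsum (\<lambda>m. (nrm (fblock f m) epowr p) epowr (r / p)) \<le> (2 * nrm f epowr p) epowr (r / p)" .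
  qed simp
  also have "\<dots> = 2 * ennreal (D powr b) * 2 epowr (r / p) * (?B * nrm f) epowr r"
    using p by (simp add: epowr_mult epowr_epowr ac_simps)
  finally show ?thesis .
qed

text \<open>For x in \<open>A (m - 1)\<close>, \<open>sig_inv u x\<close> is at most x_(m-1), the
  block \<open>A m\<close> lies before \<sigma>^2(x), and points outside \<open>R (m + 2)\<close>
  lie before \<sigma>^3(x). So each such x controls \<open>Vker\<close>; Hoelder then sums the
  blocks.\<close>

lemma B2_discrete_r_less_p:
  assumes f: "f \<in> Mplus" "nrm f < top" and B: "B2 p r q u v w k < top" and rp: "r < p"
  shows "zsum (\<lambda>m. P m * Efun q (Vker f m) epowr b)
    \<le> 4 * ennreal (D powr b) * 2 epowr (r / p) * (B2 p r q u v w k * nrm f) epowr r"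
proof -
  let ?B = "B2 p r q u v w k"
  define s where "s = 1 / max (1 / r - 1 / p) 0"
  note s = s_eqs[OF rp, folded s_def]
  \<comment> \<open>An infimum, so that it bounds the integrand of \<open>B2\<close> from below on
    the whole block.\<close>
  define I where "I m = (INF x\<in>A (m - 1). loc_norm x)" for m
  \<comment> \<open>If \<open>A m\<close> is empty, the mass of \<open>A (m - 1)\<close> may be less
    than \<open>P (m - 1)\<close>; such m contribute nothing to the left side and are set to
    0.\<close>
  define c where "c m = (if A m = {} then 0 else P (m - 1) epowr (s / r) * I m epowr s)" for m
  define d where "d m = nrm (fblock f m) epowr p" for m
  have A_prev: "emeasure mu (A (m - 1)) = P (m - 1)" "A (m - 1) \<noteq> {}" if "A m \<noteq> {}" for m
  proof -
    have R: "R (m - 1 + 1) \<noteq> {}" using that by (auto simp: A_def)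
    then show "emeasure mu (A (m - 1)) = P (m - 1)" by (rule mu_A_eq)
    then show "A (m - 1) \<noteq> {}" by auto
  qed
  have "?B = (\<integral>\<^sup>+x. (if U x = 0 then 0 else u x * U x epowr (s / p) * loc_norm x epowr s) \<partial>Leb) epowr (1 / s)"
    unfolding B2_def Let_def loc_norm_def s_def using rp by simp
  then have B_s: "?B epowr s = (\<integral>\<^sup>+x. (if U x = 0 then 0 else u x * U x epowr (s / p) * loc_norm x epowr s) \<partial>Leb)"
    using s(1) by (simp add: epowr_epowr)
  have sum_c: "zsum c \<le> ?B epowr s"
  proof -
    have "zsum c = zsum (\<lambda>n. c (n + 1))" by (rule zsum_shift[symmetric])
    also have "\<dots> \<le> zsum (\<lambda>n. emeasure mu (A n) * (P n epowr (s / p) * I (n + 1) epowr s))"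
    proof (rule zsum_mono)
      fix n
      have "P n epowr (s / r) = P n * P n epowr (s / p)"
        using epowr_add[of "P n" 1 "s / p"] by (simp add: s(3))
      then show "c (n + 1) \<le> emeasure mu (A n) * (P n epowr (s / p) * I (n + 1) epowr s)"
        using A_prev(1)[of "n + 1"] by (auto simp: c_def mult.assoc)
    qed
    also have "\<dots> \<le> ?B epowr s"
      unfolding B_s
    proof (rule step_lower)
      fix n x assume x: "x \<in> A n"
      have "P n epowr (s / p) * I (n + 1) epowr s \<le> U x epowr (s / p) * loc_norm x epowr s"
        using x s(1) p by (intro mult_mono epowr_mono) (auto simp: A_iff I_def intro: INF_lower)
      then have "u x * (P n epowr (s / p) * I (n + 1) epowr s) \<le> u x * (U x epowr (s / p) * loc_norm x epowr s)"
        by (rule mult_left_mono) simp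
      then show "u x * (P n epowr (s / p) * I (n + 1) epowr s) \<le> (if U x = 0 then 0 else u x * U x epowr (s / p) * loc_norm x epowr s)"
        using A_pos[OF x] by (simp add: mult.assoc)
    qed
    finally show ?thesis .
  qed
  have block: "P m * Efun q (Vker f m) epowr b \<le> 2 * ennreal (D powr b) * (c m epowr (r / s) * d m epowr (r / p))" for m
  proof (cases "A m = {}")
    case True
    then have "Vker f m = (\<lambda>_. 0)" by (simp add: Vker_def fun_eq_iff)
    then show ?thesis by simp
  next
    case False
    have loc: "Efun q (Vker f m) epowr b \<le> ennreal (D powr b) * (loc_norm x * nrm (fblock f m)) epowr r"
      if x: "x \<in> A (m - 1)" "loc_norm x < top" for x
    proof -
      have Ux: "0 < U x" using A_pos[OF x(1)] .
      define a where "a = sig_inv u x"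
      have a: "0 < a" "U a = U x / 2" using sig_inv_props[OF Ux] by (simp_all add: a_def)
      have "a \<le> X (m - 1)"
      proof -
        have "U a < P (m - 1)"
        proof -
          have "U x < P (m - 1) * 2" using x(1) P_Suc(1)[of "m - 1"] by (simp add: A_iff mult.commute)
          then have "U x / 2 < P (m - 1)" by (simp add: divide_less_ennreal)
          then show ?thesis by (simp add: a)
        qed
        also have "\<dots> = U (X (m - 1))"
        proof -
          have "R (m - 1) \<noteq> {}" using False R_antimono[of "m - 1" m] by (auto simp: A_def)
          then show ?thesis by (simp add: X_props(1))
        qed
        finally show ?thesis using less_if_U_less less_imp_le by blast
      qed
      let ?H = "Hstar_between u a ((sig u ^^ 2) (ereal x)) (fblock f m)"
      have H: "Fm f m y \<le> ?H y" if y: "y \<in> A m" for y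
      proof -
        have "a \<le> y"
          using \<open>a \<le> X (m - 1)\<close> X_le[of y "m - 1"] y R_antimono[of "m - 1" m] by (auto simp: A_def)
        moreover have "ereal y < (sig u ^^ 2) (ereal x)"
        proof (rule less_sig_iter[OF Ux])
          have "U y < P (m - 1 + 2)" using y by (simp add: A_iff add.commute)
          also have "\<dots> \<le> 2 ^ 2 * U x"
            unfolding P_Suc using x(1) by (intro mult_mono) (auto simp: A_iff)
          finally show "U y < 2 ^ 2 * U x" .
        qed
        moreover have "(\<integral>\<^sup>+z\<in>{z. y \<le> z \<and> z \<notin> R (m + 2)}. fblock f m z \<partial>lebesgue)
            \<le> (\<integral>\<^sup>+z\<in>{z. y \<le> z \<and> ereal z \<le> sig u ((sig u ^^ 2) (ereal x))}. fblock f m z \<partial>lebesgue)"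
        proof (rule nn_integral_mono)
          fix z
          have "ereal z \<le> sig u ((sig u ^^ 2) (ereal x))" if "z \<notin> R (m + 2)"
          proof -
            have "ereal z < (sig u ^^ 3) (ereal x)"
            proof (rule less_sig_iter[OF Ux])
              have "U z < P (m - 1 + 3)" using that by (simp add: R_iff not_le add.commute)
              also have "\<dots> \<le> 2 ^ 3 * U x"
                unfolding P_Suc using x(1) by (intro mult_mono) (auto simp: A_iff)
              finally show "U z < 2 ^ 3 * U x" .
            qed
            then show ?thesis by (simp add: numeral_3_eq_3 numeral_2_eq_2)
          qed
          then show "fblock f m z * indicator {z. y \<le> z \<and> z \<notin> R (m + 2)} z
              \<le> fblock f m z * indicator {z. y \<le> z \<and> ereal z \<le> sig u ((sig u ^^ 2) (ereal x))} z"
            by (auto split: split_indicator)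
        qed
        ultimately show ?thesis
          using order_trans[OF Fm_le_fblock[OF y]] by (simp add: Hstar_between_def)
      qed
      have "Efun q (Vker f m) epowr b \<le> ennreal (D powr b) * wnorm q (\<lambda>y. w y * k y a) ?H epowr r"
        using a \<open>a \<le> X (m - 1)\<close> by (intro Vker_le_wnorm H) auto
      also have "\<dots> \<le> ennreal (D powr b) * (loc_norm x * nrm (fblock f m)) epowr r"
        using r x(2) le_less_trans[OF nrm_fblock_le f(2)] unfolding loc_norm_def opnorm_def a_def
        by (intro mult_left_mono epowr_mono least_constD fblock_Mplus f) auto
      finally show ?thesis .
    qed
    have I_top: "I m < top"
    proof -
      have "c m \<le> zsum c" by (rule zsum_ge)
      also have "\<dots> < top" using sum_c B by (auto intro: le_less_trans)
      finally show ?thesis using False by (auto simp: c_def ennreal_mult_less_top)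
    qed
    have "Efun q (Vker f m) epowr b \<le> ennreal (D powr b) * (I m * nrm (fblock f m)) epowr r"
    proof -
      \<comment> \<open>Y puts the local bound into a form linear in \<open>loc_norm x\<close>, so
        one can divide by the norm of the block and pass to the infimum, which need not be
        attained.\<close>
      define Y where "Y = (ennreal (D powr - b) * Efun q (Vker f m) epowr b) epowr (1 / r)"
      have Y_iff: "Y \<le> Z \<longleftrightarrow> Efun q (Vker f m) epowr b \<le> ennreal (D powr b) * Z epowr r" for Z
        using D_pos r by (simp add: Y_def epowr_le_iff ennreal_inverse_powr_le_iff)
      define n where "n = nrm (fblock f m)"
      have n_top: "n < top" using le_less_trans[OF nrm_fblock_le f(2)] by (simp add: n_def)
      have Y_le: "Y \<le> loc_norm x * n" if "x \<in> A (m - 1)" "loc_norm x < top" for x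
        using loc[OF that] by (simp add: Y_iff n_def)
      obtain x0 where x0: "x0 \<in> A (m - 1)" "loc_norm x0 < top"
        using I_top by (auto simp: I_def INF_less_iff)
      have "Y \<le> I m * n"
      proof (cases "n = 0")
        case True
        then show ?thesis using Y_le[OF x0] by simp
      next
        case False
        then have "0 < n" using zero_less_iff_neq_zero by blast
        have "Y / n \<le> loc_norm x" if "x \<in> A (m - 1)" for x
          using Y_le[OF that] \<open>0 < n\<close>
          by (cases "loc_norm x = top") (auto simp: less_top[symmetric] mult.commute intro!: divide_le_posI_ennreal)
        then have "Y / n \<le> I m" unfolding I_def by (rule INF_greatest)
        then have "Y / n * n \<le> I m * n" by (rule mult_right_mono) simp
        moreover have "Y / n * n = Y"
          using False n_top by (simp add: ennreal_divide_times mult_divide_eq_ennreal flip: ennreal_times_divide)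
        ultimately show ?thesis by simp
      qed
      then show ?thesis by (simp add: Y_iff n_def)
    qed
    then have "P m * Efun q (Vker f m) epowr b \<le> P m * (ennreal (D powr b) * (I m * nrm (fblock f m)) epowr r)"
      by (rule mult_left_mono) simp
    also have "\<dots> = 2 * ennreal (D powr b) * (P (m - 1) * I m epowr r * nrm (fblock f m) epowr r)"
      using P_Suc(1)[of "m - 1"] by (simp add: epowr_mult ac_simps)
    also have "P (m - 1) * I m epowr r * nrm (fblock f m) epowr r = c m epowr (r / s) * d m epowr (r / p)"
      using False p s(1) r by (simp add: c_def d_def epowr_mult epowr_epowr)
    finally show ?thesis .
  qed
  have d_sum: "zsum d \<le> 2 * nrm f epowr p" unfolding d_def by (rule zsum_fblock[OF f(1)])
  have "zsum (\<lambda>m. P m * Efun q (Vker f m) epowr b)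
      \<le> zsum (\<lambda>m. 2 * ennreal (D powr b) * (c m epowr (r / s) * d m epowr (r / p)))"
    by (rule zsum_mono[OF block])
  also have "\<dots> = 2 * ennreal (D powr b) * zsum (\<lambda>m. c m epowr (r / s) * d m epowr (r / p))"
    by (rule zsum_cmult)
  also have "\<dots> \<le> 2 * ennreal (D powr b) * (2 * (zsum c epowr (r / s) * zsum d epowr (r / p)))"
  proof (intro mult_left_mono zsum_Holder)
    show "zsum c < top" using sum_c B by (auto intro: le_less_trans)
    have "2 * nrm f epowr p < top" using f(2) by (simp add: ennreal_mult_less_top)
    then show "zsum d < top" using le_less_trans[OF d_sum] by blast
  qed (use s r p in auto)
  also have "\<dots> \<le> 2 * ennreal (D powr b) * (2 * ((?B epowr s) epowr (r / s) * (2 * nrm f epowr p) epowr (r / p)))"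
    using s(1) r p by (intro mult_left_mono mult_mono epowr_mono sum_c d_sum) auto
  also have "\<dots> = 4 * ennreal (D powr b) * 2 epowr (r / p) * (?B * nrm f) epowr r"
  proof -
    have "2 * a * (2 * (b * (c * d))) = 4 * a * c * (b * d)" for a b c d :: ennreal
    proof -
      have "2 * a * (2 * (b * (c * d))) = (2 * 2) * (a * c * (b * d))" by (simp only: ac_simps)
      then show ?thesis by (simp add: mult.assoc)
    qed
    then show ?thesis using s(1) p by (simp add: epowr_mult epowr_epowr)
  qed
  finally show ?thesis .
qed

end

text \<open>The constants of \<open>S_integral_le\<close>, \<open>Eker_le\<close> and the discrete
  conditions, kept explicit to show that they do not involve the weights or the kernel beyond
  D.\<close>

definition suff_const :: "real \<Rightarrow> real \<Rightarrow> real \<Rightarrow> real \<Rightarrow> nat \<Rightarrow> real \<Rightarrow> ennreal" where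
  "suff_const D p r b N l =
    ennreal (D ^ (N + 2)) epowr b * (ennreal (1 / (1 - 1 / l)) epowr b * ennreal (1 / (1 - l powr (2 * b) / 2))) *
    2 epowr b * (2 epowr r * 2 epowr b * (4 * ennreal (D powr b) * 2 epowr (r / p) + ennreal (D powr b) * 4)
      + ennreal (D powr (2 * b)) * 2)"

lemma suff_const_less_top: "suff_const D p r b N l < top"
  by (simp add: suff_const_def ennreal_mult_less_top)

text \<open>The summands belong to \<open>B0\<close>, \<open>B1\<close> and, in parentheses,
  \<open>B2\<close>, where the cases p \<le> r and r < p are added to obtain one formula.\<close>

definition nec_const :: "real \<Rightarrow> real \<Rightarrow> real \<Rightarrow> ennreal \<Rightarrow> ennreal" where
  "nec_const D p r q = (let e = ennreal (D powr - (1 / gam q)) in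
    1 + inverse e + (inverse e + inverse (((e / 2) epowr r / 4) epowr (1 / r)) * 2 epowr (1 / p)))"

lemma nec_const_aux:
  assumes "0 < e" "e < top"
  shows "0 < ((e / 2) epowr r / 4) epowr (1 / r)" "((e / 2) epowr r / 4) epowr (1 / r) < top"
proof -
  obtain d where "e = ennreal d" "0 < d" using assms by (cases e) auto
  then show "0 < ((e / 2) epowr r / 4) epowr (1 / r)" "((e / 2) epowr r / 4) epowr (1 / r) < top"
    by (simp_all add: ennreal_divide_numeral epowr_ennreal)
qed

lemma nec_const_less_top:
  assumes "0 < D"
  shows "nec_const D p r q < top"
proof -
  have e: "0 < ennreal (D powr - (1 / gam q))" using assms by simp
  have inv: "inverse x < top" if "0 < x" for x :: ennreal
    using that by (auto simp: less_top[symmetric])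
  show ?thesis
    using inv[OF e] inv[OF nec_const_aux(1)[OF e]]
    by (auto simp: nec_const_def Let_def ennreal_mult_less_top)
qed

section \<open>Both inequalities with explicit constants\<close>

context setting
begin

lemma C_S_le:
  assumes N: "1 \<le> N" "D \<le> l ^ N" and l: "1 < l" "l powr (2 * b) < 2"
  defines "B \<equiv> B0 p r q u v w k + B1 p r q u v w k + B2 p r q u v w k"
  assumes B: "B < top"
  shows "CS \<le> suff_const D p r b N l epowr (1 / r) * B"
  unfolding CS_alt
proof (rule least_const_leI)
  fix f assume f: "f \<in> Mplus" "nrm f < top"
  have Bi: "B0 p r q u v w k < top" "B1 p r q u v w k < top" "B2 p r q u v w k < top"
    using B by (simp_all add: B_def)
  define Y where "Y = (B * nrm f) epowr r"
  have le_Y: "(Bi * nrm f) epowr r \<le> Y" if "Bi \<le> B" for Bi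
    unfolding Y_def using that r by (intro epowr_mono mult_right_mono) auto
  let ?V = "zsum (\<lambda>m. P m * Efun q (Vker f m) epowr b)"
  let ?C = "zsum (\<lambda>m. P m * (Efun q (Cker m) epowr b * Fr f m epowr r))"
  let ?E = "zsum (\<lambda>m. P m * Efun q (Eker f m) epowr b)"
  let ?G = "zsum (\<lambda>m. P m * (kap m * Efun q (Gker f m)) epowr b)"
  let ?K = "ennreal (D ^ (N + 2)) epowr b * (ennreal (1 / (1 - 1 / l)) epowr b * ennreal (1 / (1 - l powr (2 * b) / 2))) *
    2 epowr b"
  have C: "?C \<le> ennreal (D powr b) * 4 * Y"
  proof -
    have "?C \<le> ennreal (D powr b) * (4 * (B0 p r q u v w k * nrm f) epowr r)"
      using B0_discrete[OF f Bi(1)] D_pos by (simp add: ennreal_inverse_powr_le_iff)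
    also have "\<dots> \<le> ennreal (D powr b) * (4 * Y)"
      by (intro mult_left_mono le_Y) (auto simp: B_def add_increasing2 add.assoc)
    finally show ?thesis by (simp add: mult.assoc)
  qed
  have G: "?G \<le> ennreal (D powr (2 * b)) * 2 * Y"
  proof -
    have "?G \<le> ennreal (D powr (2 * b)) * (2 * (B1 p r q u v w k * nrm f) epowr r)"
      using B1_discrete[OF f Bi(2)] D_pos by (simp add: ennreal_inverse_powr_le_iff)
    also have "\<dots> \<le> ennreal (D powr (2 * b)) * (2 * Y)"
      by (intro mult_left_mono le_Y) (auto simp: B_def add_increasing add_increasing2)
    finally show ?thesis by (simp add: mult.assoc)
  qed
  have V: "?V \<le> 4 * ennreal (D powr b) * 2 epowr (r / p) * Y"
  proof -
    have "?V \<le> 4 * ennreal (D powr b) * 2 epowr (r / p) * (B2 p r q u v w k * nrm f) epowr r"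
    proof (cases "p \<le> r")
      case True
      note B2_discrete_p_le_r[OF f Bi(3) True]
      also have "2 * ennreal (D powr b) * 2 epowr (r / p) * (B2 p r q u v w k * nrm f) epowr r
          \<le> 4 * ennreal (D powr b) * 2 epowr (r / p) * (B2 p r q u v w k * nrm f) epowr r"
        by (intro mult_right_mono) auto
      finally show ?thesis .
    qed (use B2_discrete_r_less_p[OF f Bi(3)] in simp)
    also have "\<dots> \<le> 4 * ennreal (D powr b) * 2 epowr (r / p) * Y"
      by (intro mult_left_mono le_Y) (auto simp: B_def add_increasing)
    finally show ?thesis .
  qed
  have "?E \<le> zsum (\<lambda>m. 2 epowr r * 2 epowr b * (P m * Efun q (Vker f m) epowr b + P m * (Efun q (Cker m) epowr b * Fr f m epowr r)))"
  proof (rule zsum_mono)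
    fix m
    from mult_left_mono[OF Eker_le[OF f(1), of m], of "P m"]
    show "P m * Efun q (Eker f m) epowr b
        \<le> 2 epowr r * 2 epowr b * (P m * Efun q (Vker f m) epowr b + P m * (Efun q (Cker m) epowr b * Fr f m epowr r))"
      by (simp only: zero_le mult.left_commute[of "P m"] distrib_left)
  qed
  also have "\<dots> = 2 epowr r * 2 epowr b * (?V + ?C)"
    by (subst zsum_cmult) (simp add: nn_integral_add)
  also have "\<dots> \<le> 2 epowr r * 2 epowr b * (4 * ennreal (D powr b) * 2 epowr (r / p) * Y + ennreal (D powr b) * 4 * Y)"
    by (intro mult_left_mono add_mono V C) simp
  finally have E: "?E \<le> 2 epowr r * 2 epowr b * (4 * ennreal (D powr b) * 2 epowr (r / p) * Y + ennreal (D powr b) * 4 * Y)" .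
  have "(\<integral>\<^sup>+x. u x * S f x epowr r \<partial>Leb) \<le> ?K * (?E + ?G)"
    by (rule S_integral_le[OF N l])
  also have "\<dots> \<le> ?K * (2 epowr r * 2 epowr b * (4 * ennreal (D powr b) * 2 epowr (r / p) * Y + ennreal (D powr b) * 4 * Y)
      + ennreal (D powr (2 * b)) * 2 * Y)"
    by (intro mult_left_mono add_mono E G) simp
  also have "\<dots> = suff_const D p r b N l * Y"
    by (simp only: suff_const_def distrib_left distrib_right mult.assoc)
  finally have "(\<integral>\<^sup>+x. u x * S f x epowr r \<partial>Leb) \<le> suff_const D p r b N l * Y" .
  then have "(\<integral>\<^sup>+x. u x * S f x epowr r \<partial>Leb) epowr (1 / r) \<le> (suff_const D p r b N l * Y) epowr (1 / r)"
    using r by (intro epowr_mono) auto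
  also have "\<dots> = suff_const D p r b N l epowr (1 / r) * B * nrm f"
    using r by (simp add: epowr_mult[of "suff_const _ _ _ _ _ _"] Y_def epowr_epowr mult.assoc)
  finally show "(\<integral>\<^sup>+x. u x * S f x epowr r \<partial>Leb) epowr (1 / r) \<le> suff_const D p r b N l epowr (1 / r) * B * nrm f" .
qed

lemma B_le:
  "B0 p r q u v w k + B1 p r q u v w k + B2 p r q u v w k \<le> nec_const D p r q * CS"
proof -
  have div: "B \<le> inverse c * C" if "c * B \<le> C" "0 < c" "c < top" for B c C :: ennreal
  proof -
    have "inverse c * c = 1"
      using that by (simp add: ennreal_divide_self mult.commute[of "inverse c"] flip: divide_ennreal_def)
    then show ?thesis
      using mult_left_mono[OF that(1), of "inverse c"] by (simp flip: mult.assoc)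
  qed
  let ?c = "((e / 2) epowr r / 4) epowr (1 / r)"
  have c: "0 < ?c" "?c < top"
    using nec_const_aux[of e r] e_pos by auto
  have 1: "B1 p r q u v w k \<le> inverse e * CS"
    using B1_le e_pos(1,2) unfolding e_def by (rule div)
  have "B2 p r q u v w k \<le> inverse e * CS + inverse ?c * 2 epowr (1 / p) * CS"
  proof (cases "p \<le> r")
    case True
    have "B2 p r q u v w k \<le> inverse e * CS"
      using B2_le_if_p_le_r[OF True] e_pos by (intro div) auto
    then show ?thesis by (simp add: add_increasing2)
  next
    case False
    then have "B2 p r q u v w k \<le> inverse ?c * (2 epowr (1 / p) * CS)"
      using B2_le_if_r_less_p c by (intro div) auto
    then show ?thesis by (simp add: add_increasing mult.assoc)
  qed
  then have "B0 p r q u v w k + B1 p r q u v w k + B2 p r q u v w k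
      \<le> 1 * CS + inverse e * CS + (inverse e * CS + inverse ?c * 2 epowr (1 / p) * CS)"
    by (intro add_mono B0_le 1)
  also have "\<dots> = nec_const D p r q * CS"
    by (simp only: nec_const_def Let_def e_def distrib_right)
  finally show ?thesis .
qed

end

section \<open>Constants independent of the weights and the kernel\<close>

theorem theorem4p2:
  fixes p r D :: real and q :: ennreal
  assumes "1 \<le> p" and "0 < r" and "0 < q" and "1 \<le> D"
  shows "\<exists>c1 c2 :: real. 0 < c1 \<and> 0 < c2 \<and>
    (\<forall>u v w :: real \<Rightarrow> ennreal. \<forall>k :: real \<Rightarrow> real \<Rightarrow> ennreal.
       u \<in> Mplus \<longrightarrow> v \<in> Mplus \<longrightarrow> w \<in> Mplus \<longrightarrow>
       (\<forall>t>0. (\<integral>\<^sup>+x\<in>{0..t}. u x \<partial>lebesgue) < \<infinity>) \<longrightarrow>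
       oinarov_kernel D k \<longrightarrow>
       (let B = B0 p r q u v w k + B1 p r q u v w k + B2 p r q u v w k in
         (C_S p r q u v w k < \<infinity> \<longleftrightarrow> B < \<infinity>) \<and>
         C_S p r q u v w k \<le> ennreal c1 * B \<and>
         B \<le> ennreal c2 * C_S p r q u v w k))"
proof -
  define b where "b = r / gam q"
  have b: "0 < b" using assms gam_pos by (simp add: b_def)
  \<comment> \<open>Chosen so that \<open>l powr (2 * b)\<close> is the square root of 2, below the
    bound 2 required for the geometric series.\<close>
  define l :: real where "l = 2 powr (1 / (4 * b))"
  have l: "1 < l" "l powr (2 * b) < 2"
  proof -
    show "1 < l" using b by (simp add: l_def)
    have "l powr (2 * b) = 2 powr (1 / 2)" using b by (simp add: l_def powr_powr)
    also have "\<dots> < 2 powr 1" by (rule powr_less_mono) auto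
    finally show "l powr (2 * b) < 2" by simp
  qed
  obtain N0 where N0: "D < l ^ N0" using real_arch_pow[OF l(1)] by blast
  define N where "N = Suc N0"
  have N: "1 \<le> N" "D \<le> l ^ N"
  proof -
    have "l ^ N0 \<le> l ^ N" using l(1) by (intro power_increasing) (auto simp: N_def)
    then show "D \<le> l ^ N" using N0 by simp
  qed (simp add: N_def)
  define K1 where "K1 = suff_const D p r b N l epowr (1 / r)"
  define K2 where "K2 = nec_const D p r q"
  \<comment> \<open>Adding 1 makes the real constants positive, as the statement demands and as
    infinite right sides require.\<close>
  define c1 where "c1 = enn2real K1 + 1"
  define c2 where "c2 = enn2real K2 + 1"
  have c: "0 < c1" "0 < c2" by (auto simp: c1_def c2_def add_nonneg_pos)
  have le: "K \<le> ennreal (enn2real K + 1)" if "K < top" for K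
    using that by (cases K) (auto intro: ennreal_leI)
  have "K1 < top" "K2 < top"
    unfolding K1_def K2_def using suff_const_less_top nec_const_less_top[of D p r q] assms by auto
  then have K: "K1 \<le> ennreal c1" "K2 \<le> ennreal c2"
    unfolding c1_def c2_def by (simp_all add: le)
  show ?thesis
  proof (rule exI[of _ c1], rule exI[of _ c2], intro conjI allI impI c)
    fix u v w :: "real \<Rightarrow> ennreal" and k :: "real \<Rightarrow> real \<Rightarrow> ennreal"
    assume h: "u \<in> Mplus" "v \<in> Mplus" "w \<in> Mplus"
      "\<forall>t>0. (\<integral>\<^sup>+x\<in>{0..t}. u x \<partial>lebesgue) < \<infinity>" "oinarov_kernel D k"
    interpret S: setting u D k p r q v w
      using assms h by unfold_locales auto
    have S_b: "S.b = b" by (simp add: S.b_def b_def)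
    define B where "B = B0 p r q u v w k + B1 p r q u v w k + B2 p r q u v w k"
    define C where "C = C_S p r q u v w k"
    have 1: "C \<le> ennreal c1 * B"
    proof (cases "B < top")
      case True
      have "C \<le> K1 * B"
        using S.C_S_le[OF N l(1)] l(2) True by (simp add: C_def B_def K1_def S_b)
      also have "\<dots> \<le> ennreal c1 * B" by (intro mult_right_mono K) simp
      finally show ?thesis .
    next
      case False
      then show ?thesis using c by (simp add: less_top[symmetric] ennreal_mult_top)
    qed
    have 2: "B \<le> ennreal c2 * C"
    proof -
      have "B \<le> K2 * C" using S.B_le by (simp add: B_def C_def K2_def)
      also have "\<dots> \<le> ennreal c2 * C" by (intro mult_right_mono K) simp
      finally show ?thesis .
    qed
    have "C < \<infinity> \<longleftrightarrow> B < \<infinity>"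
      using le_less_trans[OF 1, of \<infinity>] le_less_trans[OF 2, of \<infinity>]
      by (auto simp: ennreal_mult_less_top)
    with 1 2 show "let B = B0 p r q u v w k + B1 p r q u v w k + B2 p r q u v w k in
        (C_S p r q u v w k < \<infinity> \<longleftrightarrow> B < \<infinity>) \<and>
        C_S p r q u v w k \<le> ennreal c1 * B \<and> B \<le> ennreal c2 * C_S p r q u v w k"
      unfolding Let_def B_def C_def by blast
  qed
qed

end
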